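(* Let $n\ge1$. There is a constant $C>0$, depending only on $n$, such that for all $t\in\mathbb{R}$ and all $\phi_1,\phi_2\in L^2(\mathbb{R}^n)$, \[ \left(\int_K\int_K\left|\langle e^{it\Delta}\rho(k_1)\phi_1,\rho(k_2)\phi_2\rangle\right|^2\,\mathrm{d}k_1\,\mathrm{d}k_2\right)^{1/2}\le C\,(1+|t|)^{-n/2}\,\|\phi_1\|_2\|\phi_2\|_2 . \]
   Context: $G=\mathrm{Sp}(n,\mathbb{R})$ is the group of real $2n\times2n$ matrices $S$ with $S^TJS=J$, where $J=\begin{pmatrix} 0 & I \\ -I & 0 \end{pmatrix}$, and $K=\mathrm{Sp}(n,\mathbb{R})\cap\mathrm{O}(2n,\mathbb{R})$ (isomorphic to the unitary group $\mathrm{U}(n,\mathbb{C})$ via $A+iB\mapsto\begin{pmatrix} A & -B \\ B & A \end{pmatrix}$), with Haar measure of total mass 1. $\langle\cdot,\cdot\rangle$ is the inner product of $L^2(\mathbb{R}^n)$, and $e^{it\Delta}$ is the propagator of the free Schr\"odinger equation on $\mathbb{R}^n$ ($\Delta$ the Laplacian). $\rho:G\to\mathcal{U}(L^2(\mathbb{R}^n))$ is the (projective) metaplectic representation: $\rho(g)$ is the unitary operator, determined up to a scalar of modulus 1, such that $W(\rho(g)\phi_1,\rho(g)\phi_2)(z)=W(\phi_1,\phi_2)(g^{-1}z)$ for all $\phi_1,\phi_2\in L^2(\mathbb{R}^n)$ and $z\in\mathbb{C}^n$, where $z=x+iy\in\mathbb{C}^n$ is identified with $(x,y)\in\mathbb{R}^{2n}$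 (as a column vector) and \[ W(\phi_1,\phi_2)(x+iy)=(2\pi)^{-n/2}\int_{\mathbb{R}^n}e^{-is\cdot y}\phi_1(x+\tfrac s2)\overline{\phi_2(x-\tfrac s2)}\,\mathrm{d}s \] is the cross-Wigner distribution. *)

theory Defs
  imports "HOL-Analysis.Analysis"
begin

type_synonym 'n fn = "real ^ 'n \<Rightarrow> complex"
type_synonym 'n sqmat = "real ^ ('n + 'n) ^ ('n + 'n)"

text \<open>
  $L^2(\mathbb{R}^n)$ is handled through its Borel representatives; equality of elements is
  equality almost everywhere with respect to \<^const>\<open>lborel\<close>.
\<close>

definition L2 :: "('n::finite) fn set" where
  "L2 = {f. f \<in> borel_measurable lborel \<and> integrable lborel (\<lambda>x. (cmod (f x))\<^sup>2)}"

definition L2_inner :: "('n::finite) fn \<Rightarrow> 'n fn \<Rightarrow> complex" where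
  "L2_inner f g = (LINT x|lborel. f x * cnj (g x))"

definition L2_norm :: "('n::finite) fn \<Rightarrow> real" where
  "L2_norm f = sqrt (LINT x|lborel. (cmod (f x))\<^sup>2)"

text \<open>
  Unitary operators. Compatibility with almost everywhere equality is a consequence of
  linearity and preservation of the inner product.
\<close>

definition unitary_L2 :: "(('n::finite) fn \<Rightarrow> 'n fn) \<Rightarrow> bool" where
  "unitary_L2 U \<longleftrightarrow>
     (\<forall>f\<in>L2. U f \<in> L2) \<and>
     (\<forall>f\<in>L2. \<forall>g\<in>L2. \<forall>a b.
        AE x in lborel. U (\<lambda>y. a * f y + b * g y) x = a * U f x + b * U g x) \<and>
     (\<forall>f\<in>L2. \<forall>g\<in>L2. L2_inner (U f) (U g) = L2_inner f g) \<and>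
     (\<forall>g\<in>L2. \<exists>f\<in>L2. AE x in lborel. U f x = g x)"

text \<open>
  Phase space is \<^typ>\<open>real ^ ('n + 'n)\<close>: for $z = x + iy$ the \<^const>\<open>Inl\<close> coordinates are $x$,
  the \<^const>\<open>Inr\<close> coordinates are $y$.
\<close>

definition re_part :: "real ^ ('n::finite + 'n) \<Rightarrow> real ^ 'n" where
  "re_part z = (\<chi> i. z $ Inl i)"

definition im_part :: "real ^ ('n::finite + 'n) \<Rightarrow> real ^ 'n" where
  "im_part z = (\<chi> i. z $ Inr i)"

definition cross_wigner :: "('n::finite) fn \<Rightarrow> 'n fn \<Rightarrow> real ^ ('n + 'n) \<Rightarrow> complex" where
  "cross_wigner f g z =
     complex_of_real ((2 * pi) powr (- real CARD('n) / 2)) *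
     (LINT s|lborel. exp (- \<i> * complex_of_real (s \<bullet> im_part z)) *
        f (re_part z + s /\<^sub>R 2) * cnj (g (re_part z - s /\<^sub>R 2)))"

definition sympl_J :: "('n::finite) sqmat" where
  "sympl_J = (\<chi> i j. case (i, j) of
      (Inl a, Inr b) \<Rightarrow> if a = b then 1 else 0
    | (Inr a, Inl b) \<Rightarrow> if a = b then - 1 else 0
    | _ \<Rightarrow> 0)"

definition Sp :: "('n::finite) sqmat set" where
  "Sp = {S. transpose S ** sympl_J ** S = sympl_J}"

definition Sp_K :: "('n::finite) sqmat set" where
  "Sp_K = Sp \<inter> {S. orthogonal_matrix S}"

text \<open>
  A metaplectic representation is any choice, for every \<open>g\<close>, of a unitary operator satisfying
  the covariance property; the choice is free up to a scalar of modulus 1.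
\<close>

definition metaplectic_rep :: "(('n::finite) sqmat \<Rightarrow> 'n fn \<Rightarrow> 'n fn) \<Rightarrow> bool" where
  "metaplectic_rep \<rho> \<longleftrightarrow>
     (\<forall>g\<in>Sp. unitary_L2 (\<rho> g) \<and>
        (\<forall>f1\<in>L2. \<forall>f2\<in>L2. \<forall>z.
           cross_wigner (\<rho> g f1) (\<rho> g f2) z = cross_wigner f1 f2 (matrix_inv g *v z)))"

text \<open>
  Normalized Haar measure on the compact group \<^const>\<open>Sp_K\<close>: the left-invariant Borel probability
  measure (finite Borel measures on a compact metric space are automatically regular).
\<close>

definition haar_K :: "('n::finite) sqmat measure \<Rightarrow> bool" where
  "haar_K \<mu> \<longleftrightarrow>
     sets \<mu> = sets (restrict_space borel Sp_K) \<and>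
     emeasure \<mu> Sp_K = 1 \<and>
     (\<forall>k\<in>Sp_K. \<forall>A\<in>sets \<mu>. emeasure \<mu> ((**) k ` A) = emeasure \<mu> A)"

text \<open>
  \<open>L2_fourier f h\<close>: \<open>h\<close> is the Fourier--Plancherel transform of \<open>f\<close>, i.e. the $L^2$-limit of
  $(2\pi)^{-n/2} \int_{|x| \le R} e^{-i x\cdot\xi} f(x)\,dx$ as $R \to \infty$.
\<close>

definition L2_fourier :: "('n::finite) fn \<Rightarrow> 'n fn \<Rightarrow> bool" where
  "L2_fourier f h \<longleftrightarrow> f \<in> L2 \<and> h \<in> L2 \<and>
     ((\<lambda>R. \<integral>\<^sup>+ \<xi>. ennreal ((cmod (h \<xi> -
          complex_of_real ((2 * pi) powr (- real CARD('n) / 2)) *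
          (LINT x:cball 0 R|lborel. exp (- \<i> * complex_of_real (x \<bullet> \<xi>)) * f x)))\<^sup>2) \<partial>lborel)
       \<longlongrightarrow> 0) at_top"

text \<open>
  \<open>U t\<close> is $e^{it\Delta}$, defined by the functional calculus of the Laplacian: since $\Delta$ acts
  on the Fourier side as multiplication by $-|\xi|^2$, it is the Fourier multiplier
  with symbol $e^{-it|\xi|^2}$.
\<close>

definition free_schroedinger_propagator :: "(real \<Rightarrow> ('n::finite) fn \<Rightarrow> 'n fn) \<Rightarrow> bool" where
  "free_schroedinger_propagator U \<longleftrightarrow>
     (\<forall>t. \<forall>f\<in>L2. \<exists>h. L2_fourier f h \<and>
        L2_fourier (U t f) (\<lambda>\<xi>. exp (- \<i> * complex_of_real (t * (norm \<xi>)\<^sup>2)) * h \<xi>))"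

end

(* The matrix coefficients of e^(it Laplacian) in the basis of Hermite functions factorise into the
   one-dimensional numbers b_ml = INT exp(-i t x^2) h_m(x) h_l(x) dx. Integration by parts gives a
   recurrence for them governed by the unitary matrix with rows (q-1, q) and (q, q-1), where
   q = 1/(1+it). Hence the sum of |b_ml|^2 over m + l = M depends only on the parity of M, and
   |b_ml| <= (1+t^2)^(-1/4).

   Smoothing Wigner covariance by Gaussians, which is possible since K acts orthogonally on phase
   space, shows that K acts on coherent state coefficients by change of variables, up to a scalar. In
   particular the diagonal torus of K multiplies the Hermite coefficients of rho(k) phi by characters
   that separate the Hermite indices, so by invariance of Haar measure the coefficients at different
   indices are orthogonal in L^2(K). Expanding in Hermite functions, the double average becomes a sum,
   over pairs of indices, of squared coefficients of the propagator weighted by masses of total at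
   most |phi_1|^2 |phi_2|^2, and only the supremum bound (1+t^2)^(-n/4) matters. *)
theory Submission
  imports Defs "HOL-Probability.Characteristic_Functions"
begin

section \<open>Gaussian integrals and Hermite functions on the line\<close>

text \<open>\<open>metaplectic_rep\<close> determines each operator only up to a scalar and says
  nothing about its dependence on the group element; neither multiplicativity nor measurability of
  \<open>\<rho>\<close> is given. Everything therefore passes through coherent state coefficients:
  they determine an L2 function, \<open>Sp_K\<close> acts on them by an explicit continuous change
  of variables, and the Gaussian ground state, which every element of \<open>Sp_K\<close> fixes up
  to a scalar, supplies the normalisation that removes the undetermined phase. Squared moduli do not
  see that phase, so it is divided out before measurability and orthogonality are discussed.

  Completeness of the Hermite functions has the same source. A Gaussian weight in the momentum
  variable makes the coherent state resolution of the identity absolutely convergent. Its limit and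
  its uniform bound carry one and the same constant, and this equality of constants turns Bessel's
  inequality into Parseval's identity.\<close>

lemma gauss_integral_std:
  fixes c :: complex
  shows "has_bochner_integral lborel
    (\<lambda>x::real. exp (- (of_real x)\<^sup>2 / 2 + c * of_real x)) (of_real (sqrt (2*pi)) * exp (c\<^sup>2 / 2))"
proof -
  define a b where "a = Re c" and "b = Im c"
  have c: "c = of_real a + \<i> * of_real b" by (simp add: a_def b_def complex_eq)
  have i0: "integrable lborel (\<lambda>x. std_normal_density x *\<^sub>R iexp (b * x))"
    by (rule Bochner_Integration.integrable_bound[OF integrable_normal_density[of 1 0]])
       (auto simp: std_normal_density_def)
  \<comment> \<open>The characteristic function of the standard normal distribution accounts for the
    imaginary part of \<open>c\<close>; the real part is then produced by translating the variable
    by \<open>a\<close>.\<close>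
  have "(LINT x|std_normal_distribution. iexp (b * x)) = exp (- b\<^sup>2 / 2)"
    using fun_cong[OF char_std_normal_distribution, of b] by (simp add: char_def exp_of_real)
  then have v0: "(LINT x|lborel. std_normal_density x *\<^sub>R iexp (b * x)) = exp (- b\<^sup>2 / 2)"
    by (subst (asm) integral_density) auto
  have h0: "has_bochner_integral lborel (\<lambda>x. std_normal_density x *\<^sub>R iexp (b * x)) (exp (- b\<^sup>2 / 2))"
    using i0 v0 by (simp add: has_bochner_integral_iff)
  have h1: "has_bochner_integral lborel (\<lambda>x. std_normal_density (-a + 1*x) *\<^sub>R iexp (b * (-a + 1*x)))
     (exp (- b\<^sup>2 / 2) /\<^sub>R \<bar>1\<bar>)"
    using lborel_has_bochner_integral_real_affine_iff[of 1 "\<lambda>x. std_normal_density x *\<^sub>R iexp (b * x)" "complex_of_real (exp (- b\<^sup>2 / 2))" "-a"] h0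
    by simp
  have h2: "has_bochner_integral lborel (\<lambda>x. (of_real (sqrt (2*pi)) * exp (of_real (a\<^sup>2/2) + \<i> * of_real (a * b))) * (std_normal_density (-a + 1*x) *\<^sub>R iexp (b * (-a + 1*x))))
     ((of_real (sqrt (2*pi)) * exp (of_real (a\<^sup>2/2) + \<i> * of_real (a * b))) * (exp (- b\<^sup>2 / 2) /\<^sub>R \<bar>1\<bar>))"
    by (rule has_bochner_integral_mult_right, rule h1)
  have e1: "(of_real (sqrt (2*pi)) * exp (of_real (a\<^sup>2/2) + \<i> * of_real (a * b))) * (std_normal_density (-a + 1*x) *\<^sub>R iexp (b * (-a + 1*x)))
    = exp (- (of_real x)\<^sup>2 / 2 + c * of_real x)" for x :: real
  proof -
    have "exp (of_real (a\<^sup>2/2) + \<i> * of_real (a * b)) * (exp (of_real (- (x - a)\<^sup>2 / 2)) * iexp (b * (-a + 1*x)))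
      = exp (- (of_real x)\<^sup>2 / 2 + c * of_real x)"
      unfolding exp_add[symmetric] by (rule arg_cong[where f=exp]) (simp add: c power2_eq_square field_simps)
    moreover have "(of_real (sqrt (2*pi)) * E) * (std_normal_density (-a + 1*x) *\<^sub>R F) = E * (exp (of_real (- (x - a)\<^sup>2 / 2)) * F)" for E F :: complex
      unfolding std_normal_density_def scaleR_conv_of_real exp_of_real by simp
    ultimately show ?thesis by simp
  qed
  have e2: "((of_real (sqrt (2*pi)) * exp (of_real (a\<^sup>2/2) + \<i> * of_real (a * b))) * (exp (- b\<^sup>2 / 2) /\<^sub>R \<bar>1\<bar>))
    = of_real (sqrt (2*pi)) * exp (c\<^sup>2 / 2)"
  proof -
    have "exp (of_real (a\<^sup>2/2) + \<i> * of_real (a * b)) * exp (of_real (- b\<^sup>2 / 2)) = exp (c\<^sup>2 / 2)"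
      unfolding exp_add[symmetric] by (rule arg_cong[where f=exp]) (simp add: c power2_eq_square field_simps)
    moreover have "complex_of_real (exp (- b\<^sup>2 / 2)) = exp (of_real (- b\<^sup>2 / 2))" by (simp only: exp_of_real)
    ultimately show ?thesis by (simp del: of_real_minus of_real_divide of_real_power)
  qed
  show ?thesis using h2 unfolding e1 e2 .
qed

lemma gauss_integral:
  fixes c :: complex and A :: real
  assumes A: "A > 0"
  shows "has_bochner_integral lborel
    (\<lambda>x::real. exp (- (of_real A) * (of_real x)\<^sup>2 + c * of_real x))
    (of_real (sqrt (pi/A)) * exp (c\<^sup>2 / (4 * of_real A)))"
proof -
  define r where "r = sqrt (2*A)"
  have r: "r > 0" "r * r = 2 * A" using A by (auto simp: r_def)
  have r2: "complex_of_real r * of_real r = 2 * of_real A" unfolding of_real_mult[symmetric] r by simp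
  let ?f = "\<lambda>x::real. exp (- (of_real x)\<^sup>2 / 2 + (c / of_real r) * of_real x)"
  let ?v = "of_real (sqrt (2*pi)) * exp ((c / of_real r)\<^sup>2 / 2)"
  have "has_bochner_integral lborel (\<lambda>x. ?f (0 + r * x)) (?v /\<^sub>R \<bar>r\<bar>)"
    using lborel_has_bochner_integral_real_affine_iff[of r ?f "?v" 0] gauss_integral_std[of "c / of_real r"] r
    by simp
  moreover have "?f (0 + r * x) = exp (- (of_real A) * (of_real x)\<^sup>2 + c * of_real x)" for x
    using r r2 by (intro arg_cong[where f=exp]) (simp add: power2_eq_square algebra_simps)
  moreover have "?v /\<^sub>R \<bar>r\<bar> = of_real (sqrt (pi/A)) * exp (c\<^sup>2 / (4 * of_real A))"
  proof -
    have "sqrt (2 * pi) / r = sqrt (pi / A)" using A by (simp add: r_def real_sqrt_divide[symmetric] real_sqrt_mult)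
    then have "sqrt (pi / A) = sqrt (2*pi) / r" by simp
    moreover have "(c / of_real r)\<^sup>2 / 2 = c\<^sup>2 / (4 * of_real A)"
      using r2 A by (simp add: power2_eq_square)
    ultimately show ?thesis using r by (simp only: scaleR_conv_of_real) (simp add: field_simps del: power_divide)
  qed
  ultimately show ?thesis by simp
qed

lemma gauss_integral_real:
  fixes c A :: real
  assumes A: "A > 0"
  shows "has_bochner_integral lborel (\<lambda>x::real. exp (- A * x\<^sup>2 + c * x)) (sqrt (pi/A) * exp (c\<^sup>2 / (4 * A)))"
proof -
  have "has_bochner_integral lborel (\<lambda>x::real. complex_of_real (exp (- A * x\<^sup>2 + c * x))) (of_real (sqrt (pi/A) * exp (c\<^sup>2 / (4 * A))))"
    using gauss_integral[OF A, of "of_real c"] by (simp add: exp_of_real[symmetric])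
  from has_bochner_integral_Re[OF this] show ?thesis by simp
qed

section \<open>Functions with Gaussian decay, and integration by parts\<close>

definition gauss_decay :: "(real \<Rightarrow> complex) \<Rightarrow> bool" where
  "gauss_decay g \<longleftrightarrow> continuous_on UNIV g \<and> (\<exists>C K. \<forall>x. cmod (g x) \<le> C * exp (K * \<bar>x\<bar> - x\<^sup>2/4))"

lemma gauss_decayI:
  assumes "continuous_on UNIV g" "\<And>x. cmod (g x) \<le> C * exp (K * \<bar>x\<bar> - x\<^sup>2/4)"
  shows "gauss_decay g"
  using assms unfolding gauss_decay_def by blast

text \<open>The linear term in the exponent of \<open>gauss_decay\<close> exists for this closure
  property: polynomials and exponentials can be multiplied in without leaving the class, so every
  derivative met in an integration by parts below stays in it.\<close>

lemma gauss_decay_mult_exp: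
  assumes "gauss_decay g" "continuous_on UNIV f" "\<And>x. cmod (f x) \<le> C * exp (K * \<bar>x\<bar>)"
  shows "gauss_decay (\<lambda>x. f x * g x)"
proof -
  obtain C' K' where g: "continuous_on UNIV g" "\<And>x. cmod (g x) \<le> C' * exp (K' * \<bar>x\<bar> - x\<^sup>2/4)"
    using assms unfolding gauss_decay_def by blast
  show ?thesis
  proof (rule gauss_decayI)
    show "continuous_on UNIV (\<lambda>x. f x * g x)" using assms g by (intro continuous_intros)
    fix x
    have "cmod (f x * g x) \<le> (C * exp (K * \<bar>x\<bar>)) * (C' * exp (K' * \<bar>x\<bar> - x\<^sup>2/4))"
      unfolding norm_mult by (intro mult_mono assms g) (use order_trans[OF norm_ge_zero assms(3)] in auto)
    also have "\<dots> = (C * C') * exp ((K + K') * \<bar>x\<bar> - x\<^sup>2/4)"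
      by (simp add: exp_diff distrib_right exp_add)
    finally show "cmod (f x * g x) \<le> (C * C') * exp ((K + K') * \<bar>x\<bar> - x\<^sup>2/4)" .
  qed
qed

lemma gauss_decay_cmult: "gauss_decay g \<Longrightarrow> gauss_decay (\<lambda>x. c * g x)"
  by (rule gauss_decay_mult_exp[where C="cmod c" and K=0]) auto

lemma gauss_decay_add:
  assumes "gauss_decay f" "gauss_decay g"
  shows "gauss_decay (\<lambda>x. f x + g x)"
proof -
  obtain C K where f: "continuous_on UNIV f" "\<And>x. cmod (f x) \<le> C * exp (K * \<bar>x\<bar> - x\<^sup>2/4)"
    using assms unfolding gauss_decay_def by blast
  obtain C' K' where g: "continuous_on UNIV g" "\<And>x. cmod (g x) \<le> C' * exp (K' * \<bar>x\<bar> - x\<^sup>2/4)"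
    using assms unfolding gauss_decay_def by blast
  have C: "C \<ge> 0" "C' \<ge> 0"
    using order_trans[OF norm_ge_zero f(2)[of 0]] order_trans[OF norm_ge_zero g(2)[of 0]] by auto
  show ?thesis
  proof (rule gauss_decayI)
    show "continuous_on UNIV (\<lambda>x. f x + g x)" using f g by (intro continuous_intros)
    fix x
    have "cmod (f x + g x) \<le> C * exp (K * \<bar>x\<bar> - x\<^sup>2/4) + C' * exp (K' * \<bar>x\<bar> - x\<^sup>2/4)"
      by (rule order_trans[OF norm_triangle_ineq add_mono[OF f(2) g(2)]])
    also have "\<dots> \<le> C * exp (max K K' * \<bar>x\<bar> - x\<^sup>2/4) + C' * exp (max K K' * \<bar>x\<bar> - x\<^sup>2/4)"
      using C by (intro add_mono mult_left_mono) (auto intro!: mult_right_mono)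
    finally show "cmod (f x + g x) \<le> (C + C') * exp (max K K' * \<bar>x\<bar> - x\<^sup>2/4)" by (simp add: algebra_simps)
  qed
qed

lemma gauss_decay_diff:
  assumes "gauss_decay f" "gauss_decay g"
  shows "gauss_decay (\<lambda>x. f x - g x)"
  using gauss_decay_add[OF assms(1) gauss_decay_cmult[OF assms(2), of "-1"]] by simp

lemma abs_le_exp_abs: "\<bar>x\<bar> \<le> exp \<bar>x::real\<bar>"
  using exp_ge_add_one_self[of "\<bar>x\<bar>"] by linarith

lemma gauss_decay_mult_id: "gauss_decay g \<Longrightarrow> gauss_decay (\<lambda>x. of_real x * g x)"
  by (rule gauss_decay_mult_exp[where C=1 and K=1]) (auto intro!: continuous_intros abs_le_exp_abs)

text \<open>Half of the decay rate pays for the linear term: K|x| <= 2K^2 + x^2/8, by completing the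
  square.\<close>

lemma gauss_decay_bound:
  assumes "gauss_decay g"
  obtains C where "\<And>x. cmod (g x) \<le> C * exp (- (1/8) * x\<^sup>2)"
proof -
  obtain C K where g: "\<And>x. cmod (g x) \<le> C * exp (K * \<bar>x\<bar> - x\<^sup>2/4)"
    using assms unfolding gauss_decay_def by blast
  have C: "C \<ge> 0" using order_trans[OF norm_ge_zero g[of 0]] by auto
  have "cmod (g x) \<le> (C * exp (2*K\<^sup>2)) * exp (- (1/8) * x\<^sup>2)" for x
  proof -
    have "0 \<le> (K - \<bar>x\<bar>/4)\<^sup>2" by simp
    then have "0 \<le> K\<^sup>2 + x\<^sup>2/16 - K * \<bar>x\<bar> / 2"
      by (simp add: power2_eq_square field_simps)
    then have "K * \<bar>x\<bar> - x\<^sup>2/4 \<le> 2*K\<^sup>2 + - (1/8) * x\<^sup>2"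
      by (simp add: field_simps)
    then have "exp (K * \<bar>x\<bar> - x\<^sup>2/4) \<le> exp (2*K\<^sup>2) * exp (- (1/8) * x\<^sup>2)"
      unfolding exp_add[symmetric] by simp
    with C have "C * exp (K * \<bar>x\<bar> - x\<^sup>2/4) \<le> C * (exp (2*K\<^sup>2) * exp (- (1/8) * x\<^sup>2))" by (intro mult_left_mono)
    with g[of x] show ?thesis by (simp add: mult.assoc)
  qed
  then show ?thesis using that by blast
qed

lemma gauss_decay_integrable:
  assumes "gauss_decay g"
  shows "integrable lborel g"
proof -
  obtain C where C: "\<And>x. cmod (g x) \<le> C * exp (- (1/8) * x\<^sup>2)" using gauss_decay_bound[OF assms] by blast
  have "integrable lborel (\<lambda>x::real. exp (- (1/8) * x\<^sup>2))"
    using gauss_integral_real[of "1/8" 0] by (simp add: has_bochner_integral_iff)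
  then have "integrable lborel (\<lambda>x::real. C * exp (- (1/8) * x\<^sup>2))" by simp
  moreover have "g \<in> borel_measurable lborel"
    using assms by (auto simp: gauss_decay_def intro: borel_measurable_continuous_onI)
  ultimately show ?thesis
    by (rule Bochner_Integration.integrable_bound) (use C in \<open>auto intro!: AE_I2 intro: order_trans[OF _ abs_ge_self]\<close>)
qed

lemma gauss_decay_tendsto:
  assumes "gauss_decay g" and F: "F = at_top \<or> F = at_bot"
  shows "(g \<longlongrightarrow> 0) F"
proof -
  obtain C where C: "\<And>x. cmod (g x) \<le> C * exp (- (1/8) * x\<^sup>2)" using gauss_decay_bound[OF assms(1)] by blast
  have "((\<lambda>x::real. C * exp (- (1/8) * x\<^sup>2)) \<longlongrightarrow> 0) F"
  proof -
    have "filterlim (\<lambda>x::real. x\<^sup>2) at_top F"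
      using F filterlim_pow_at_bot_even[of 2 "\<lambda>x. x" at_bot] filterlim_pow_at_top[of 2 "\<lambda>x. x" at_top]
      by (auto simp: filterlim_ident)
    then have "filterlim (\<lambda>x::real. - (1/8) * x\<^sup>2) at_bot F"
      by (intro filterlim_tendsto_neg_mult_at_bot[where c="-(1/8)"]) auto
    then have "((\<lambda>x::real. exp (- (1/8) * x\<^sup>2)) \<longlongrightarrow> 0) F"
      by (rule filterlim_compose[OF exp_at_bot])
    then show ?thesis using tendsto_mult_right_zero by blast
  qed
  then show ?thesis by (rule Lim_null_comparison[rotated]) (use C in auto)
qed

text \<open>The form taken by every integration by parts below: a product is differentiated, the
  boundary terms vanish, and a linear relation between integrals remains.\<close>

lemma integral_derivative_eq_zero:
  assumes g: "gauss_decay g" and g': "gauss_decay g'"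
    and d: "\<And>x. (g has_vector_derivative g' x) (at x)"
  shows "(LINT x|lborel. g' x) = 0"
proof -
  have "(LBINT x=-\<infinity>..\<infinity>. g' x) = 0 - 0"
  proof (rule interval_integral_FTC_integrable)
    show "isCont g' x" for x using g' by (auto simp: gauss_decay_def continuous_on_eq_continuous_at)
    show "set_integrable lborel (einterval (-\<infinity>) \<infinity>) g'"
      using gauss_decay_integrable[OF g'] by (simp add: set_integrable_def)
    show "((g \<circ> real_of_ereal) \<longlongrightarrow> 0) (at_right (-\<infinity>))"
      using gauss_decay_tendsto[OF g, of at_bot] by (simp add: ereal_tendsto_simps)
    show "((g \<circ> real_of_ereal) \<longlongrightarrow> 0) (at_left \<infinity>)"
      using gauss_decay_tendsto[OF g, of at_top] by (simp add: ereal_tendsto_simps)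
  qed (use d in auto)
  then show ?thesis by (simp add: interval_lebesgue_integral_def set_lebesgue_integral_def)
qed

section \<open>One-dimensional Hermite functions\<close>

lemma pi_powr_quarter_square: "pi powr (-1/4) * pi powr (-1/4) = 1 / sqrt pi"
proof -
  have "pi powr (-1/4) * pi powr (-1/4) = pi powr (-1/4 + -1/4)" by (rule powr_add[symmetric])
  also have "\<dots> = pi powr (- (1/2))" by simp
  also have "\<dots> = 1 / sqrt pi" by (subst powr_minus_divide) (simp add: powr_half_sqrt)
  finally show ?thesis .
qed

lemma sqrt_power_eq_powr: "x > 0 \<Longrightarrow> sqrt x ^ n = x powr (real n / 2)"
  by (simp add: powr_half_sqrt[symmetric] powr_power)

text \<open>The $L^2$-normalised Hermite functions. In their recurrences the truncated index
  \<open>n - 1\<close> at \<open>n = 0\<close> is harmless: its coefficient vanishes.\<close>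

fun herm :: "nat \<Rightarrow> real \<Rightarrow> real" where
  "herm 0 x = pi powr (-1/4) * exp (- x\<^sup>2/2)"
| "herm (Suc 0) x = sqrt 2 * x * (pi powr (-1/4) * exp (- x\<^sup>2/2))"
| "herm (Suc (Suc n)) x = (sqrt 2 * x * herm (Suc n) x - sqrt (Suc n) * herm n x) / sqrt (Suc (Suc n))"

lemma herm_rec: "sqrt 2 * x * herm n x = sqrt (Suc n) * herm (Suc n) x + sqrt n * herm (n - 1) x"
  by (cases n) (auto simp: field_simps)

lemma herm_abs:
  "herm 0 = (\<lambda>x. pi powr (-1/4) * exp (- x\<^sup>2/2))"
  "herm (Suc 0) = (\<lambda>x. sqrt 2 * x * (pi powr (-1/4) * exp (- x\<^sup>2/2)))"
  "herm (Suc (Suc n)) = (\<lambda>x. (sqrt 2 * x * herm (Suc n) x - sqrt (Suc n) * herm n x) / sqrt (Suc (Suc n)))"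
  by (auto simp: fun_eq_iff)

text \<open>The ladder relation. As the functions are given by a three-term recurrence, it is
  obtained by differentiating that recurrence, with an induction over two consecutive
  indices.\<close>

lemma herm_deriv:
  "(herm n has_real_derivative (sqrt n * herm (n-1) x - sqrt (Suc n) * herm (Suc n) x) / sqrt 2) (at x)"
proof (induction n arbitrary: x rule: induct_nat_012)
  case 0
  have "((\<lambda>x. pi powr (-1/4) * exp (- x\<^sup>2/2)) has_real_derivative - x * herm 0 x) (at x)"
    by (auto intro!: derivative_eq_intros)
  moreover have "- x * herm 0 x = (sqrt 0 * herm (0 - 1) x - sqrt (Suc 0) * herm (Suc 0) x) / sqrt 2"
    by simp
  ultimately show ?case unfolding herm_abs(1)[symmetric] by (simp del: herm.simps)
next
  case 1
  have "((\<lambda>x. sqrt 2 * x * (pi powr (-1/4) * exp (- x\<^sup>2/2))) has_real_derivative sqrt 2 * herm 0 x - x * herm 1 x) (at x)"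
    by (auto intro!: derivative_eq_intros simp: algebra_simps power2_eq_square)
  moreover have "sqrt 2 * herm 0 x - x * herm 1 x = (sqrt (Suc 0) * herm (Suc 0 - 1) x - sqrt (Suc (Suc 0)) * herm (Suc (Suc 0)) x) / sqrt 2"
    using herm_rec[of x 1] by (simp add: field_simps)
  ultimately show ?case unfolding herm_abs(2)[symmetric] by (simp del: herm.simps)
next
  case (ge2 n)
  have "((\<lambda>x. (sqrt 2 * x * herm (Suc n) x - sqrt (Suc n) * herm n x) / sqrt (Suc (Suc n))) has_real_derivative
    (sqrt 2 * herm (Suc n) x + sqrt 2 * x * ((sqrt (Suc n) * herm n x - sqrt (Suc (Suc n)) * herm (Suc (Suc n)) x) / sqrt 2)
      - sqrt (Suc n) * ((sqrt n * herm (n-1) x - sqrt (Suc n) * herm (Suc n) x) / sqrt 2)) / sqrt (Suc (Suc n))) (at x)"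
  proof -
    have i: "((\<lambda>x. sqrt 2 * x) has_real_derivative sqrt 2) (at x)" using DERIV_cmult_Id by blast
    from DERIV_cdivide[OF DERIV_diff[OF DERIV_mult[OF i ge2(2)] DERIV_cmult[OF ge2(1)]]]
    show ?thesis by (rule DERIV_cong) (simp add: mult.commute del: herm.simps)
  qed
  moreover have "(sqrt 2 * herm (Suc n) x + sqrt 2 * x * ((sqrt (Suc n) * herm n x - sqrt (Suc (Suc n)) * herm (Suc (Suc n)) x) / sqrt 2)
      - sqrt (Suc n) * ((sqrt n * herm (n-1) x - sqrt (Suc n) * herm (Suc n) x) / sqrt 2)) / sqrt (Suc (Suc n))
    = (sqrt (Suc (Suc n)) * herm (Suc n) x - sqrt (Suc (Suc (Suc n))) * herm (Suc (Suc (Suc n))) x) / sqrt 2"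
  proof -
    define a b c d s t u where "a = herm n x" and "b = herm (Suc n) x" and "c = herm (Suc (Suc n)) x"
      and "d = herm (Suc (Suc (Suc n))) x" and "s = sqrt (Suc n)" and "t = sqrt (Suc (Suc n))" and "u = sqrt (Suc (Suc (Suc n)))"
    have r0: "sqrt n * herm (n-1) x = sqrt 2 * x * a - s * b" using herm_rec[of x n] by (simp add: a_def b_def s_def)
    have r2: "sqrt 2 * x * c = u * d + t * b" using herm_rec[of x "Suc (Suc n)"] by (simp add: d_def b_def c_def t_def u_def del: herm.simps)
    have st: "s * s = Suc n" "t * t = Suc (Suc n)" "t > 0" by (auto simp: s_def t_def)
    \<comment> \<open>With denominators cleared, the terms in \<open>x * a\<close> cancel,
      \<open>r2\<close> removes \<open>x * c\<close>, and what remains is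
      \<open>s * s + 1 = t * t\<close>.\<close>
    have "2 * b + sqrt 2 * x * (s * a - t * c) - s * (sqrt 2 * x * a - s * b - s * b) = t * (t * b - u * d)"
    proof -
      have "2 * b + sqrt 2 * x * (s * a - t * c) - s * (sqrt 2 * x * a - s * b - s * b)
        = 2 * b - t * (sqrt 2 * x * c) + 2 * ((s * s) * b)" by (simp add: algebra_simps)
      also have "\<dots> = 2 * b - t * (u * d + t * b) + 2 * ((s * s) * b)" unfolding r2 ..
      also have "\<dots> = 2 * ((s * s + 1) * b) - t * u * d - t * t * b" by (simp add: algebra_simps)
      also have "\<dots> = t * (t * b - u * d)" using st by (simp add: algebra_simps)
      finally show ?thesis .
    qed
    then have "(2 * b + sqrt 2 * x * (s * a - t * c) - s * (sqrt 2 * x * a - s * b - s * b)) / (t * sqrt 2) = (t * b - u * d) / sqrt 2"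
      using st by simp
    moreover have "(sqrt 2 * b + sqrt 2 * x * ((s * a - t * c) / sqrt 2) - s * ((sqrt 2 * x * a - s * b - s * b) / sqrt 2)) / t
      = (2 * b + sqrt 2 * x * (s * a - t * c) - s * (sqrt 2 * x * a - s * b - s * b)) / (t * sqrt 2)"
      using st by (simp add: field_simps)
    ultimately show ?thesis unfolding r0 a_def b_def c_def d_def s_def t_def u_def by simp
  qed
  ultimately show ?case unfolding herm_abs(3)[of n, symmetric] by (simp del: herm.simps)
qed

lemma herm_cont [continuous_intros]: "continuous_on UNIV (herm n)"
  by (auto intro!: continuous_at_imp_continuous_on DERIV_isCont[OF herm_deriv])

lemma herm_bound: "\<exists>C\<ge>0. \<exists>K. \<forall>x. \<bar>herm n x\<bar> \<le> C * exp (K * \<bar>x\<bar> - x\<^sup>2/2)"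
proof (induction n rule: induct_nat_012)
  case 0
  show ?case by (rule exI[of _ "pi powr (-1/4)"], auto intro!: exI[of _ 0])
next
  case 1
  have "\<bar>herm (Suc 0) x\<bar> \<le> (sqrt 2 * pi powr (-1/4)) * exp (1 * \<bar>x\<bar> - x\<^sup>2/2)" for x
  proof -
    have "\<bar>x\<bar> * (sqrt 2 * pi powr (-1/4) * exp (- x\<^sup>2/2)) \<le> exp \<bar>x\<bar> * (sqrt 2 * pi powr (-1/4) * exp (- x\<^sup>2/2))"
      by (intro mult_right_mono abs_le_exp_abs) auto
    moreover have "exp (1 * \<bar>x\<bar> - x\<^sup>2/2) = exp \<bar>x\<bar> * exp (- x\<^sup>2/2)" by (simp add: mult_exp_exp)
    ultimately show ?thesis by (simp add: abs_mult mult_ac)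
  qed
  then show ?case by (intro exI[of _ "sqrt 2 * pi powr (-1/4)"] conjI exI[of _ 1]) (auto simp del: herm.simps)
next
  case (ge2 n)
  then obtain C K C' K' where C: "C \<ge> 0" "C' \<ge> 0" and b: "\<And>x. \<bar>herm (Suc n) x\<bar> \<le> C * exp (K * \<bar>x\<bar> - x\<^sup>2/2)"
    "\<And>x. \<bar>herm n x\<bar> \<le> C' * exp (K' * \<bar>x\<bar> - x\<^sup>2/2)" by blast
  define L where "L = max (K+1) K'"
  have "\<bar>herm (Suc (Suc n)) x\<bar> \<le> (sqrt 2 * C + sqrt (Suc n) * C') * exp (L * \<bar>x\<bar> - x\<^sup>2/2)" for x
  proof -
    have s: "sqrt (Suc (Suc n)) \<ge> 1" by simp
    have "\<bar>herm (Suc (Suc n)) x\<bar> \<le> \<bar>sqrt 2 * x * herm (Suc n) x - sqrt (Suc n) * herm n x\<bar>"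
      using s by (simp add: abs_divide divide_le_eq mult_le_cancel_left1 del: real_sqrt_ge_1_iff)
    also have "\<dots> \<le> \<bar>sqrt 2 * x * herm (Suc n) x\<bar> + \<bar>sqrt (Suc n) * herm n x\<bar>" by linarith
    also have "\<dots> = sqrt 2 * (\<bar>x\<bar> * \<bar>herm (Suc n) x\<bar>) + sqrt (Suc n) * \<bar>herm n x\<bar>" by (simp add: abs_mult)
    also have "\<dots> \<le> sqrt 2 * (exp \<bar>x\<bar> * (C * exp (K * \<bar>x\<bar> - x\<^sup>2/2))) + sqrt (Suc n) * (C' * exp (K' * \<bar>x\<bar> - x\<^sup>2/2))"
      using C by (intro add_mono mult_left_mono mult_mono b abs_le_exp_abs) auto
    also have "\<dots> = sqrt 2 * C * exp ((K + 1) * \<bar>x\<bar> - x\<^sup>2/2) + sqrt (Suc n) * C' * exp (K' * \<bar>x\<bar> - x\<^sup>2/2)"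
      by (simp add: exp_diff exp_add distrib_right mult.assoc mult.left_commute[of _ C])
    also have "\<dots> \<le> sqrt 2 * C * exp (L * \<bar>x\<bar> - x\<^sup>2/2) + sqrt (Suc n) * C' * exp (L * \<bar>x\<bar> - x\<^sup>2/2)"
      using C by (intro add_mono mult_left_mono) (auto simp: L_def intro!: mult_right_mono)
    finally show ?thesis by (simp add: algebra_simps)
  qed
  then show ?case using C by (intro exI[of _ "sqrt 2 * C + sqrt (Suc n) * C'"] conjI exI[of _ L]) auto
qed

lemma gauss_decay_herm: "gauss_decay (\<lambda>x. of_real (herm n x))"
proof -
  obtain C K where b: "C \<ge> 0" "\<And>x. \<bar>herm n x\<bar> \<le> C * exp (K * \<bar>x\<bar> - x\<^sup>2/2)" using herm_bound by blast
  show ?thesis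
  proof (rule gauss_decayI)
    show "continuous_on UNIV (\<lambda>x. complex_of_real (herm n x))" by (intro continuous_intros)
    have "C * exp (K * \<bar>x\<bar> - x\<^sup>2/2) \<le> C * exp (K * \<bar>x\<bar> - x\<^sup>2/4)" for x
      using b by (intro mult_left_mono) auto
    then show "cmod (complex_of_real (herm n x)) \<le> C * exp (K * \<bar>x\<bar> - x\<^sup>2/4)" for x
      using b(2)[of x] order_trans by fastforce
  qed
qed

text \<open>Boundedness, in the shape that \<open>gauss_decay_mult_exp\<close> expects when
  \<open>K\<close> is 0.\<close>

lemma herm_exp_bound: "\<exists>C. \<forall>x. cmod (of_real (herm n x)) \<le> C * exp (0 * \<bar>x\<bar>)"
proof -
  obtain C where C: "\<And>x. cmod (of_real (herm n x)) \<le> C * exp (- (1/8) * x\<^sup>2)"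
    using gauss_decay_bound[OF gauss_decay_herm[of n]] by blast
  have C0: "C \<ge> 0" using order_trans[OF norm_ge_zero C[of 0]] by simp
  have "cmod (of_real (herm n x)) \<le> C * exp (0 * \<bar>x\<bar>)" for x
  proof -
    have "C * exp (- (1/8) * x\<^sup>2) \<le> C * exp (0 * \<bar>x\<bar>)" using C0 by (intro mult_left_mono) auto
    with C[of x] show ?thesis by linarith
  qed
  then show ?thesis by blast
qed

abbreviation hermC :: "nat \<Rightarrow> real \<Rightarrow> complex" where
  "hermC n x \<equiv> complex_of_real (herm n x)"

lemma hermC_rec:
  "of_real (sqrt 2) * of_real x * hermC n x
    = of_real (sqrt (Suc n)) * hermC (Suc n) x + of_real (sqrt n) * hermC (n - 1) x"
  unfolding of_real_mult[symmetric] of_real_add[symmetric] herm_rec ..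

lemma hermC_deriv:
  "((\<lambda>x. hermC n x) has_vector_derivative
     (of_real (sqrt n) * hermC (n-1) x - of_real (sqrt (Suc n)) * hermC (Suc n) x) / of_real (sqrt 2)) (at x)"
  using has_vector_derivative_of_real[OF herm_deriv[of n x], where 'a=complex] by simp

text \<open>The raising term is traded for multiplication by \<open>x\<close>. This suits integrands
  with a factor exp(-x^2/2): there the two multiples of \<open>x\<close> and the lowered term
  combine into the next Hermite function.\<close>

lemma hermC_deriv':
  "((\<lambda>x. hermC n x) has_vector_derivative
     (of_real (sqrt 2) * of_real (sqrt n) * hermC (n-1) x - of_real x * hermC n x)) (at x)"
proof -
  have s: "of_real (sqrt 2) * of_real (sqrt 2) = (2::complex)" by (simp flip: of_real_mult)
  have "(of_real (sqrt n) * hermC (n-1) x - of_real (sqrt (Suc n)) * hermC (Suc n) x)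
      = 2 * of_real (sqrt n) * hermC (n-1) x - of_real (sqrt 2) * of_real x * hermC n x"
    unfolding hermC_rec by simp
  also have "\<dots> = of_real (sqrt 2) * (of_real (sqrt 2) * of_real (sqrt n) * hermC (n-1) x - of_real x * hermC n x)"
    by (simp add: algebra_simps flip: s)
  finally show ?thesis using hermC_deriv[of n x] by simp
qed

lemma gauss_decay_herm_exp:
  "gauss_decay (\<lambda>x. exp (c * of_real x) * hermC n x)"
proof (rule gauss_decay_mult_exp[OF gauss_decay_herm])
  show "continuous_on UNIV (\<lambda>x. exp (c * complex_of_real x))" by (intro continuous_intros)
  show "cmod (exp (c * of_real x)) \<le> 1 * exp (\<bar>Re c\<bar> * \<bar>x\<bar>)" for x
    by (simp add: abs_mult[symmetric])
qed

lemma gauss_decay_herm_gauss_exp: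
  assumes "A \<ge> 0"
  shows "gauss_decay (\<lambda>x. exp (- of_real A * (of_real x)\<^sup>2 + c * of_real x) * hermC n x)"
proof -
  have "gauss_decay (\<lambda>x. exp (- of_real A * (of_real x)\<^sup>2) * (exp (c * of_real x) * hermC n x))"
  proof (rule gauss_decay_mult_exp[OF gauss_decay_herm_exp, where C=1 and K=0])
    show "continuous_on UNIV (\<lambda>x. exp (- complex_of_real A * (of_real x)\<^sup>2))" by (intro continuous_intros)
    show "cmod (exp (- complex_of_real A * (of_real x)\<^sup>2)) \<le> 1 * exp (0 * \<bar>x\<bar>)" for x
      using assms by simp
  qed
  then show ?thesis unfolding mult.assoc[symmetric] mult_exp_exp .
qed

lemma gauss_decay_chirp:
  "gauss_decay (\<lambda>x. exp (- \<i> * of_real (t * x\<^sup>2)) * hermC m x * hermC l x)"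
proof -
  obtain C where C: "\<And>x. cmod (of_real (herm m x)) \<le> C * exp (0 * \<bar>x\<bar>)" using herm_exp_bound by blast
  have "gauss_decay (\<lambda>x. (exp (- \<i> * of_real (t * x\<^sup>2)) * hermC m x) * hermC l x)"
  proof (rule gauss_decay_mult_exp[OF gauss_decay_herm, where C=C and K=0])
    show "continuous_on UNIV (\<lambda>x. exp (- \<i> * complex_of_real (t * x\<^sup>2)) * hermC m x)" by (intro continuous_intros)
    show "cmod (exp (- \<i> * complex_of_real (t * x\<^sup>2)) * hermC m x) \<le> C * exp (0 * \<bar>x\<bar>)" for x
      using C[of x] by (simp add: norm_mult)
  qed
  then show ?thesis .
qed

section \<open>Matrix elements of a quadratic phase in the Hermite basis\<close>

definition chirp_coeff :: "real \<Rightarrow> nat \<Rightarrow> nat \<Rightarrow> complex" where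
  "chirp_coeff t m l = (LINT x|lborel. exp (- \<i> * of_real (t * x\<^sup>2)) * hermC m x * hermC l x)"

lemma chirp_coeff_commute: "chirp_coeff t m l = chirp_coeff t l m"
  by (simp add: chirp_coeff_def mult_ac)

definition chirp_q :: "real \<Rightarrow> complex" where
  "chirp_q t = 1 / (1 + \<i> * complex_of_real t)"

text \<open>Integration by parts expresses the integral with an extra factor \<open>x\<close> through lower
  coefficients; \<^term>\<open>chirp_q t\<close> is the inverse of the factor \<open>1 + \<i> t\<close> that appears.\<close>

lemma chirp_coeff_rec:
  "of_real (sqrt (Suc m)) * chirp_coeff t (Suc m) l
    = (chirp_q t - 1) * of_real (sqrt m) * chirp_coeff t (m - 1) l + chirp_q t * of_real (sqrt l) * chirp_coeff t m (l - 1)"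
proof -
  let ?e = "\<lambda>x. exp (- \<i> * complex_of_real (t * x\<^sup>2))"
  let ?b = "chirp_coeff t"
  note I = gauss_decay_integrable[OF gauss_decay_chirp]
  \<comment> \<open>The integral carrying the factor sqrt 2 * x is evaluated twice: here by the
    three-term recurrence in \<open>m\<close>, and in \<open>X2\<close> by the one in
    \<open>l\<close>.\<close>
  have X1: "(LINT x|lborel. of_real (sqrt 2) * (of_real x * (?e x * hermC m x * hermC l x)))
     = of_real (sqrt (Suc m)) * ?b (Suc m) l + of_real (sqrt m) * ?b (m-1) l"
  proof -
    have "of_real (sqrt 2) * (of_real x * (?e x * hermC m x * hermC l x))
       = of_real (sqrt (Suc m)) * (?e x * hermC (Suc m) x * hermC l x) + of_real (sqrt m) * (?e x * hermC (m-1) x * hermC l x)" for x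
    proof -
      have "of_real (sqrt 2) * (of_real x * (?e x * hermC m x * hermC l x)) = ?e x * (of_real (sqrt 2) * of_real x * hermC m x) * hermC l x"
        by (simp add: mult_ac)
      then show ?thesis unfolding hermC_rec by (simp add: algebra_simps)
    qed
    then show ?thesis using I by (simp add: chirp_coeff_def Bochner_Integration.integral_add)
  qed
  have X2: "(LINT x|lborel. of_real (sqrt 2) * (of_real x * (?e x * hermC m x * hermC l x)))
     = of_real (sqrt (Suc l)) * ?b m (Suc l) + of_real (sqrt l) * ?b m (l-1)"
  proof -
    have "of_real (sqrt 2) * (of_real x * (?e x * hermC m x * hermC l x))
       = of_real (sqrt (Suc l)) * (?e x * hermC m x * hermC (Suc l) x) + of_real (sqrt l) * (?e x * hermC m x * hermC (l-1) x)" for x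
    proof -
      have "of_real (sqrt 2) * (of_real x * (?e x * hermC m x * hermC l x)) = ?e x * hermC m x * (of_real (sqrt 2) * of_real x * hermC l x)"
        by (simp add: mult_ac)
      then show ?thesis unfolding hermC_rec by (simp add: algebra_simps)
    qed
    then show ?thesis using I by (simp add: chirp_coeff_def Bochner_Integration.integral_add)
  qed
  define X where "X = (LINT x|lborel. of_real (sqrt 2) * (of_real x * (?e x * hermC m x * hermC l x)))"
  \<comment> \<open>The derivative of the integrand, whose integral vanishes. Differentiating the
    quadratic phase produces the factor \<open>x\<close>; the two Hermite factors produce ladder
    terms.\<close>
  define g' where "g' = (\<lambda>x. (- 2 * \<i> * of_real t / of_real (sqrt 2)) * (of_real (sqrt 2) * (of_real x * (?e x * hermC m x * hermC l x)))
     + (1 / of_real (sqrt 2)) * ((of_real (sqrt m) * (?e x * hermC (m-1) x * hermC l x) - of_real (sqrt (Suc m)) * (?e x * hermC (Suc m) x * hermC l x))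
     + (of_real (sqrt l) * (?e x * hermC m x * hermC (l-1) x) - of_real (sqrt (Suc l)) * (?e x * hermC m x * hermC (Suc l) x))))"
  have gd: "gauss_decay g'"
    unfolding g'_def by (intro gauss_decay_add gauss_decay_diff gauss_decay_cmult gauss_decay_mult_id gauss_decay_chirp)
  have "(LINT x|lborel. g' x) = 0"
  proof (rule integral_derivative_eq_zero[OF gauss_decay_chirp gd])
    fix x :: real
    have de: "(?e has_vector_derivative (- 2 * \<i> * of_real t * of_real x * ?e x)) (at x)"
    proof -
      have "((\<lambda>x. - \<i> * complex_of_real (t * x\<^sup>2)) has_vector_derivative (- 2 * \<i> * of_real t * of_real x)) (at x)"
        by (auto intro!: derivative_eq_intros simp: has_vector_derivative_def scaleR_conv_of_real fun_eq_iff)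
      from field_vector_diff_chain_at[OF this DERIV_exp]
      show ?thesis by (simp add: o_def)
    qed
    have "((\<lambda>x. ?e x * hermC m x * hermC l x) has_vector_derivative
      (?e x * hermC m x) * ((of_real (sqrt l) * hermC (l-1) x - of_real (sqrt (Suc l)) * hermC (Suc l) x) / of_real (sqrt 2))
      + (?e x * ((of_real (sqrt m) * hermC (m-1) x - of_real (sqrt (Suc m)) * hermC (Suc m) x) / of_real (sqrt 2))
         + (- 2 * \<i> * of_real t * of_real x * ?e x) * hermC m x) * hermC l x) (at x)"
      by (intro has_vector_derivative_mult de hermC_deriv)
    moreover have "(?e x * hermC m x) * ((of_real (sqrt l) * hermC (l-1) x - of_real (sqrt (Suc l)) * hermC (Suc l) x) / of_real (sqrt 2))
      + (?e x * ((of_real (sqrt m) * hermC (m-1) x - of_real (sqrt (Suc m)) * hermC (Suc m) x) / of_real (sqrt 2))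
         + (- 2 * \<i> * of_real t * of_real x * ?e x) * hermC m x) * hermC l x = g' x"
    proof -
      have "(E*m)*((sl*l1 - sl'*l2)/r) + (E*((sm*m1 - sm'*m2)/r) + (-2*\<i>*t*x*E)*m)*l
        = (-2*\<i>*t/r)*(r*(x*(E*m*l))) + (1/r)*((sm*(E*m1*l) - sm'*(E*m2*l)) + (sl*(E*m*l1) - sl'*(E*m*l2)))"
        if "r \<noteq> 0" for E m l sl l1 sl' l2 r sm m1 sm' m2 t x :: complex
        using that by (simp add: field_simps)
      then show ?thesis unfolding g'_def by simp
    qed
    ultimately show "((\<lambda>x. ?e x * hermC m x * hermC l x) has_vector_derivative g' x) (at x)" by simp
  qed
  moreover have "(LINT x|lborel. g' x) = (- 2 * \<i> * of_real t / of_real (sqrt 2)) * X + (1 / of_real (sqrt 2)) *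
     ((of_real (sqrt m) * ?b (m-1) l - of_real (sqrt (Suc m)) * ?b (Suc m) l)
     + (of_real (sqrt l) * ?b m (l-1) - of_real (sqrt (Suc l)) * ?b m (Suc l)))"
  proof -
    have hb: "has_bochner_integral lborel (\<lambda>x. ?e x * hermC m x * hermC l x) (?b m l)" for m l
      using I by (simp add: has_bochner_integral_iff chirp_coeff_def)
    have hX: "has_bochner_integral lborel (\<lambda>x. of_real (sqrt 2) * (of_real x * (?e x * hermC m x * hermC l x))) X"
      unfolding X_def has_bochner_integral_iff
      by (intro conjI refl integrable_mult_right gauss_decay_integrable[OF gauss_decay_mult_id[OF gauss_decay_chirp]])
    have "has_bochner_integral lborel g' ((- 2 * \<i> * of_real t / of_real (sqrt 2)) * X + (1 / of_real (sqrt 2)) *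
     ((of_real (sqrt m) * ?b (m-1) l - of_real (sqrt (Suc m)) * ?b (Suc m) l)
     + (of_real (sqrt l) * ?b m (l-1) - of_real (sqrt (Suc l)) * ?b m (Suc l))))"
      unfolding g'_def by (intro has_bochner_integral_add has_bochner_integral_diff has_bochner_integral_mult_right hb hX)
    then show ?thesis by (simp add: has_bochner_integral_iff)
  qed
  ultimately have z: "(- 2 * \<i> * of_real t / of_real (sqrt 2)) * X + (1 / of_real (sqrt 2)) *
     ((of_real (sqrt m) * ?b (m-1) l - of_real (sqrt (Suc m)) * ?b (Suc m) l)
     + (of_real (sqrt l) * ?b m (l-1) - of_real (sqrt (Suc l)) * ?b m (Suc l))) = 0" by simp
  have "r * X / s + (1 / s) * y = 0 \<Longrightarrow> s \<noteq> 0 \<Longrightarrow> r * X + y = 0" for r s y :: complex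
    by (simp add: field_simps)
  from this[of "- 2 * \<i> * of_real t" "of_real (sqrt 2)"] z
  have z: "(- 2 * \<i> * of_real t) * X +
     ((of_real (sqrt m) * ?b (m-1) l - of_real (sqrt (Suc m)) * ?b (Suc m) l)
     + (of_real (sqrt l) * ?b m (l-1) - of_real (sqrt (Suc l)) * ?b m (Suc l))) = 0"
    by simp
  \<comment> \<open>The raised coefficients are eliminated in favour of \<open>X\<close>. The
    vanishing integral then becomes the equation (1 + it) X = lowered terms, which is solved with
    \<open>chirp_q t\<close>.\<close>
  have x1: "of_real (sqrt (Suc m)) * ?b (Suc m) l = X - of_real (sqrt m) * ?b (m-1) l"
    using X1[folded X_def] by (simp only: add_diff_cancel_right')
  have x2: "of_real (sqrt (Suc l)) * ?b m (Suc l) = X - of_real (sqrt l) * ?b m (l-1)"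
    using X2[folded X_def] by (simp only: add_diff_cancel_right')
  have alg: "(- 2 * \<i> * s) * X + ((p - (X - p)) + (r - (X - r))) = 0 \<Longrightarrow> (1 + \<i> * s) * X = p + r" for s p r :: complex
  proof -
    assume "(- 2 * \<i> * s) * X + ((p - (X - p)) + (r - (X - r))) = 0"
    then have "2 * ((1 + \<i> * s) * X) = 2 * (p + r)" by (simp add: algebra_simps)
    then show ?thesis by (metis mult_cancel_left zero_neq_numeral)
  qed
  have "(1 + \<i> * of_real t) * X = of_real (sqrt m) * ?b (m-1) l + of_real (sqrt l) * ?b m (l-1)"
    using z unfolding x1 x2 by (rule alg)
  moreover have "1 + \<i> * complex_of_real t \<noteq> 0" by (auto simp: complex_eq_iff)
  ultimately have X: "X = chirp_q t * (of_real (sqrt m) * ?b (m-1) l + of_real (sqrt l) * ?b m (l-1))"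
    by (simp add: chirp_q_def field_simps)
  have "q * (a * b + c * d) - a * b = (q - 1) * a * b + q * c * d" for q a b c d :: complex
    by (simp add: algebra_simps)
  then show ?thesis unfolding x1 X .
qed

lemma chirp_coeff_rec2:
  "of_real (sqrt (Suc l)) * chirp_coeff t m (Suc l)
    = (chirp_q t - 1) * of_real (sqrt l) * chirp_coeff t m (l - 1) + chirp_q t * of_real (sqrt m) * chirp_coeff t (m - 1) l"
  using chirp_coeff_rec[of l t m] unfolding chirp_coeff_commute[of t "Suc l" m] chirp_coeff_commute[of t "l - 1" m] chirp_coeff_commute[of t l "m - 1"] .

text \<open>Only the modulus is wanted, so no branch of the square root of 1 + it has to be chosen:
  the product of the integral with its conjugate is evaluated as a double integral.\<close>

lemma chirp_coeff_00: "(cmod (chirp_coeff t 0 0))\<^sup>2 = 1 / sqrt (1 + t\<^sup>2)"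
proof -
  let ?f = "\<lambda>x::real. exp (- (1 + \<i> * of_real t) * (of_real x)\<^sup>2)"
  have e0: "exp (- \<i> * complex_of_real (t * x\<^sup>2)) * hermC 0 x * hermC 0 x = of_real (1 / sqrt pi) * ?f x" for x
  proof -
    have "herm 0 x * herm 0 x = (pi powr (-1/4) * pi powr (-1/4)) * (exp (-x\<^sup>2/2) * exp (-x\<^sup>2/2))"
      by simp
    also have "\<dots> = 1 / sqrt pi * exp (- x\<^sup>2)" unfolding pi_powr_quarter_square mult_exp_exp by simp
    finally have "hermC 0 x * hermC 0 x = of_real (1 / sqrt pi) * exp (- (of_real x)\<^sup>2)"
      by (simp add: exp_of_real[symmetric] flip: of_real_mult)
    then have "exp (- \<i> * complex_of_real (t * x\<^sup>2)) * hermC 0 x * hermC 0 x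
       = of_real (1 / sqrt pi) * (exp (- \<i> * complex_of_real (t * x\<^sup>2)) * exp (- (of_real x)\<^sup>2))"
      by (simp add: mult.assoc)
    also have "\<dots> = of_real (1 / sqrt pi) * ?f x"
      unfolding mult_exp_exp by (simp add: algebra_simps)
    finally show ?thesis .
  qed
  define B where "B = (LINT x|lborel. ?f x)"
  have c: "chirp_coeff t 0 0 = of_real (1 / sqrt pi) * B"
    unfolding chirp_coeff_def e0 B_def by simp
  have cB: "cnj B = (LINT x|lborel. exp (- (1 - \<i> * of_real t) * (of_real x)\<^sup>2))"
    unfolding B_def by (subst Bochner_Integration.integral_cnj[symmetric]) (simp add: exp_cnj)
  \<comment> \<open>With y = x - p as the second variable the quadratic phases in \<open>x\<close>
    cancel. The inner integral has the real quadratic coefficient 2, so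
    \<open>gauss_integral\<close> applies, and a real Gaussian in \<open>p\<close> is left
    over.\<close>
  let ?F = "\<lambda>(p, x). exp (- 2 * (of_real x)\<^sup>2 + ((2 - 2 * \<i> * of_real t) * of_real p) * of_real x) * exp (- (1 - \<i> * of_real t) * (of_real p)\<^sup>2) :: complex"
  have F: "?f x * exp (- (1 - \<i> * of_real t) * (of_real (x - p))\<^sup>2) = ?F (p, x)" for x p :: real
    unfolding mult_exp_exp prod.case by (rule arg_cong[where f=exp]) (simp add: power2_eq_square algebra_simps)
  have "B * cnj B = (LINT x|lborel. ?f x * cnj B)" unfolding B_def by simp
  also have "\<dots> = (LINT x|lborel. LINT p|lborel. ?F (p, x))"
  proof (rule Bochner_Integration.integral_cong[OF refl])
    fix x :: real
    have "cnj B = (LINT p|lborel. exp (- (1 - \<i> * of_real t) * (of_real (x - p))\<^sup>2))"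
      unfolding cB using lborel_integral_real_affine[of "-1" "\<lambda>y. exp (- (1 - \<i> * of_real t) * (complex_of_real y)\<^sup>2)" x] by simp
    then show "?f x * cnj B = (LINT p|lborel. ?F (p, x))" unfolding F[symmetric] by simp
  qed
  also have "\<dots> = (LINT p|lborel. LINT x|lborel. ?F (p, x))"
  proof (rule lborel_pair.Fubini_integral[where f="\<lambda>x p. ?F (p, x)", symmetric])
    have n: "cmod (?F (p, x)) = exp (- x\<^sup>2) * exp (- (x - p)\<^sup>2)" for p x
      unfolding F[symmetric] norm_mult by (simp add: power2_eq_square)
    show "integrable (lborel \<Otimes>\<^sub>M lborel) (\<lambda>(x, p). ?F (p, x))"
    proof (rule lborel_pair.Fubini_integrable)
      show "(\<lambda>(x, p). ?F (p, x)) \<in> borel_measurable (lborel \<Otimes>\<^sub>M lborel)" by measurable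
      have g: "has_bochner_integral lborel (\<lambda>p. exp (- (x - p)\<^sup>2)) (sqrt pi)" for x :: real
        using lborel_has_bochner_integral_real_affine_iff[of "-1" "\<lambda>y. exp (- y\<^sup>2)" "sqrt pi" x] gauss_integral_real[of 1 0]
        by simp
      have "(\<lambda>x. LINT p|lborel. norm ((\<lambda>(x, p). ?F (p, x)) (x, p))) = (\<lambda>x. exp (- x\<^sup>2) * sqrt pi)"
        using g unfolding prod.case n[unfolded prod.case] by (auto simp: has_bochner_integral_iff)
      then show "integrable lborel (\<lambda>x. LINT p|lborel. norm ((\<lambda>(x, p). ?F (p, x)) (x, p)))"
        using gauss_integral_real[of 1 0] by (simp add: has_bochner_integral_iff)
      show "AE x in lborel. integrable lborel (\<lambda>p. (\<lambda>(x, p). ?F (p, x)) (x, p))"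
      proof (rule AE_I2)
        fix x :: real
        have "integrable lborel (\<lambda>p. exp (- x\<^sup>2) * exp (- (x - p)\<^sup>2))" using g by (simp add: has_bochner_integral_iff)
        then show "integrable lborel (\<lambda>p. (\<lambda>(x, p). ?F (p, x)) (x, p))"
          unfolding prod.case
          by (rule Bochner_Integration.integrable_bound) (measurable, rule AE_I2, unfold n[unfolded prod.case], simp)
      qed
    qed
  qed
  also have "\<dots> = (LINT p|lborel. of_real (sqrt (pi/2)) * of_real (exp (- ((1 + t\<^sup>2)/2) * p\<^sup>2 + 0 * p)))"
  proof (rule Bochner_Integration.integral_cong[OF refl])
    fix p :: real
    have "(LINT x|lborel. ?F (p, x)) = of_real (sqrt (pi/2)) * exp (((2 - 2 * \<i> * of_real t) * of_real p)\<^sup>2 / (4 * 2)) * exp (- (1 - \<i> * of_real t) * (of_real p)\<^sup>2)"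
      using gauss_integral[of 2 "(2 - 2 * \<i> * of_real t) * of_real p"] by (simp add: has_bochner_integral_iff)
    also have "\<dots> = of_real (sqrt (pi/2)) * exp (complex_of_real (- ((1 + t\<^sup>2)/2) * p\<^sup>2 + 0 * p))"
    proof -
      have "((2 - 2 * \<i> * of_real t) * of_real p)\<^sup>2 / (4 * 2) + - (1 - \<i> * of_real t) * (of_real p)\<^sup>2
        = complex_of_real (- ((1 + t\<^sup>2)/2) * p\<^sup>2 + 0 * p)"
        by (simp add: power2_eq_square field_simps)
      then show ?thesis by (simp only: mult.assoc mult_exp_exp)
    qed
    finally show "(LINT x|lborel. ?F (p, x)) = of_real (sqrt (pi/2)) * of_real (exp (- ((1 + t\<^sup>2)/2) * p\<^sup>2 + 0 * p))"
      by (simp only: exp_of_real)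
  qed
  also have "\<dots> = of_real (sqrt (pi/2)) * of_real (sqrt (pi / ((1 + t\<^sup>2)/2)))"
    using gauss_integral_real[of "(1 + t\<^sup>2)/2" 0] by (simp add: has_bochner_integral_iff add_pos_nonneg)
  finally have "B * cnj B = of_real (sqrt (pi/2) * sqrt (pi / ((1 + t\<^sup>2)/2)))" by simp
  moreover have "sqrt (pi/2) * sqrt (pi / ((1 + t\<^sup>2)/2)) = pi / sqrt (1 + t\<^sup>2)"
  proof -
    have "pi/2 * (pi / ((1 + t\<^sup>2)/2)) = pi\<^sup>2 / (1 + t\<^sup>2)" by (simp add: power2_eq_square)
    then have "sqrt (pi/2) * sqrt (pi / ((1 + t\<^sup>2)/2)) = sqrt (pi\<^sup>2 / (1 + t\<^sup>2))"
      by (simp only: real_sqrt_mult[symmetric])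
    then show ?thesis by (simp add: real_sqrt_divide)
  qed
  ultimately have "(cmod B)\<^sup>2 = pi / sqrt (1 + t\<^sup>2)"
    by (metis complex_norm_square of_real_eq_iff of_real_power)
  then show ?thesis unfolding c by (simp add: norm_mult power_mult_distrib norm_divide power_divide)
qed

text \<open>The matrix with rows $(q-1, q)$ and $(q, q-1)$, through which the two recurrences act
  on $(\sqrt{m}\,b_{m-1,l}, \sqrt{l}\,b_{m,l-1})$, is unitary.\<close>

lemma chirp_q_unitary:
  "(cmod ((chirp_q t - 1) * a + chirp_q t * b))\<^sup>2 + (cmod ((chirp_q t - 1) * b + chirp_q t * a))\<^sup>2
    = (cmod a)\<^sup>2 + (cmod b)\<^sup>2"
proof -
  define q where "q = chirp_q t"
  define x y where "x = Re q" and "y = Im q"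
  have nz: "1 + t\<^sup>2 \<noteq> 0" by (metis add_pos_nonneg zero_le_power2 zero_less_one less_irrefl)
  have xe: "x = 1 / (1 + t\<^sup>2)" and ye: "y = - t / (1 + t\<^sup>2)"
    by (simp_all add: x_def y_def q_def chirp_q_def Re_divide Im_divide power2_eq_square)
  have "x\<^sup>2 + y\<^sup>2 = (1 + t\<^sup>2) / (1 + t\<^sup>2)\<^sup>2" unfolding xe ye by (simp add: power_divide add_divide_distrib)
  also have "\<dots> = x" using nz xe by (simp add: power2_eq_square)
  \<comment> \<open>This identity, |q|^2 = Re q, is all that unitarity amounts to: the matrix has
    orthogonal real eigenvectors with eigenvalues -1 and 2q - 1, and the identity says that |2q - 1|
    = 1.\<close>
  finally have xy: "x\<^sup>2 + y\<^sup>2 = x" .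
  have "((x - 1) * a1 - y * a2 + (x * b1 - y * b2))\<^sup>2 + ((x - 1) * a2 + y * a1 + (x * b2 + y * b1))\<^sup>2
    + ((x - 1) * b1 - y * b2 + (x * a1 - y * a2))\<^sup>2 + ((x - 1) * b2 + y * b1 + (x * a2 + y * a1))\<^sup>2
    = a1\<^sup>2 + a2\<^sup>2 + (b1\<^sup>2 + b2\<^sup>2) + 2 * (x\<^sup>2 + y\<^sup>2 - x) * (a1\<^sup>2 + a2\<^sup>2 + b1\<^sup>2 + b2\<^sup>2 + 2 * (a1 * b1 + a2 * b2))" for a1 a2 b1 b2
    by (simp add: power2_eq_square algebra_simps)
  moreover have "x\<^sup>2 + y\<^sup>2 - x = 0" using xy by simp
  ultimately have "((x - 1) * a1 - y * a2 + (x * b1 - y * b2))\<^sup>2 + ((x - 1) * a2 + y * a1 + (x * b2 + y * b1))\<^sup>2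
    + ((x - 1) * b1 - y * b2 + (x * a1 - y * a2))\<^sup>2 + ((x - 1) * b2 + y * b1 + (x * a2 + y * a1))\<^sup>2
    = a1\<^sup>2 + a2\<^sup>2 + (b1\<^sup>2 + b2\<^sup>2)" for a1 a2 b1 b2 by simp
  from this[of "Re a" "Im a" "Re b" "Im b"]
  show ?thesis unfolding cmod_power2 q_def[symmetric] by (simp add: x_def y_def)
qed

text \<open>Unitarity is summed over \<open>m + l = M + 1\<close>; after reindexing, the weights of each entry
  on either level add up to \<open>M + 2\<close>.\<close>

lemma chirp_coeff_level_step:
  "(\<Sum>m\<le>M + 2. (cmod (chirp_coeff t m (M + 2 - m)))\<^sup>2) = (\<Sum>m\<le>M. (cmod (chirp_coeff t m (M - m)))\<^sup>2)"
proof -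
  let ?b = "chirp_coeff t"
  let ?n = "\<lambda>m l. (cmod (?b m l))\<^sup>2"
  have sq: "(cmod (of_real (sqrt (real k)) * z))\<^sup>2 = real k * (cmod z)\<^sup>2" for k z
    by (simp add: norm_mult power_mult_distrib)
  have step: "real (Suc m) * ?n (Suc m) l + real (Suc l) * ?n m (Suc l) = real m * ?n (m - 1) l + real l * ?n m (l - 1)" for m l
    using chirp_q_unitary[of t "of_real (sqrt m) * ?b (m-1) l" "of_real (sqrt l) * ?b m (l-1)"]
    unfolding mult.assoc[symmetric] chirp_coeff_rec[symmetric] chirp_coeff_rec2[symmetric] sq .
  have "(\<Sum>m\<le>M + 1. real (Suc m) * ?n (Suc m) (M + 1 - m)) + (\<Sum>m\<le>M + 1. real (Suc (M + 1 - m)) * ?n m (Suc (M + 1 - m)))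
     = (\<Sum>m\<le>M + 1. real m * ?n (m - 1) (M + 1 - m)) + (\<Sum>m\<le>M + 1. real (M + 1 - m) * ?n m (M + 1 - m - 1))"
    unfolding sum.distrib[symmetric] step ..
  \<comment> \<open>The shift of the index is free, since the additional term at 0 carries the
    weight 0.\<close>
  moreover have "(\<Sum>m\<le>M + 1. real (Suc m) * ?n (Suc m) (M + 1 - m)) = (\<Sum>m\<le>M + 2. real m * ?n m (M + 2 - m))"
    using sum.atMost_Suc_shift[of "\<lambda>m. real m * ?n m (M + 2 - m)" "M + 1"] by simp
  moreover have "(\<Sum>m\<le>M + 1. real (Suc (M + 1 - m)) * ?n m (Suc (M + 1 - m))) = (\<Sum>m\<le>M + 2. real (M + 2 - m) * ?n m (M + 2 - m))"
  proof -
    have "(\<Sum>m\<le>M + 2. real (M + 2 - m) * ?n m (M + 2 - m)) = (\<Sum>m\<le>M + 1. real (M + 2 - m) * ?n m (M + 2 - m))"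
      by simp
    also have "\<dots> = (\<Sum>m\<le>M + 1. real (Suc (M + 1 - m)) * ?n m (Suc (M + 1 - m)))"
      by (rule sum.cong[OF refl]) (auto simp: Suc_diff_le)
    finally show ?thesis by simp
  qed
  moreover have "(\<Sum>m\<le>M + 1. real m * ?n (m - 1) (M + 1 - m)) = (\<Sum>m\<le>M. real (Suc m) * ?n m (M - m))"
    using sum.atMost_Suc_shift[of "\<lambda>m. real m * ?n (m - 1) (M + 1 - m)" "M"] by simp
  moreover have "(\<Sum>m\<le>M + 1. real (M + 1 - m) * ?n m (M + 1 - m - 1)) = (\<Sum>m\<le>M. real (M + 1 - m) * ?n m (M - m))"
    by simp
  ultimately have "(\<Sum>m\<le>M + 2. real m * ?n m (M + 2 - m)) + (\<Sum>m\<le>M + 2. real (M + 2 - m) * ?n m (M + 2 - m))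
    = (\<Sum>m\<le>M. real (Suc m) * ?n m (M - m)) + (\<Sum>m\<le>M. real (M + 1 - m) * ?n m (M - m))" by linarith
  moreover have "(\<Sum>m\<le>M + 2. real m * ?n m (M + 2 - m)) + (\<Sum>m\<le>M + 2. real (M + 2 - m) * ?n m (M + 2 - m))
     = (\<Sum>m\<le>M + 2. real (M + 2) * ?n m (M + 2 - m))"
    unfolding sum.distrib[symmetric] distrib_right[symmetric] by (rule sum.cong[OF refl]) (auto simp: of_nat_diff)
  moreover have "(\<Sum>m\<le>M. real (Suc m) * ?n m (M - m)) + (\<Sum>m\<le>M. real (M + 1 - m) * ?n m (M - m))
     = (\<Sum>m\<le>M. real (M + 2) * ?n m (M - m))"
    unfolding sum.distrib[symmetric] distrib_right[symmetric] by (rule sum.cong[OF refl]) (auto simp: of_nat_diff)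
  ultimately have "real (M + 2) * (\<Sum>m\<le>M + 2. ?n m (M + 2 - m)) = real (M + 2) * (\<Sum>m\<le>M. ?n m (M - m))"
    by (simp only: sum_distrib_left)
  then show ?thesis by (simp del: of_nat_add)
qed

text \<open>Equality holds at even levels, which inherit the mass of level 0; at odd levels the sum
  vanishes, because both coefficients of level 1 do.\<close>

lemma chirp_coeff_level: "(\<Sum>m\<le>M. (cmod (chirp_coeff t m (M - m)))\<^sup>2) \<le> 1 / sqrt (1 + t\<^sup>2)"
proof (induction M rule: induct_nat_012)
  case 0
  then show ?case by (simp add: chirp_coeff_00)
next
  case 1
  have "chirp_coeff t (Suc 0) 0 = 0" "chirp_coeff t 0 (Suc 0) = 0"
    using chirp_coeff_rec[of 0 t 0] chirp_coeff_rec2[of 0 t 0] by simp_all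
  then show ?case by simp
next
  case (ge2 n)
  then show ?case using chirp_coeff_level_step[where M=n] by (simp only: add_2_eq_Suc')
qed

lemma chirp_coeff_bound: "cmod (chirp_coeff t m l) \<le> (1 + t\<^sup>2) powr (-1/4)"
proof -
  have p: "1 + t\<^sup>2 > 0" by (simp add: add_pos_nonneg)
  have "(cmod (chirp_coeff t m l))\<^sup>2 \<le> (\<Sum>j\<le>m + l. (cmod (chirp_coeff t j (m + l - j)))\<^sup>2)"
    using member_le_sum[of m "{..m + l}" "\<lambda>j. (cmod (chirp_coeff t j (m + l - j)))\<^sup>2"] by simp
  also have "\<dots> \<le> 1 / sqrt (1 + t\<^sup>2)" by (rule chirp_coeff_level)
  also have "\<dots> = ((1 + t\<^sup>2) powr (-1/4))\<^sup>2"
  proof -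
    have "((1 + t\<^sup>2) powr (-1/4))\<^sup>2 = (1 + t\<^sup>2) powr (-1/4 + -1/4)" unfolding power2_eq_square by (rule powr_add[symmetric])
    also have "\<dots> = (1 + t\<^sup>2) powr (- (1/2))" by simp
    also have "\<dots> = 1 / sqrt (1 + t\<^sup>2)" using p by (subst powr_minus_divide) (simp add: powr_half_sqrt)
    finally show ?thesis by simp
  qed
  finally show ?thesis by (rule power2_le_imp_le) simp
qed

text \<open>Orthonormality is the case \<open>t = 0\<close> of the recurrence: then
  \<open>chirp_q\<close> equals 1 and the recurrence merely lowers both indices together.\<close>

lemma chirp_coeff_zero: "chirp_coeff 0 m l = (if m = l then 1 else 0)"
proof (induction m arbitrary: l)
  case 0
  show ?case
  proof (cases l)
    case 0
    have "herm 0 x * herm 0 x = 1 / sqrt pi * exp (- 1 * x\<^sup>2 + 0 * x)" for x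
    proof -
      have "herm 0 x * herm 0 x = (pi powr (-1/4) * pi powr (-1/4)) * (exp (-x\<^sup>2/2) * exp (-x\<^sup>2/2))" by simp
      also have "\<dots> = 1 / sqrt pi * exp (- 1 * x\<^sup>2 + 0 * x)" unfolding pi_powr_quarter_square mult_exp_exp by simp
      finally show ?thesis .
    qed
    then have "has_bochner_integral lborel (\<lambda>x. herm 0 x * herm 0 x) 1"
      using has_bochner_integral_mult_right[of "1 / sqrt pi" lborel, OF gauss_integral_real[of 1 0]] by simp
    from has_bochner_integral_of_real[OF this, where 'a=complex] 0 show ?thesis
      by (simp add: chirp_coeff_def has_bochner_integral_iff)
  next
    case (Suc k)
    then show ?thesis using chirp_coeff_rec2[of k 0 0] by (simp add: chirp_q_def)
  qed
next
  case (Suc m)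
  have "of_real (sqrt (Suc m)) * chirp_coeff 0 (Suc m) l = of_real (sqrt l) * chirp_coeff 0 m (l - 1)"
    using chirp_coeff_rec[of m 0 l] by (simp add: chirp_q_def)
  then show ?case using Suc[of "l - 1"] by (cases l) (auto split: if_splits simp: norm_eq_zero)
qed

section \<open>Hermite functions and coherent states on $\mathbb{R}^n$\<close>

lemma gauss_decay_mult:
  assumes "gauss_decay f" "gauss_decay g"
  shows "gauss_decay (\<lambda>x. f x * g x)"
proof -
  obtain C where C: "\<And>x. cmod (f x) \<le> C * exp (- (1/8) * x\<^sup>2)" using gauss_decay_bound[OF assms(1)] by blast
  have C0: "C \<ge> 0" using order_trans[OF norm_ge_zero C[of 0]] by simp
  have "cmod (f x) \<le> C * exp (0 * \<bar>x\<bar>)" for x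
    using C0 by (intro order_trans[OF C[of x]] mult_left_mono) auto
  then show ?thesis using assms by (intro gauss_decay_mult_exp[where C=C and K=0]) (auto simp: gauss_decay_def)
qed

text \<open>Integration by parts gives the transforms a recurrence that differs from the one for the
  Hermite functions only by a factor \<i> for each degree. The Gaussian case then determines all of
  them.\<close>

lemma hermC_fourier:
  "(LINT x|lborel. exp (\<i> * of_real (x * \<xi>)) * hermC m x) = of_real (sqrt (2 * pi)) * \<i> ^ m * hermC m \<xi>"
proof -
  let ?e = "\<lambda>x. exp ((\<i> * of_real \<xi>) * complex_of_real x)"
  define F where "F m = (LINT x|lborel. ?e x * hermC m x)" for m
  note gd = gauss_decay_herm_exp[of "\<i> * of_real \<xi>"]
  have hb: "has_bochner_integral lborel (\<lambda>x. ?e x * hermC m x) (F m)" for m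
    using gauss_decay_integrable[OF gd] by (simp add: has_bochner_integral_iff F_def)
  have rec: "of_real (sqrt (Suc m)) * F (Suc m) = of_real (sqrt 2) * (\<i> * of_real \<xi>) * F m + of_real (sqrt m) * F (m - 1)" for m
  proof -
    define g' where "g' = (\<lambda>x. (\<i> * of_real \<xi>) * (?e x * hermC m x) +
       (1 / of_real (sqrt 2)) * (of_real (sqrt m) * (?e x * hermC (m-1) x) - of_real (sqrt (Suc m)) * (?e x * hermC (Suc m) x)))"
    have "(LINT x|lborel. g' x) = 0"
    proof (rule integral_derivative_eq_zero[OF gd])
      show "gauss_decay g'" unfolding g'_def by (intro gauss_decay_add gauss_decay_diff gauss_decay_cmult gd)
      fix x :: real
      have de: "(?e has_vector_derivative (\<i> * of_real \<xi> * ?e x)) (at x)"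
      proof -
        have "((\<lambda>x. (\<i> * of_real \<xi>) * complex_of_real x) has_vector_derivative (\<i> * of_real \<xi>)) (at x)"
          by (auto intro!: derivative_eq_intros simp: has_vector_derivative_def scaleR_conv_of_real fun_eq_iff)
        from field_vector_diff_chain_at[OF this DERIV_exp]
        show ?thesis by (simp add: o_def)
      qed
      have "((\<lambda>x. ?e x * hermC m x) has_vector_derivative
        ?e x * ((of_real (sqrt m) * hermC (m-1) x - of_real (sqrt (Suc m)) * hermC (Suc m) x) / of_real (sqrt 2))
         + (\<i> * of_real \<xi> * ?e x) * hermC m x) (at x)"
        by (intro has_vector_derivative_mult de hermC_deriv)
      moreover have "E * ((a * b - c * d) / r) + k * E * h = k * (E * h) + (1 / r) * (a * (E * b) - c * (E * d))" for E a b c d r k h :: complex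
        by (simp add: divide_inverse algebra_simps)
      ultimately show "((\<lambda>x. ?e x * hermC m x) has_vector_derivative g' x) (at x)" unfolding g'_def by (simp only:)
    qed
    moreover have "has_bochner_integral lborel g' ((\<i> * of_real \<xi>) * F m + (1 / of_real (sqrt 2)) * (of_real (sqrt m) * F (m-1) - of_real (sqrt (Suc m)) * F (Suc m)))"
      unfolding g'_def by (intro has_bochner_integral_add has_bochner_integral_diff has_bochner_integral_mult_right hb)
    ultimately have "(\<i> * of_real \<xi>) * F m + (1 / of_real (sqrt 2)) * (of_real (sqrt m) * F (m-1) - of_real (sqrt (Suc m)) * F (Suc m)) = 0"
      by (simp add: has_bochner_integral_iff)
    moreover have "k + (1 / r) * (a - b) = 0 \<Longrightarrow> r \<noteq> 0 \<Longrightarrow> b = r * k + a" for k r a b :: complex by (simp add: field_simps)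
    ultimately show ?thesis by (simp add: mult.assoc)
  qed
  have F0: "F 0 = of_real (sqrt (2 * pi)) * hermC 0 \<xi>"
  proof -
    have "has_bochner_integral lborel (\<lambda>x. of_real (pi powr (-1/4)) * exp (- (of_real x)\<^sup>2 / 2 + (\<i> * of_real \<xi>) * of_real x))
       (of_real (pi powr (-1/4)) * (of_real (sqrt (2*pi)) * exp ((\<i> * of_real \<xi>)\<^sup>2 / 2)))"
      by (rule has_bochner_integral_mult_right, rule gauss_integral_std)
    moreover have "of_real (pi powr (-1/4)) * exp (- (of_real x)\<^sup>2 / 2 + (\<i> * of_real \<xi>) * of_real x) = ?e x * hermC 0 x" for x
      unfolding exp_add by (simp add: exp_of_real[symmetric])
    ultimately have "F 0 = of_real (pi powr (-1/4)) * (of_real (sqrt (2*pi)) * exp ((\<i> * of_real \<xi>)\<^sup>2 / 2))"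
      unfolding F_def by (simp only: has_bochner_integral_iff)
    then show ?thesis by (simp add: power_mult_distrib exp_of_real[symmetric])
  qed
  have "F m = of_real (sqrt (2 * pi)) * \<i> ^ m * hermC m \<xi>"
  proof (induction m rule: induct_nat_012)
    case 0
    show ?case using F0 by simp
  next
    case 1
    have "F (Suc 0) = of_real (sqrt 2) * (\<i> * of_real \<xi>) * F 0" using rec[of 0] by simp
    then show ?case by (simp add: F0 mult_ac)
  next
    case (ge2 n)
    have "of_real (sqrt (Suc (Suc n))) * F (Suc (Suc n)) = of_real (sqrt (2*pi)) * \<i> ^ (Suc (Suc n)) * (of_real (sqrt 2) * of_real \<xi> * hermC (Suc n) \<xi> - of_real (sqrt (Suc n)) * hermC n \<xi>)"
      using rec[of "Suc n"] ge2 by (simp add: algebra_simps del: herm.simps)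
    also have "\<dots> = of_real (sqrt (Suc (Suc n))) * (of_real (sqrt (2*pi)) * \<i> ^ (Suc (Suc n)) * hermC (Suc (Suc n)) \<xi>)"
      unfolding hermC_rec by (simp add: mult_ac del: herm.simps)
    finally show ?case by (subst (asm) mult_cancel_left) (auto simp del: herm.simps)
  qed
  then show ?thesis unfolding F_def by (simp add: mult_ac)
qed

text \<open>The Bargmann transform takes Hermite functions to monomials: against this kernel the
  integration by parts leaves a two-term recurrence, solved by powers of \<open>c\<close>.\<close>

lemma hermC_gauss_exp:
  "(LINT x|lborel. exp (- of_real (1/2) * (of_real x)\<^sup>2 + c * of_real x) * hermC m x)
    = of_real (pi powr (1/4)) * exp (c\<^sup>2 / 4) * (c / of_real (sqrt 2)) ^ m / of_real (sqrt (fact m))"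
proof -
  let ?e = "\<lambda>x. exp (- of_real (1/2) * (of_real x)\<^sup>2 + c * complex_of_real x)"
  define F where "F m = (LINT x|lborel. ?e x * hermC m x)" for m
  have gd: "gauss_decay (\<lambda>x. ?e x * hermC m x)" for m by (rule gauss_decay_herm_gauss_exp) simp
  have hb: "has_bochner_integral lborel (\<lambda>x. ?e x * hermC m x) (F m)" for m
    using gauss_decay_integrable[OF gd] by (simp add: has_bochner_integral_iff F_def)
  have s2: "of_real (sqrt 2) * of_real (sqrt 2) = (2::complex)" by (simp flip: of_real_mult)
  have rec: "of_real (sqrt (Suc m)) * F (Suc m) = c / of_real (sqrt 2) * F m" for m
  proof -
    define g' where "g' = (\<lambda>x. c * (?e x * hermC m x) - of_real (sqrt 2) * (of_real (sqrt (Suc m)) * (?e x * hermC (Suc m) x)))"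
    have "(LINT x|lborel. g' x) = 0"
    proof (rule integral_derivative_eq_zero[OF gd])
      show "gauss_decay g'" unfolding g'_def by (intro gauss_decay_add gauss_decay_diff gauss_decay_cmult gd)
      fix x :: real
      have de: "(?e has_vector_derivative ((c - of_real x) * ?e x)) (at x)"
      proof -
        have "((\<lambda>x. - of_real (1/2) * (of_real x)\<^sup>2 + c * complex_of_real x) has_vector_derivative (c - of_real x)) (at x)"
          by (auto intro!: derivative_eq_intros simp: has_vector_derivative_def scaleR_conv_of_real fun_eq_iff algebra_simps)
        from field_vector_diff_chain_at[OF this DERIV_exp]
        show ?thesis by (simp add: o_def)
      qed
      have "((\<lambda>x. ?e x * hermC m x) has_vector_derivative
        ?e x * (of_real (sqrt 2) * of_real (sqrt m) * hermC (m-1) x - of_real x * hermC m x)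
         + ((c - of_real x) * ?e x) * hermC m x) (at x)"
        by (intro has_vector_derivative_mult de hermC_deriv')
      moreover have "?e x * (of_real (sqrt 2) * of_real (sqrt m) * hermC (m-1) x - of_real x * hermC m x)
         + ((c - of_real x) * ?e x) * hermC m x = g' x"
      proof -
        have a1: "of_real (sqrt (Suc m)) * hermC (Suc m) x = of_real (sqrt 2) * of_real x * hermC m x - of_real (sqrt m) * hermC (m-1) x"
          unfolding hermC_rec by simp
        have a2: "E * (r * s * k - X * h) + ((c - X) * E) * h = c * (E * h) - r * (E * (r * X * h - s * k))" if "r * r = 2" for E r s k X h :: complex
        proof -
          have "r * (E * (r * X * h - s * k)) = (r * r) * (E * X * h) - r * s * k * E" by (simp add: algebra_simps)
          then show ?thesis unfolding that by (simp add: algebra_simps)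
        qed
        have a3: "of_real (sqrt 2) * (of_real (sqrt (Suc m)) * (?e x * hermC (Suc m) x)) = of_real (sqrt 2) * (?e x * (of_real (sqrt (Suc m)) * hermC (Suc m) x))"
          by (simp only: mult_ac)
        show ?thesis unfolding g'_def a3 a1 by (rule a2[OF s2])
      qed
      ultimately show "((\<lambda>x. ?e x * hermC m x) has_vector_derivative g' x) (at x)" by simp
    qed
    moreover have "has_bochner_integral lborel g' (c * F m - of_real (sqrt 2) * (of_real (sqrt (Suc m)) * F (Suc m)))"
      unfolding g'_def by (intro has_bochner_integral_add has_bochner_integral_diff has_bochner_integral_mult_right hb)
    ultimately have "c * F m - of_real (sqrt 2) * (of_real (sqrt (Suc m)) * F (Suc m)) = 0"
      by (simp add: has_bochner_integral_iff)
    then have "of_real (sqrt 2) * (of_real (sqrt (Suc m)) * F (Suc m)) = c * F m" by simp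
    then show ?thesis by (simp add: eq_divide_eq mult_ac)
  qed
  have "F m = of_real (pi powr (1/4)) * exp (c\<^sup>2 / 4) * (c / of_real (sqrt 2)) ^ m / of_real (sqrt (fact m))"
  proof (induction m)
    case 0
    have "has_bochner_integral lborel (\<lambda>x. of_real (pi powr (-1/4)) * exp (- of_real 1 * (of_real x)\<^sup>2 + c * of_real x))
       (of_real (pi powr (-1/4)) * (of_real (sqrt (pi / 1)) * exp (c\<^sup>2 / (4 * of_real 1))))"
      by (rule has_bochner_integral_mult_right, rule gauss_integral) simp
    moreover have "of_real (pi powr (-1/4)) * exp (- of_real 1 * (of_real x)\<^sup>2 + c * of_real x) = ?e x * hermC 0 x" for x
    proof -
      have "?e x * hermC 0 x = of_real (pi powr (-1/4)) * (?e x * exp (of_real (- x\<^sup>2/2)))"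
        by (simp add: exp_of_real[symmetric])
      then show ?thesis unfolding mult_exp_exp by (simp add: algebra_simps)
    qed
    moreover have "pi powr (-1/4) * sqrt pi = pi powr (1/4)"
    proof -
      have "pi powr (-1/4) * sqrt pi = pi powr (-1/4 + 1/2)" unfolding powr_add by (simp add: powr_half_sqrt)
      then show ?thesis by simp
    qed
    then have "complex_of_real (pi powr (-1/4)) * of_real (sqrt pi) = of_real (pi powr (1/4))" by (simp flip: of_real_mult)
    ultimately have "F 0 = of_real (pi powr (-1/4)) * (of_real (sqrt pi) * exp (c\<^sup>2 / 4))"
      and "complex_of_real (pi powr (-1/4)) * of_real (sqrt pi) = of_real (pi powr (1/4))"
      unfolding F_def by (simp_all only: has_bochner_integral_iff div_by_1 of_real_1 mult_1_right)
    then show ?case by (simp only: mult.assoc[symmetric]) simp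
  next
    case (Suc m)
    have "F (Suc m) = c / of_real (sqrt 2) * F m / of_real (sqrt (Suc m))"
      using rec[of m] by (simp add: eq_divide_eq mult_ac)
    then show ?case unfolding Suc by (simp add: real_sqrt_mult mult_ac)
  qed
  then show ?thesis unfolding F_def .
qed

text \<open>Lebesgue measure on \<open>real ^ 'n\<close> is the image of a product measure indexed
  by \<open>Basis\<close>, so product integrands split. The local \<open>ix\<close> translates a
  basis vector back into its coordinate index.\<close>

lemma lborel_integral_prod_vec:
  fixes f :: "'n::finite \<Rightarrow> real \<Rightarrow> complex"
  assumes f: "\<And>i. integrable lborel (f i)"
  shows "has_bochner_integral lborel (\<lambda>x::real^'n. \<Prod>i\<in>UNIV. f i (x $ i)) (\<Prod>i\<in>UNIV. LINT y|lborel. f i y)"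
proof -
  interpret product_sigma_finite "\<lambda>b::real^'n. lborel :: real measure" by standard
  define ix where "ix b = (THE i::'n. b = axis i 1)" for b :: "real^'n"
  have ix: "ix (axis i 1) = i" for i unfolding ix_def by (rule the_equality) (auto simp: axis_eq_axis)
  have B: "(Basis :: (real^'n) set) = (\<lambda>i. axis i 1) ` UNIV" by (auto simp: Basis_vec_def)
  have inj: "inj (\<lambda>i::'n. axis i (1::real))" by (auto intro!: injI simp: axis_eq_axis)
  define g where "g b = f (ix b)" for b :: "real^'n"
  have g: "integrable lborel (g b)" for b unfolding g_def by (rule f)
  have [measurable]: "f i \<in> borel_measurable borel" for i using borel_measurable_integrable[OF f[of i]] by simp
  have e: "(\<Prod>i\<in>UNIV. f i (((\<Sum>b\<in>Basis. w b *\<^sub>R b) :: real^'n) $ i)) = (\<Prod>b\<in>Basis. g b (w b))" for w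
  proof -
    have "((\<Sum>b\<in>Basis. w b *\<^sub>R b) :: real^'n) $ i = w (axis i 1)" for i
    proof -
      have "((\<Sum>b\<in>Basis. w b *\<^sub>R b) :: real^'n) $ i = (\<Sum>b\<in>Basis. w b *\<^sub>R b) \<bullet> axis i 1"
        by (simp add: inner_axis)
      also have "\<dots> = w (axis i 1)" by (rule inner_sum_left_Basis) (simp add: B)
      finally show ?thesis .
    qed
    then show ?thesis unfolding B prod.reindex[OF inj] by (simp add: g_def ix)
  qed
  have m: "(\<lambda>w. \<Sum>b\<in>Basis. w b *\<^sub>R b) \<in> measurable (\<Pi>\<^sub>M b\<in>(Basis::(real^'n) set). lborel) borel"
    by measurable
  have m2: "(\<lambda>x::real^'n. \<Prod>i\<in>UNIV. f i (x $ i)) \<in> borel_measurable borel" by measurable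
  have "integrable (\<Pi>\<^sub>M b\<in>(Basis::(real^'n) set). lborel) (\<lambda>w. \<Prod>b\<in>Basis. g b (w b))"
    by (rule product_integrable_prod) (auto intro: g)
  then have 1: "integrable lborel (\<lambda>x::real^'n. \<Prod>i\<in>UNIV. f i (x $ i))"
    by (subst lborel_eq, subst integrable_distr_eq[OF m m2]) (simp only: e)
  have "(LINT x|lborel. (\<Prod>i\<in>UNIV. f i ((x::real^'n) $ i))) = (LINT w|(\<Pi>\<^sub>M b\<in>(Basis::(real^'n) set). lborel). (\<Prod>b\<in>Basis. g b (w b)))"
    by (subst lborel_eq, subst integral_distr[OF m m2]) (simp only: e)
  also have "\<dots> = (\<Prod>b\<in>Basis. LINT y|lborel. g b y)"
    by (rule product_integral_prod) (auto intro: g)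
  also have "\<dots> = (\<Prod>i\<in>UNIV. LINT y|lborel. f i y)"
    unfolding B prod.reindex[OF inj] by (simp add: g_def ix)
  finally show ?thesis using 1 by (simp add: has_bochner_integral_iff)
qed

definition hermite :: "('n::finite \<Rightarrow> nat) \<Rightarrow> 'n fn" where
  "hermite \<alpha> x = (\<Prod>i\<in>UNIV. hermC (\<alpha> i) (x $ i))"

lemma cnj_hermite [simp]: "cnj (hermite \<alpha> x) = hermite \<alpha> x"
  by (simp add: hermite_def)

lemma hermC_mult_integral: "has_bochner_integral lborel (\<lambda>x. hermC m x * hermC l x) (if m = l then 1 else 0)"
  using chirp_coeff_zero[of m l] gauss_decay_integrable[OF gauss_decay_chirp[of 0 m l]]
  by (simp add: chirp_coeff_def has_bochner_integral_iff)

lemma herm_measurable [measurable]: "herm n \<in> borel_measurable borel"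
  by (intro borel_measurable_continuous_onI herm_cont)

lemma hermite_measurable [measurable]: "hermite \<alpha> \<in> borel_measurable borel"
  unfolding hermite_def[abs_def] by measurable

lemma hermite_orthonormal:
  "has_bochner_integral lborel (\<lambda>x. hermite \<alpha> x * cnj (hermite \<beta> x)) (if \<alpha> = \<beta> then 1 else 0)"
proof -
  have "has_bochner_integral lborel (\<lambda>x::real^'a. \<Prod>i\<in>UNIV. hermC (\<alpha> i) (x $ i) * hermC (\<beta> i) (x $ i))
     (\<Prod>i\<in>UNIV. LINT y|lborel. hermC (\<alpha> i) y * hermC (\<beta> i) y)"
    by (rule lborel_integral_prod_vec) (use hermC_mult_integral in \<open>auto simp: has_bochner_integral_iff\<close>)
  moreover have "(\<Prod>i\<in>UNIV. LINT y|lborel. hermC (\<alpha> i) y * hermC (\<beta> i) y) = (if \<alpha> = \<beta> then 1 else 0)"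
    using hermC_mult_integral by (auto simp: has_bochner_integral_iff fun_eq_iff)
  ultimately show ?thesis by (simp add: prod.distrib hermite_def)
qed

lemma sum_UNIV_Plus: "(\<Sum>j\<in>(UNIV::('n::finite + 'm::finite) set). f j) = (\<Sum>i\<in>UNIV. f (Inl i)) + (\<Sum>i\<in>UNIV. f (Inr i))"
  by (subst UNIV_Plus_UNIV[symmetric], subst sum.Plus) auto

lemma prod_UNIV_Plus: "(\<Prod>j\<in>(UNIV::('n::finite + 'm::finite) set). f j) = (\<Prod>i\<in>UNIV. f (Inl i)) * (\<Prod>i\<in>UNIV. f (Inr i))"
  by (subst UNIV_Plus_UNIV[symmetric], subst prod.Plus) auto

lemma norm_power2_vec: "(norm x)\<^sup>2 = (\<Sum>i\<in>UNIV. (x $ i)\<^sup>2)" for x :: "real^'n::finite"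
  by (simp add: norm_vec_def L2_set_def sum_nonneg)

lemma hermite_chirp_bound:
  fixes \<alpha> \<beta> :: "'n::finite \<Rightarrow> nat"
  shows "cmod (LINT x|lborel. exp (- \<i> * of_real (t * (norm x)\<^sup>2)) * hermite \<alpha> x * cnj (hermite \<beta> x))
    \<le> (1 + t\<^sup>2) powr (- real CARD('n) / 4)"
proof -
  have "(LINT x|lborel. exp (- \<i> * of_real (t * (norm x)\<^sup>2)) * hermite \<alpha> x * cnj (hermite \<beta> x))
    = (LINT x|lborel. (\<Prod>i\<in>UNIV. exp (- \<i> * of_real (t * (x $ i)\<^sup>2)) * hermC (\<alpha> i) (x $ i) * hermC (\<beta> i) (x $ i)))"
    by (simp add: prod.distrib hermite_def norm_power2_vec sum_distrib_left exp_sum[symmetric] sum_negf)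
  also have "\<dots> = (\<Prod>i\<in>UNIV. chirp_coeff t (\<alpha> i) (\<beta> i))"
    unfolding chirp_coeff_def
    by (rule has_bochner_integral_integral_eq, rule lborel_integral_prod_vec, rule gauss_decay_integrable, rule gauss_decay_chirp)
  finally have "cmod (LINT x|lborel. exp (- \<i> * of_real (t * (norm x)\<^sup>2)) * hermite \<alpha> x * cnj (hermite \<beta> x))
    = (\<Prod>i\<in>UNIV. cmod (chirp_coeff t (\<alpha> i) (\<beta> i)))" by (simp only: prod_norm)
  also have "\<dots> \<le> (\<Prod>i\<in>(UNIV::'n set). (1 + t\<^sup>2) powr (-1/4))"
    by (intro prod_mono conjI norm_ge_zero chirp_coeff_bound)
  also have "\<dots> = (1 + t\<^sup>2) powr (- real CARD('n) / 4)"
  proof -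
    have "1 + t\<^sup>2 \<noteq> 0" by (metis add_pos_nonneg zero_le_power2 zero_less_one less_irrefl)
    then show ?thesis by (subst prod_constant, subst powr_power) simp_all
  qed
  finally show ?thesis .
qed

lemma hermite_fourier:
  fixes \<alpha> :: "'n::finite \<Rightarrow> nat"
  shows "(LINT x|lborel. exp (\<i> * of_real (x \<bullet> \<xi>)) * hermite \<alpha> x)
     = of_real ((2 * pi) powr (real CARD('n) / 2)) * \<i> ^ (\<Sum>i\<in>UNIV. \<alpha> i) * hermite \<alpha> \<xi>"
proof -
  have "(LINT x|lborel. exp (\<i> * of_real (x \<bullet> \<xi>)) * hermite \<alpha> x)
    = (LINT x|lborel. (\<Prod>i\<in>UNIV. exp (\<i> * of_real (x $ i * \<xi> $ i)) * hermC (\<alpha> i) (x $ i)))"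
    by (simp add: prod.distrib hermite_def inner_vec_def sum_distrib_left exp_sum[symmetric])
  also have "\<dots> = (\<Prod>i\<in>UNIV. of_real (sqrt (2 * pi)) * \<i> ^ (\<alpha> i) * hermC (\<alpha> i) (\<xi> $ i))"
  proof -
    have "integrable lborel (\<lambda>x. exp (\<i> * of_real (x * \<xi> $ i)) * hermC (\<alpha> i) x)" for i
      using gauss_decay_integrable[OF gauss_decay_herm_exp[of "\<i> * of_real (\<xi> $ i)"]] by (simp add: mult_ac)
    then show ?thesis
      unfolding hermC_fourier[symmetric] by (intro has_bochner_integral_integral_eq lborel_integral_prod_vec)
  qed
  also have "\<dots> = of_real (sqrt (2 * pi) ^ CARD('n)) * \<i> ^ (\<Sum>i\<in>UNIV. \<alpha> i) * hermite \<alpha> \<xi>"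
    by (simp add: prod.distrib hermite_def power_sum)
  also have "sqrt (2 * pi) ^ CARD('n) = (2 * pi) powr (real CARD('n) / 2)"
    by (simp add: sqrt_power_eq_powr)
  finally show ?thesis .
qed

text \<open>Gaussian wave packets centred at a phase space point. The phase \<open>- x y / 2\<close> makes the
  Hermite coefficients $e^{-|w|^2/2} w^\alpha / \sqrt{\alpha!}$ (up to conjugation) with $w = (x + iy)/\sqrt 2$.\<close>

definition coherent1 :: "real \<Rightarrow> real \<Rightarrow> real \<Rightarrow> complex" where
  "coherent1 x y s = of_real (pi powr (-1/4)) *
     exp (- (of_real (s - x))\<^sup>2 / 2 + \<i> * of_real (s * y) - \<i> * of_real (x * y) / 2)"

definition coherent :: "real ^ ('n::finite + 'n) \<Rightarrow> 'n fn" where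
  "coherent z s = (\<Prod>i\<in>UNIV. coherent1 (z $ Inl i) (z $ Inr i) (s $ i))"

lemma coherent1_alt:
  "coherent1 x y s = (of_real (pi powr (-1/4)) * exp (- of_real (x\<^sup>2) / 2 - \<i> * of_real (x * y) / 2)) *
    exp (- of_real (1/2) * (of_real s)\<^sup>2 + (of_real x + \<i> * of_real y) * of_real s)"
  unfolding coherent1_def mult.assoc mult_exp_exp
  by (intro arg_cong2[where f="(*)"] arg_cong[where f=exp] refl) (simp add: power2_eq_square field_simps)

lemma gauss_decay_coherent1: "gauss_decay (coherent1 x y)"
proof -
  have "coherent1 x y = (\<lambda>s. exp (- of_real (x\<^sup>2) / 2 - \<i> * of_real (x * y) / 2) *
     (exp ((of_real x + \<i> * of_real y) * of_real s) * hermC 0 s))"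
  proof
    fix s :: real
    have "exp ((of_real x + \<i> * of_real y) * of_real s) * hermC 0 s
       = of_real (pi powr (-1/4)) * (exp ((of_real x + \<i> * of_real y) * of_real s) * exp (of_real (- s\<^sup>2/2)))"
      by (simp add: exp_of_real[symmetric])
    also have "\<dots> = of_real (pi powr (-1/4)) * exp (- of_real (1/2) * (of_real s)\<^sup>2 + (of_real x + \<i> * of_real y) * of_real s)"
      unfolding mult_exp_exp by (simp add: algebra_simps)
    finally show "coherent1 x y s = exp (- of_real (x\<^sup>2) / 2 - \<i> * of_real (x * y) / 2) *
     (exp ((of_real x + \<i> * of_real y) * of_real s) * hermC 0 s)"
      unfolding coherent1_alt by (simp only: mult_ac)
  qed
  then show ?thesis by (simp only:) (intro gauss_decay_cmult gauss_decay_herm_exp)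
qed

lemma coherent1_herm:
  "(LINT s|lborel. coherent1 x y s * hermC m s)
    = exp (- of_real (x\<^sup>2 + y\<^sup>2) / 4) * ((of_real x + \<i> * of_real y) / of_real (sqrt 2)) ^ m / of_real (sqrt (fact m))"
proof -
  let ?c = "of_real x + \<i> * of_real y"
  let ?K = "exp (- of_real (x\<^sup>2) / 2 - \<i> * of_real (x * y) / 2)"
  have "(LINT s|lborel. coherent1 x y s * hermC m s) = (of_real (pi powr (-1/4)) * ?K) *
     (LINT s|lborel. exp (- of_real (1/2) * (of_real s)\<^sup>2 + ?c * of_real s) * hermC m s)"
    unfolding coherent1_alt mult.assoc by simp
  also have "\<dots> = (of_real (pi powr (-1/4)) * of_real (pi powr (1/4))) * (?K * exp (?c\<^sup>2 / 4)) * (?c / of_real (sqrt 2)) ^ m / of_real (sqrt (fact m))"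
    unfolding hermC_gauss_exp by (simp only: mult_ac times_divide_eq_right times_divide_eq_left)
  also have "complex_of_real (pi powr (-1/4)) * of_real (pi powr (1/4)) = 1"
    by (simp add: powr_minus flip: of_real_mult)
  \<comment> \<open>The square of \<open>?c\<close> divided by 4 has imaginary part x y / 2, which
    the phase of the wave packet is chosen to cancel.\<close>
  also have "?K * exp (?c\<^sup>2 / 4) = exp (- of_real (x\<^sup>2 + y\<^sup>2) / 4)"
  proof -
    have "- of_real (x\<^sup>2) / 2 - \<i> * of_real (x * y) / 2 + ?c\<^sup>2 / 4 = - of_real (x\<^sup>2 + y\<^sup>2) / 4"
      by (simp add: power2_eq_square field_simps)
    then show ?thesis by (simp only: mult_exp_exp)
  qed
  finally show ?thesis by simp
qed

lemma coherent_hermite: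
  "has_bochner_integral lborel (\<lambda>s. coherent z s * cnj (hermite \<alpha> s))
    (exp (- of_real ((norm z)\<^sup>2) / 4) * (\<Prod>i\<in>UNIV. ((of_real (z $ Inl i) + \<i> * of_real (z $ Inr i)) / of_real (sqrt 2)) ^ \<alpha> i / of_real (sqrt (fact (\<alpha> i)))))"
proof -
  have "has_bochner_integral lborel (\<lambda>s. (\<Prod>i\<in>UNIV. coherent1 (z $ Inl i) (z $ Inr i) (s $ i) * hermC (\<alpha> i) (s $ i)))
    (\<Prod>i\<in>UNIV. LINT s|lborel. coherent1 (z $ Inl i) (z $ Inr i) s * hermC (\<alpha> i) s)"
    by (rule lborel_integral_prod_vec) (intro gauss_decay_integrable gauss_decay_mult gauss_decay_coherent1 gauss_decay_herm)
  moreover have "(norm z)\<^sup>2 = (\<Sum>i\<in>UNIV. (z $ Inl i)\<^sup>2 + (z $ Inr i)\<^sup>2)"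
    unfolding norm_power2_vec sum_UNIV_Plus sum.distrib ..
  then have "exp (- of_real ((norm z)\<^sup>2) / 4) = (\<Prod>i\<in>UNIV. exp (- complex_of_real ((z $ Inl i)\<^sup>2 + (z $ Inr i)\<^sup>2) / 4))"
    unfolding exp_sum[OF finite, symmetric]
    by (simp only: of_real_sum sum_negf[symmetric] sum_divide_distrib)
  then have "(\<Prod>i\<in>UNIV. LINT s|lborel. coherent1 (z $ Inl i) (z $ Inr i) s * hermC (\<alpha> i) s) =
    exp (- of_real ((norm z)\<^sup>2) / 4) * (\<Prod>i\<in>UNIV. ((of_real (z $ Inl i) + \<i> * of_real (z $ Inr i)) / of_real (sqrt 2)) ^ \<alpha> i / of_real (sqrt (fact (\<alpha> i))))"
    unfolding coherent1_herm by (simp only: prod.distrib[symmetric] mult.assoc times_divide_eq_right)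
  ultimately show ?thesis
    by (simp add: coherent_def hermite_def prod.distrib)
qed

lemma coherent1_square:
  "has_bochner_integral lborel (\<lambda>s. coherent1 x y s * cnj (coherent1 x y s)) 1"
proof -
  have "coherent1 x y s * cnj (coherent1 x y s) = of_real (exp (- x\<^sup>2) / sqrt pi) * exp (- of_real 1 * (of_real s)\<^sup>2 + of_real (2 * x) * of_real s)" for s
  proof -
    have "complex_of_real (pi powr (-1/4)) * of_real (pi powr (-1/4)) = of_real (1 / sqrt pi)"
      by (simp only: of_real_mult[symmetric] pi_powr_quarter_square)
    moreover have "exp (- (of_real (s - x))\<^sup>2 / 2 + \<i> * of_real (s * y) - \<i> * of_real (x * y) / 2) * cnj (exp (- (of_real (s - x))\<^sup>2 / 2 + \<i> * of_real (s * y) - \<i> * of_real (x * y) / 2))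
      = exp (of_real (- x\<^sup>2)) * exp (- of_real 1 * (of_real s)\<^sup>2 + of_real (2 * x) * of_real s)"
      unfolding exp_cnj mult_exp_exp by (rule arg_cong[where f=exp]) (simp add: power2_eq_square field_simps)
    moreover have "complex_of_real (exp (- x\<^sup>2) / sqrt pi) = of_real (1 / sqrt pi) * exp (of_real (- x\<^sup>2))"
      by (simp only: exp_of_real of_real_mult[symmetric]) simp
    moreover have "P * U * (P * V) = R * Y" if "P * P = Q" "U * V = X * Y" "R = Q * X" for P Q R U V X Y :: complex
    proof -
      have "P * U * (P * V) = (P * P) * (U * V)" by (simp only: mult_ac)
      then show ?thesis unfolding that by (simp only: mult_ac)
    qed
    ultimately show ?thesis
      unfolding coherent1_def complex_cnj_mult complex_cnj_complex_of_real by blast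
  qed
  moreover have "has_bochner_integral lborel (\<lambda>s. complex_of_real (exp (- x\<^sup>2) / sqrt pi) * exp (- of_real 1 * (of_real s)\<^sup>2 + of_real (2 * x) * of_real s))
    (complex_of_real (exp (- x\<^sup>2) / sqrt pi) * (of_real (sqrt (pi / 1)) * exp ((of_real (2 * x))\<^sup>2 / (4 * of_real 1))))"
    by (rule has_bochner_integral_mult_right, rule gauss_integral) simp
  moreover have "complex_of_real (exp (- x\<^sup>2) / sqrt pi) * (of_real (sqrt (pi / 1)) * exp ((of_real (2 * x))\<^sup>2 / (4 * of_real 1))) = 1"
  proof -
    have "exp ((complex_of_real (2 * x))\<^sup>2 / (4 * of_real 1)) = of_real (exp (x\<^sup>2))"
      by (simp add: power_mult_distrib exp_of_real[symmetric])
    moreover have "exp (- x\<^sup>2) / sqrt pi * (sqrt (pi / 1) * exp (x\<^sup>2)) = 1" by (simp add: exp_minus)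
    ultimately show ?thesis by (simp only: of_real_mult[symmetric] of_real_1)
  qed
  ultimately show ?thesis by simp
qed

lemma coherent_square:
  "has_bochner_integral lborel (\<lambda>s. coherent z s * cnj (coherent z s)) 1"
proof -
  have "has_bochner_integral lborel (\<lambda>s. (\<Prod>i\<in>UNIV. coherent1 (z $ Inl i) (z $ Inr i) (s $ i) * cnj (coherent1 (z $ Inl i) (z $ Inr i) (s $ i))))
    (\<Prod>i\<in>UNIV. LINT s|lborel. coherent1 (z $ Inl i) (z $ Inr i) s * cnj (coherent1 (z $ Inl i) (z $ Inr i) s))"
    by (rule lborel_integral_prod_vec) (use coherent1_square in \<open>auto simp: has_bochner_integral_iff\<close>)
  then show ?thesis using coherent1_square by (simp add: coherent_def prod.distrib has_bochner_integral_iff)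
qed

lemma coherent_measurable2 [measurable]: "(\<lambda>(z::real^('n::finite + 'n), s). coherent z s) \<in> borel_measurable (borel \<Otimes>\<^sub>M borel)"
proof -
  have "continuous_on UNIV (\<lambda>p::(real^('n + 'n)) \<times> (real^'n). coherent (fst p) (snd p))"
    unfolding coherent_def coherent1_def
    by (intro continuous_on_prod continuous_intros continuous_on_component) auto
  then show ?thesis
    unfolding borel_prod case_prod_beta' by (rule borel_measurable_continuous_onI)
qed

lemma coherent_0: "coherent 0 s = hermite (\<lambda>_. 0) s"
  by (simp add: coherent_def coherent1_def hermite_def exp_of_real[symmetric])

text \<open>The parameter \<tau> serves two computations. At \<tau> = 0 this is the regularised
  reproducing kernel; at \<tau> = 1 the extra exponential cancels the oscillation of the integrand,
  which gives the integral of its absolute value.\<close>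

lemma coherent_kernel:
  fixes s s' :: "real ^ 'n::finite"
  assumes e: "e > 0"
  shows "has_bochner_integral lborel (\<lambda>z. cnj (coherent z s) * coherent z s' * of_real (exp (- e * (norm (im_part z))\<^sup>2)) * exp (\<i> * of_real (\<tau> * ((s - s') \<bullet> im_part z))))
    (of_real ((pi / e) powr (real CARD('n) / 2) * exp (- (1/4 + (1 - \<tau>)\<^sup>2/(4*e)) * (norm (s - s'))\<^sup>2)))"
proof -
  \<comment> \<open>One factor for each real coordinate of phase space. The position factors are
    Gaussians centred at the midpoint of \<open>s $ i\<close> and \<open>s' $ i\<close>; the
    momentum factors oscillate and are damped by the weight \<open>e\<close> alone.\<close>
  define f :: "'n + 'n \<Rightarrow> real \<Rightarrow> complex" where
    "f j = (case j of Inl i \<Rightarrow> (\<lambda>x. of_real (1 / sqrt pi) * exp (- of_real (((s$i)\<^sup>2 + (s'$i)\<^sup>2) / 2)) * exp (- of_real 1 * (of_real x)\<^sup>2 + of_real (s$i + s'$i) * of_real x))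
     | Inr i \<Rightarrow> (\<lambda>y. exp (- of_real e * (of_real y)\<^sup>2 + (- \<i> * of_real ((1 - \<tau>) * (s$i - s'$i))) * of_real y)))" for j
  define v :: "'n + 'n \<Rightarrow> complex" where
    "v j = (case j of Inl i \<Rightarrow> of_real (exp (- (s$i - s'$i)\<^sup>2 / 4))
     | Inr i \<Rightarrow> of_real (sqrt (pi/e) * exp (- ((1 - \<tau>) * (s$i - s'$i))\<^sup>2 / (4 * e))))" for j
  have fv: "has_bochner_integral lborel (f j) (v j)" for j
  proof (cases j)
    case (Inl i)
    have "has_bochner_integral lborel (f j) (of_real (1 / sqrt pi) * exp (- of_real (((s$i)\<^sup>2 + (s'$i)\<^sup>2) / 2)) * (of_real (sqrt (pi / 1)) * exp ((of_real (s$i + s'$i))\<^sup>2 / (4 * of_real 1))))"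
      unfolding f_def Inl sum.case by (rule has_bochner_integral_mult_right, rule gauss_integral) simp
    moreover have "of_real (1 / sqrt pi) * exp (- of_real (((s$i)\<^sup>2 + (s'$i)\<^sup>2) / 2)) * (of_real (sqrt (pi / 1)) * exp ((of_real (s$i + s'$i))\<^sup>2 / (4 * of_real 1))) = v j"
    proof -
      have "- of_real (((s$i)\<^sup>2 + (s'$i)\<^sup>2) / 2) + (of_real (s$i + s'$i))\<^sup>2 / (4 * of_real 1) = complex_of_real (- (s$i - s'$i)\<^sup>2 / 4)"
        by (simp add: power2_eq_square field_simps)
      then have "exp (- of_real (((s$i)\<^sup>2 + (s'$i)\<^sup>2) / 2)) * exp ((of_real (s$i + s'$i))\<^sup>2 / (4 * of_real 1)) = complex_of_real (exp (- (s$i - s'$i)\<^sup>2 / 4))"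
        by (simp only: mult_exp_exp exp_of_real)
      moreover have "a * b * (c * d) = (a * c) * (b * d)" for a b c d :: complex by (simp add: mult_ac)
      moreover have "complex_of_real (1 / sqrt pi) * of_real (sqrt (pi / 1)) = 1" by (simp flip: of_real_mult)
      ultimately show ?thesis unfolding v_def Inl sum.case by (simp only: mult_1)
    qed
    ultimately show ?thesis by simp
  next
    case (Inr i)
    have "has_bochner_integral lborel (f j) (of_real (sqrt (pi / e)) * exp ((- \<i> * of_real ((1 - \<tau>) * (s$i - s'$i)))\<^sup>2 / (4 * of_real e)))"
      unfolding f_def Inr sum.case by (rule gauss_integral[OF e])
    moreover have "(- \<i> * of_real ((1 - \<tau>) * (s$i - s'$i)))\<^sup>2 / (4 * of_real e) = complex_of_real (- ((1 - \<tau>) * (s$i - s'$i))\<^sup>2 / (4 * e))"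
      by (simp add: power_mult_distrib[of \<i>] power_mult_distrib[of "- \<i>"])
    then have "exp ((- \<i> * of_real ((1 - \<tau>) * (s$i - s'$i)))\<^sup>2 / (4 * of_real e)) = of_real (exp (- ((1 - \<tau>) * (s$i - s'$i))\<^sup>2 / (4 * e)))"
      by (simp only: exp_of_real)
    ultimately show ?thesis unfolding v_def Inr sum.case by (simp only: of_real_mult)
  qed
  have "has_bochner_integral lborel (\<lambda>z. \<Prod>j\<in>UNIV. f j (z $ j)) (\<Prod>j\<in>UNIV. LINT y|lborel. f j y)"
    by (rule lborel_integral_prod_vec) (use fv in \<open>auto simp: has_bochner_integral_iff\<close>)
  moreover have "(\<Prod>j\<in>UNIV. LINT y|lborel. f j y) = (\<Prod>j\<in>UNIV. v j)"
    using fv by (simp add: has_bochner_integral_iff)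
  moreover have "(\<Prod>j\<in>UNIV. v j) = of_real ((pi / e) powr (real CARD('n) / 2) * exp (- (1/4 + (1 - \<tau>)\<^sup>2/(4*e)) * (norm (s - s'))\<^sup>2))"
  proof -
    have "(\<Prod>j\<in>UNIV. v j) = (\<Prod>i\<in>UNIV. v (Inl i)) * (\<Prod>i\<in>UNIV. v (Inr i))"
      by (rule prod_UNIV_Plus)
    also have "\<dots> = of_real (sqrt (pi/e) ^ CARD('n) * (exp (\<Sum>i\<in>UNIV. - (s$i - s'$i)\<^sup>2 / 4) * exp (\<Sum>i\<in>UNIV. - ((1 - \<tau>) * (s$i - s'$i))\<^sup>2 / (4 * e))))"
      unfolding exp_sum[OF finite] by (simp add: v_def prod.distrib)
    also have "sqrt (pi/e) ^ CARD('n) = (pi / e) powr (real CARD('n) / 2)"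
      using e by (simp add: sqrt_power_eq_powr)
    also have "exp (\<Sum>i\<in>UNIV. - (s$i - s'$i)\<^sup>2 / 4) * exp (\<Sum>i\<in>UNIV. - ((1 - \<tau>) * (s$i - s'$i))\<^sup>2 / (4 * e)) = exp (- (1/4 + (1 - \<tau>)\<^sup>2/(4*e)) * (norm (s - s'))\<^sup>2)"
      unfolding mult_exp_exp norm_power2_vec power_mult_distrib
      by (simp add: sum_negf sum_divide_distrib[symmetric] sum_distrib_left[symmetric] left_diff_distrib)
    finally show ?thesis .
  qed
  moreover have "(\<Prod>j\<in>UNIV. f j (z $ j)) = cnj (coherent z s) * coherent z s' * of_real (exp (- e * (norm (im_part z))\<^sup>2)) * exp (\<i> * of_real (\<tau> * ((s - s') \<bullet> im_part z)))" for z
  proof -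
    have 1: "(\<Prod>j\<in>UNIV. f j (z $ j)) = (\<Prod>i\<in>UNIV. f (Inl i) (z $ Inl i) * f (Inr i) (z $ Inr i))"
      unfolding prod_UNIV_Plus prod.distrib ..
    have 2: "f (Inl i) (z $ Inl i) * f (Inr i) (z $ Inr i) = cnj (coherent1 (z $ Inl i) (z $ Inr i) (s $ i)) * coherent1 (z $ Inl i) (z $ Inr i) (s' $ i) * exp (of_real (- e * (z $ Inr i)\<^sup>2)) * exp (\<i> * of_real (\<tau> * ((s $ i - s' $ i) * z $ Inr i)))" for i
    proof -
      define x y a b where "x = z $ Inl i" and "y = z $ Inr i" and "a = s $ i" and "b = s' $ i"
      have pp: "complex_of_real (pi powr (-1/4)) * of_real (pi powr (-1/4)) = of_real (1 / sqrt pi)"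
        by (simp only: of_real_mult[symmetric] pi_powr_quarter_square)
      have r: "p * u * (p * w) * t * t' = (p * p) * (u * w * t * t')" for p u w t t' :: complex by (simp add: mult_ac)
      have "f (Inl i) x * f (Inr i) y = of_real (1 / sqrt pi) * exp ((- of_real ((a\<^sup>2 + b\<^sup>2) / 2) + (- of_real 1 * (of_real x)\<^sup>2 + of_real (a + b) * of_real x)) + (- of_real e * (of_real y)\<^sup>2 + (- \<i> * of_real ((1 - \<tau>) * (a - b))) * of_real y))"
        unfolding f_def a_def b_def by (simp only: sum.case mult.assoc mult_exp_exp)
      moreover have "cnj (coherent1 x y a) * coherent1 x y b * exp (of_real (- e * y\<^sup>2)) * exp (\<i> * of_real (\<tau> * ((a - b) * y))) =
        of_real (1 / sqrt pi) * exp (cnj (- (of_real (a - x))\<^sup>2 / 2 + \<i> * of_real (a * y) - \<i> * of_real (x * y) / 2) +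
          (- (of_real (b - x))\<^sup>2 / 2 + \<i> * of_real (b * y) - \<i> * of_real (x * y) / 2) + of_real (- e * y\<^sup>2) + \<i> * of_real (\<tau> * ((a - b) * y)))"
        unfolding coherent1_def complex_cnj_mult complex_cnj_complex_of_real r pp exp_cnj mult_exp_exp ..
      moreover have "(- of_real ((a\<^sup>2 + b\<^sup>2) / 2) + (- of_real 1 * (of_real x)\<^sup>2 + of_real (a + b) * of_real x)) + (- of_real e * (of_real y)\<^sup>2 + (- \<i> * of_real ((1 - \<tau>) * (a - b))) * of_real y)
        = cnj (- (of_real (a - x))\<^sup>2 / 2 + \<i> * of_real (a * y) - \<i> * of_real (x * y) / 2) +
          (- (of_real (b - x))\<^sup>2 / 2 + \<i> * of_real (b * y) - \<i> * of_real (x * y) / 2) + of_real (- e * y\<^sup>2) + \<i> * of_real (\<tau> * ((a - b) * y))"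
        by (simp add: power2_eq_square field_simps)
      ultimately show ?thesis unfolding x_def y_def a_def b_def by (simp only:)
    qed
    have 3: "of_real (exp (- e * (norm (im_part z))\<^sup>2)) = (\<Prod>i\<in>UNIV. exp (complex_of_real (- e * (z $ Inr i)\<^sup>2)))"
      unfolding norm_power2_vec by (simp add: im_part_def sum_distrib_left exp_sum exp_of_real[symmetric] sum_negf[symmetric])
    have 4: "exp (\<i> * of_real (\<tau> * ((s - s') \<bullet> im_part z))) = (\<Prod>i\<in>UNIV. exp (\<i> * complex_of_real (\<tau> * ((s $ i - s' $ i) * z $ Inr i))))"
      by (simp add: im_part_def inner_vec_def sum_distrib_left exp_sum)
    show ?thesis unfolding 1 2 3 4 by (simp add: coherent_def prod.distrib)
  qed
  ultimately show ?thesis by simp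
qed

section \<open>The Hilbert space $L^2$\<close>

lemma borel_measurable_cnj [measurable (raw)]:
  "f \<in> borel_measurable M \<Longrightarrow> (\<lambda>x. cnj (f x)) \<in> borel_measurable M"
  by (rule measurable_compose[OF _ borel_measurable_continuous_onI[of cnj]]) (auto intro: continuous_intros)

lemma L2_measurable: "f \<in> L2 \<Longrightarrow> f \<in> borel_measurable borel"
  by (simp add: L2_def)

lemma L2_square_integrable: "f \<in> L2 \<Longrightarrow> integrable lborel (\<lambda>x. (cmod (f x))\<^sup>2)"
  by (simp add: L2_def)

lemma L2I: "f \<in> borel_measurable borel \<Longrightarrow> integrable lborel (\<lambda>x. (cmod (f x))\<^sup>2) \<Longrightarrow> f \<in> L2"
  by (simp add: L2_def)

lemma L2_mult_integrable:
  assumes "f \<in> L2" "g \<in> L2"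
  shows "integrable lborel (\<lambda>x. f x * g x)"
proof -
  note [measurable] = assms[THEN L2_measurable]
  have "integrable lborel (\<lambda>x. (cmod (f x))\<^sup>2 + (cmod (g x))\<^sup>2)"
    using assms[THEN L2_square_integrable] by simp
  then show ?thesis
  proof (rule Bochner_Integration.integrable_bound)
    have "cmod (f x * g x) \<le> norm ((cmod (f x))\<^sup>2 + (cmod (g x))\<^sup>2)" for x
    proof -
      have "0 \<le> (cmod (f x) - cmod (g x))\<^sup>2" by simp
      then have "2 * (cmod (f x) * cmod (g x)) \<le> (cmod (f x))\<^sup>2 + (cmod (g x))\<^sup>2"
        by (simp add: power2_eq_square algebra_simps)
      moreover have "0 \<le> cmod (f x) * cmod (g x)" by simp
      ultimately show ?thesis by (simp only: norm_mult real_norm_def)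
    qed
    then show "AE x in lborel. cmod (f x * g x) \<le> norm ((cmod (f x))\<^sup>2 + (cmod (g x))\<^sup>2)" by simp
  qed measurable
qed

lemma L2_cnj: "f \<in> L2 \<Longrightarrow> (\<lambda>x. cnj (f x)) \<in> L2"
  by (auto simp: L2_def)

lemma L2_inner_integrable: "f \<in> L2 \<Longrightarrow> g \<in> L2 \<Longrightarrow> integrable lborel (\<lambda>x. f x * cnj (g x))"
  by (rule L2_mult_integrable[OF _ L2_cnj])

lemma L2_cmult: "f \<in> L2 \<Longrightarrow> (\<lambda>x. c * f x) \<in> L2"
  by (auto simp: L2_def norm_mult power_mult_distrib)

lemma L2_add:
  assumes "f \<in> L2" "g \<in> L2"
  shows "(\<lambda>x. f x + g x) \<in> L2"
proof (rule L2I)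
  note [measurable] = assms[THEN L2_measurable]
  show "(\<lambda>x. f x + g x) \<in> borel_measurable borel" by measurable
  have "integrable lborel (\<lambda>x. 2 * (cmod (f x))\<^sup>2 + 2 * (cmod (g x))\<^sup>2)"
    using assms[THEN L2_square_integrable] by simp
  then show "integrable lborel (\<lambda>x. (cmod (f x + g x))\<^sup>2)"
  proof (rule Bochner_Integration.integrable_bound)
    have "norm ((cmod (f x + g x))\<^sup>2) \<le> norm (2 * (cmod (f x))\<^sup>2 + 2 * (cmod (g x))\<^sup>2)" for x
    proof -
      have "(cmod (f x + g x))\<^sup>2 \<le> (cmod (f x) + cmod (g x))\<^sup>2" by (intro power_mono norm_triangle_ineq) simp
      also have "\<dots> \<le> 2 * (cmod (f x))\<^sup>2 + 2 * (cmod (g x))\<^sup>2"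
        using zero_le_power2[of "cmod (f x) - cmod (g x)"] by (simp add: power2_eq_square algebra_simps)
      finally show ?thesis by simp
    qed
    then show "AE x in lborel. norm ((cmod (f x + g x))\<^sup>2) \<le> norm (2 * (cmod (f x))\<^sup>2 + 2 * (cmod (g x))\<^sup>2)" by simp
  qed measurable
qed

lemma L2_diff: "f \<in> L2 \<Longrightarrow> g \<in> L2 \<Longrightarrow> (\<lambda>x. f x - g x) \<in> L2"
  using L2_add[of f "\<lambda>x. (-1) * g x"] L2_cmult[of g "-1"] by simp

lemma L2_zero: "(\<lambda>_. 0) \<in> L2"
  by (simp add: L2_def)

lemma L2_sum: "finite A \<Longrightarrow> (\<And>a. a \<in> A \<Longrightarrow> f a \<in> L2) \<Longrightarrow> (\<lambda>x. \<Sum>a\<in>A. f a x) \<in> L2"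
  by (induction A rule: finite_induct) (auto intro: L2_zero L2_add)

lemma L2_inner_cnj: "cnj (L2_inner f g) = L2_inner g f"
  unfolding L2_inner_def by (subst Bochner_Integration.integral_cnj[symmetric]) (simp add: mult.commute)

lemma L2_inner_diff_left: "f \<in> L2 \<Longrightarrow> g \<in> L2 \<Longrightarrow> h \<in> L2 \<Longrightarrow> L2_inner (\<lambda>x. f x - g x) h = L2_inner f h - L2_inner g h"
  by (simp add: L2_inner_def left_diff_distrib Bochner_Integration.integral_diff L2_inner_integrable)

lemma L2_inner_cmult_left: "L2_inner (\<lambda>x. c * f x) h = c * L2_inner f h"
  by (simp add: L2_inner_def mult.assoc)

lemma L2_inner_sum_left:
  assumes "finite A" "\<And>a. a \<in> A \<Longrightarrow> f a \<in> L2" "h \<in> L2"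
  shows "L2_inner (\<lambda>x. \<Sum>a\<in>A. f a x) h = (\<Sum>a\<in>A. L2_inner (f a) h)"
  unfolding L2_inner_def sum_distrib_right by (rule Bochner_Integration.integral_sum) (auto intro: L2_inner_integrable assms)

lemma L2_inner_diff_right: "f \<in> L2 \<Longrightarrow> g \<in> L2 \<Longrightarrow> h \<in> L2 \<Longrightarrow> L2_inner h (\<lambda>x. f x - g x) = L2_inner h f - L2_inner h g"
  using L2_inner_diff_left[of f g h] by (metis L2_inner_cnj complex_cnj_diff)

lemma L2_inner_cmult_right: "L2_inner h (\<lambda>x. c * f x) = cnj c * L2_inner h f"
  using L2_inner_cmult_left[of c f h] by (metis L2_inner_cnj complex_cnj_mult)

lemma L2_inner_sum_right:
  assumes "finite A" "\<And>a. a \<in> A \<Longrightarrow> f a \<in> L2" "h \<in> L2"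
  shows "L2_inner h (\<lambda>x. \<Sum>a\<in>A. f a x) = (\<Sum>a\<in>A. L2_inner h (f a))"
proof -
  have "cnj (L2_inner (\<lambda>x. \<Sum>a\<in>A. f a x) h) = cnj (\<Sum>a\<in>A. L2_inner (f a) h)" by (simp only: L2_inner_sum_left[OF assms])
  then show ?thesis unfolding cnj_sum L2_inner_cnj .
qed

lemma L2_norm_nonneg [simp]: "L2_norm f \<ge> 0"
  by (simp add: L2_norm_def)

lemma L2_norm_power2: "(L2_norm f)\<^sup>2 = (LINT x|lborel. (cmod (f x))\<^sup>2)"
  by (simp add: L2_norm_def)

lemma L2_inner_self: "L2_inner f f = of_real ((L2_norm f)\<^sup>2)"
  unfolding L2_inner_def L2_norm_power2 integral_complex_of_real[symmetric]
  by (simp add: complex_norm_square del: of_real_power)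

lemma L2_norm_diff_power2:
  assumes "f \<in> L2" "g \<in> L2"
  shows "(L2_norm (\<lambda>x. f x - g x))\<^sup>2 = (L2_norm f)\<^sup>2 - 2 * Re (L2_inner f g) + (L2_norm g)\<^sup>2"
proof -
  have "L2_inner (\<lambda>x. f x - g x) (\<lambda>x. f x - g x) = L2_inner f f - L2_inner f g - cnj (L2_inner f g) + L2_inner g g"
    using assms by (simp add: L2_inner_diff_left L2_inner_diff_right L2_diff L2_inner_cnj)
  then have "Re (L2_inner (\<lambda>x. f x - g x) (\<lambda>x. f x - g x)) = Re (L2_inner f f) - 2 * Re (L2_inner f g) + Re (L2_inner g g)" by simp
  then show ?thesis by (simp only: L2_inner_self Re_complex_of_real)
qed

lemma L2_norm_cmult: "L2_norm (\<lambda>x. c * f x) = cmod c * L2_norm f"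
  by (simp add: L2_norm_def norm_mult power_mult_distrib real_sqrt_mult)

lemma L2_norm_eq_0:
  assumes "f \<in> L2" "L2_norm f = 0"
  shows "AE x in lborel. f x = 0"
proof -
  have "(LINT x|lborel. (cmod (f x))\<^sup>2) = 0" using assms by (simp add: L2_norm_power2[symmetric])
  then have "AE x in lborel. (cmod (f x))\<^sup>2 = 0"
    using integral_nonneg_eq_0_iff_AE[OF L2_square_integrable[OF assms(1)]] by simp
  then show ?thesis by simp
qed

lemma L2_inner_cong_AE:
  assumes "f \<in> L2" "f' \<in> L2" "g \<in> L2" "AE x in lborel. f x = f' x"
  shows "L2_inner f g = L2_inner f' g"
proof -
  note [measurable] = assms(1-3)[THEN L2_measurable]
  show ?thesis unfolding L2_inner_def
    by (rule integral_cong_AE) (measurable, use assms(4) in auto)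
qed

lemma L2_cauchy_schwarz:
  assumes "f \<in> L2" "g \<in> L2"
  shows "cmod (L2_inner f g) \<le> L2_norm f * L2_norm g"
proof (cases "L2_norm g = 0")
  case True
  have "L2_inner g f = 0"
    using L2_inner_cong_AE[OF assms(2) L2_zero assms(1)] L2_norm_eq_0[OF assms(2) True] by (simp add: L2_inner_def)
  then have "L2_inner f g = 0" using L2_inner_cnj[of g f] by simp
  then show ?thesis by simp
next
  case False
  define G where "G = (L2_norm g)\<^sup>2"
  have G: "G > 0" using False by (simp add: G_def)
  \<comment> \<open>\<open>c\<close> times \<open>g\<close> is the orthogonal projection of
    \<open>f\<close> onto the line spanned by \<open>g\<close>; the inequality says that the
    remainder has nonnegative squared norm.\<close>
  define c where "c = L2_inner f g / of_real G"
  have "0 \<le> (L2_norm (\<lambda>x. f x - c * g x))\<^sup>2" by simp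
  also have "\<dots> = (L2_norm f)\<^sup>2 - 2 * Re (cnj c * L2_inner f g) + (cmod c)\<^sup>2 * G"
    by (subst L2_norm_diff_power2) (auto intro: assms L2_cmult simp: L2_norm_cmult power_mult_distrib G_def L2_inner_cmult_right)
  also have "cnj c * L2_inner f g = of_real ((cmod (L2_inner f g))\<^sup>2 / G)"
    by (simp add: c_def complex_norm_square mult.commute del: of_real_power)
  also have "(cmod c)\<^sup>2 * G = (cmod (L2_inner f g))\<^sup>2 / G"
    using G by (simp add: c_def norm_divide power_divide power2_eq_square)
  finally have "(cmod (L2_inner f g))\<^sup>2 / G \<le> (L2_norm f)\<^sup>2" by simp
  then have "(cmod (L2_inner f g))\<^sup>2 \<le> (L2_norm f * L2_norm g)\<^sup>2"
    using G by (simp add: G_def power_mult_distrib divide_le_eq)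
  then show ?thesis by (rule power2_le_imp_le) simp
qed

lemma hermite_L2 [simp]: "hermite \<alpha> \<in> L2"
proof (rule L2I)
  have "integrable lborel (\<lambda>x. Re (hermite \<alpha> x * cnj (hermite \<alpha> x)))"
    using hermite_orthonormal[of \<alpha> \<alpha>] by (simp only: integrable_Re has_bochner_integral_iff)
  then show "integrable lborel (\<lambda>x. (cmod (hermite \<alpha> x))\<^sup>2)"
    by (simp only: complex_norm_square[symmetric] of_real_power[symmetric] Re_complex_of_real)
qed simp

lemma coherent_measurable [measurable]: "coherent z \<in> borel_measurable borel"
  using measurable_compose[OF measurable_Pair1'[of z borel borel] coherent_measurable2] by simp

lemma coherent_L2 [simp]: "coherent z \<in> L2"
proof (rule L2I)
  have "integrable lborel (\<lambda>x. Re (coherent z x * cnj (coherent z x)))"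
    using coherent_square[of z] by (simp only: integrable_Re has_bochner_integral_iff)
  then show "integrable lborel (\<lambda>x. (cmod (coherent z x))\<^sup>2)"
    by (simp only: complex_norm_square[symmetric] of_real_power[symmetric] Re_complex_of_real)
qed simp

lemma coherent_norm [simp]: "L2_norm (coherent z) = 1"
proof -
  have "L2_inner (coherent z) (coherent z) = 1"
    using coherent_square[of z] by (simp add: L2_inner_def has_bochner_integral_iff)
  then have "(L2_norm (coherent z))\<^sup>2 = 1" unfolding L2_inner_self by (simp only: of_real_eq_1_iff)
  then show ?thesis by (metis L2_norm_nonneg power2_eq_1_iff neg_0_le_iff_le not_one_le_zero)
qed

section \<open>Hermite coefficients and finite projections\<close>

definition hcoeff :: "('n::finite) fn \<Rightarrow> ('n \<Rightarrow> nat) \<Rightarrow> complex" where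
  "hcoeff f \<alpha> = L2_inner f (hermite \<alpha>)"

text \<open>Boxes are preferred to sets of bounded total degree because a sum of products over a box
  factors into one-dimensional sums.\<close>

definition cube :: "nat \<Rightarrow> ('n::finite \<Rightarrow> nat) set" where
  "cube N = PiE UNIV (\<lambda>_. {..N})"

lemma finite_cube [simp]: "finite (cube N)"
  unfolding cube_def by (rule finite_PiE) auto

definition hproj :: "nat \<Rightarrow> ('n::finite) fn \<Rightarrow> 'n fn" where
  "hproj N f x = (\<Sum>\<alpha>\<in>cube N. hcoeff f \<alpha> * hermite \<alpha> x)"

lemma hermite_inner: "L2_inner (hermite \<alpha>) (hermite \<beta>) = (if \<alpha> = \<beta> then 1 else 0)"
  using hermite_orthonormal[of \<alpha> \<beta>] by (simp add: L2_inner_def has_bochner_integral_iff)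

lemma hproj_L2 [simp]: "hproj N f \<in> L2"
  unfolding hproj_def[abs_def] by (intro L2_sum L2_cmult) auto

lemma hproj_inner_left: "g \<in> L2 \<Longrightarrow> L2_inner (hproj N f) g = (\<Sum>\<alpha>\<in>cube N. hcoeff f \<alpha> * cnj (hcoeff g \<alpha>))"
  unfolding hproj_def[abs_def]
  by (subst L2_inner_sum_left) (auto intro: L2_cmult simp: L2_inner_cmult_left hcoeff_def L2_inner_cnj)

lemma hproj_inner_right: "f \<in> L2 \<Longrightarrow> L2_inner f (hproj N g) = (\<Sum>\<alpha>\<in>cube N. hcoeff f \<alpha> * cnj (hcoeff g \<alpha>))"
  unfolding hproj_def[abs_def]
  by (subst L2_inner_sum_right) (auto intro: L2_cmult intro!: sum.cong mult.commute simp: L2_inner_cmult_right hcoeff_def L2_inner_cnj)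

lemma hcoeff_hproj: "hcoeff (hproj N f) \<alpha> = (if \<alpha> \<in> cube N then hcoeff f \<alpha> else 0)"
proof -
  have "hcoeff (hproj N f) \<alpha> = (\<Sum>\<beta>\<in>cube N. hcoeff f \<beta> * (if \<beta> = \<alpha> then 1 else 0))"
    unfolding hcoeff_def[of "hproj N f"] by (subst hproj_inner_left) (auto simp: hcoeff_def hermite_inner intro!: sum.cong)
  also have "\<dots> = (\<Sum>\<beta>\<in>cube N. if \<beta> = \<alpha> then hcoeff f \<beta> else 0)"
    by (intro sum.cong) auto
  finally show ?thesis by simp
qed

lemma hproj_norm: "(L2_norm (hproj N f))\<^sup>2 = (\<Sum>\<alpha>\<in>cube N. (cmod (hcoeff f \<alpha>))\<^sup>2)"
proof -
  have "complex_of_real ((L2_norm (hproj N f))\<^sup>2) = (\<Sum>\<alpha>\<in>cube N. hcoeff f \<alpha> * cnj (hcoeff f \<alpha>))"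
    unfolding L2_inner_self[symmetric] by (subst hproj_inner_left) (auto simp: hcoeff_hproj)
  also have "\<dots> = of_real (\<Sum>\<alpha>\<in>cube N. (cmod (hcoeff f \<alpha>))\<^sup>2)"
    by (simp add: complex_norm_square del: of_real_power)
  finally show ?thesis by (simp only: of_real_eq_iff)
qed

lemma hproj_diff_norm:
  assumes "f \<in> L2"
  shows "(L2_norm (\<lambda>x. f x - hproj N f x))\<^sup>2 = (L2_norm f)\<^sup>2 - (\<Sum>\<alpha>\<in>cube N. (cmod (hcoeff f \<alpha>))\<^sup>2)"
proof -
  have "L2_inner f (hproj N f) = of_real (\<Sum>\<alpha>\<in>cube N. (cmod (hcoeff f \<alpha>))\<^sup>2)"
    using assms by (simp add: hproj_inner_right complex_norm_square del: of_real_power)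
  then show ?thesis using assms by (subst L2_norm_diff_power2) (auto simp: hproj_norm)
qed

lemma hcoeff_bessel: "f \<in> L2 \<Longrightarrow> (\<Sum>\<alpha>\<in>cube N. (cmod (hcoeff f \<alpha>))\<^sup>2) \<le> (L2_norm f)\<^sup>2"
  using hproj_diff_norm[of f N] zero_le_power2[of "L2_norm (\<lambda>x. f x - hproj N f x)"] by linarith

text \<open>The squared coefficients are the weights of a product of Poisson distributions with
  means \<open>r i\<close>, so their sums over boxes are products of partial sums of exponential
  series. This is Parseval's identity for coherent states, from which the general case will be
  derived.\<close>

lemma hcoeff_coherent_sum:
  "(\<lambda>N. \<Sum>\<alpha>\<in>cube N. (cmod (hcoeff (coherent z) \<alpha>))\<^sup>2) \<longlonglongrightarrow> 1"
proof -
  define r where "r i = ((z $ Inl i)\<^sup>2 + (z $ Inr i)\<^sup>2) / 2" for i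
  have nz: "(norm z)\<^sup>2 / 2 = (\<Sum>i\<in>UNIV. r i)"
    unfolding norm_power2_vec sum_UNIV_Plus r_def by (simp add: sum.distrib sum_divide_distrib add_divide_distrib)
  have 1: "(cmod (hcoeff (coherent z) \<alpha>))\<^sup>2 = exp (- (norm z)\<^sup>2 / 2) * (\<Prod>i\<in>UNIV. r i ^ \<alpha> i / fact (\<alpha> i))" for \<alpha>
  proof -
    have w: "(cmod ((of_real x + \<i> * of_real y) / of_real (sqrt 2)))\<^sup>2 = (x\<^sup>2 + y\<^sup>2) / 2" for x y
    proof -
      have "(cmod (of_real x + \<i> * of_real y))\<^sup>2 = x\<^sup>2 + y\<^sup>2" by (simp add: cmod_power2)
      then show ?thesis by (simp add: norm_divide power_divide)
    qed
    have wk: "(cmod ((((of_real x + \<i> * of_real y) / of_real (sqrt 2)) ^ k) / of_real (sqrt (fact k))))\<^sup>2 = ((x\<^sup>2 + y\<^sup>2) / 2) ^ k / fact k" for x y k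
    proof -
      have "(cmod ((((of_real x + \<i> * of_real y) / of_real (sqrt 2)) ^ k) / of_real (sqrt (fact k))))\<^sup>2
        = ((cmod ((of_real x + \<i> * of_real y) / of_real (sqrt 2)))\<^sup>2) ^ k / fact k"
        unfolding norm_divide[of "_ ^ k"] norm_power power_divide[of "_ ^ k"] by (simp add: power_mult[symmetric] mult.commute)
      then show ?thesis unfolding w .
    qed
    have "(cmod (exp (- complex_of_real ((norm z)\<^sup>2) / 4)))\<^sup>2 = exp (- (norm z)\<^sup>2 / 2)"
    proof -
      have "- complex_of_real ((norm z)\<^sup>2) / 4 = of_real (- (norm z)\<^sup>2 / 4)" by simp
      then have "cmod (exp (- complex_of_real ((norm z)\<^sup>2) / 4)) = exp (- (norm z)\<^sup>2 / 4)"
        by (simp only: exp_of_real norm_of_real abs_exp_cancel)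
      then show ?thesis by (simp add: power2_eq_square mult_exp_exp)
    qed
    moreover have "(cmod (\<Prod>i\<in>UNIV. ((of_real (z $ Inl i) + \<i> * of_real (z $ Inr i)) / of_real (sqrt 2)) ^ \<alpha> i / of_real (sqrt (fact (\<alpha> i)))))\<^sup>2
      = (\<Prod>i\<in>UNIV. r i ^ \<alpha> i / fact (\<alpha> i))"
      unfolding prod_norm[symmetric] prod_power_distrib r_def by (intro prod.cong refl wk)
    ultimately show ?thesis
      using coherent_hermite[of z \<alpha>] unfolding hcoeff_def L2_inner_def
      by (simp only: has_bochner_integral_iff norm_mult power_mult_distrib)
  qed
  have 2: "(\<Sum>\<alpha>\<in>cube N. (cmod (hcoeff (coherent z) \<alpha>))\<^sup>2) = exp (- (norm z)\<^sup>2 / 2) * (\<Prod>i\<in>UNIV. \<Sum>k\<le>N. r i ^ k / fact k)" for N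
    unfolding 1 sum_distrib_left[symmetric] cube_def by (subst prod_sum_PiE) auto
  have "(\<lambda>N. \<Sum>k\<le>N. r i ^ k / fact k) \<longlonglongrightarrow> exp (r i)" for i
    using exp_converges[of "r i"] by (simp add: sums_def_le divide_inverse mult.commute)
  then have "(\<lambda>N. exp (- (norm z)\<^sup>2 / 2) * (\<Prod>i\<in>UNIV. \<Sum>k\<le>N. r i ^ k / fact k)) \<longlonglongrightarrow> exp (- (norm z)\<^sup>2 / 2) * (\<Prod>i\<in>UNIV. exp (r i))"
    by (intro tendsto_intros)
  also have "exp (- (norm z)\<^sup>2 / 2) * (\<Prod>i\<in>UNIV. exp (r i)) = 1"
    unfolding exp_sum[OF finite, symmetric] nz[symmetric] by (simp add: mult_exp_exp)
  finally show ?thesis unfolding 2 .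
qed

text \<open>Available before completeness is known: \<open>hproj\<close> is self-adjoint, so it can
  be moved onto the coherent state, whose expansion converges in norm by
  \<open>hcoeff_coherent_sum\<close>.\<close>

lemma coherent_hproj_tendsto:
  assumes f: "f \<in> L2"
  shows "(\<lambda>N. L2_inner (hproj N f) (coherent z)) \<longlonglongrightarrow> L2_inner f (coherent z)"
proof -
  let ?d = "\<lambda>N. L2_norm (\<lambda>x. coherent z x - hproj N (coherent z) x)"
  have "(\<lambda>N. (?d N)\<^sup>2) \<longlonglongrightarrow> 1\<^sup>2 - 1"
    unfolding hproj_diff_norm[OF coherent_L2] coherent_norm by (intro tendsto_intros hcoeff_coherent_sum)
  then have "(\<lambda>N. sqrt ((?d N)\<^sup>2)) \<longlonglongrightarrow> sqrt (1\<^sup>2 - 1)" by (rule tendsto_real_sqrt)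
  then have d: "(\<lambda>N. L2_norm f * ?d N) \<longlonglongrightarrow> 0" by (intro tendsto_mult_right_zero) simp
  have "cmod (L2_inner f (coherent z) - L2_inner (hproj N f) (coherent z)) \<le> L2_norm f * ?d N" for N
  proof -
    have "L2_inner (hproj N f) (coherent z) = L2_inner f (hproj N (coherent z))"
      using f by (simp add: hproj_inner_left hproj_inner_right)
    then have "L2_inner f (coherent z) - L2_inner (hproj N f) (coherent z) = L2_inner f (\<lambda>x. coherent z x - hproj N (coherent z) x)"
      using f by (simp add: L2_inner_diff_right)
    then show ?thesis using L2_cauchy_schwarz[OF f, of "\<lambda>x. coherent z x - hproj N (coherent z) x"] by (simp add: L2_diff)
  qed
  then have "(\<lambda>N. L2_inner f (coherent z) - L2_inner (hproj N f) (coherent z)) \<longlonglongrightarrow> 0"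
    by (intro Lim_null_comparison[OF _ d]) auto
  from tendsto_diff[OF tendsto_const[of "L2_inner f (coherent z)"] this] show ?thesis by simp
qed

section \<open>Continuity of translations in $L^2$\<close>

lemma lborel_distr_translate: "distr lborel borel (\<lambda>x::'a::euclidean_space. x - v) = lborel"
proof -
  have "(\<lambda>x. x - v) = (+) (- v)" by auto
  then show ?thesis using lborel_distr_plus[of "-v"] by simp
qed

lemma lborel_integral_translate:
  fixes f :: "'a::euclidean_space \<Rightarrow> 'b::{banach, second_countable_topology}"
  assumes "f \<in> borel_measurable borel"
  shows "(LINT x|lborel. f (x - v)) = (LINT x|lborel. f x)"
  by (subst lborel_distr_translate[of v, symmetric], subst integral_distr) (use assms in auto)

lemma lborel_integrable_translate:
  fixes f :: "'a::euclidean_space \<Rightarrow> 'b::{banach, second_countable_topology}"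
  assumes "integrable lborel f"
  shows "integrable lborel (\<lambda>x. f (x - v))"
proof -
  have [measurable]: "f \<in> borel_measurable borel" using assms by auto
  have "integrable (distr lborel borel (\<lambda>x. x - v)) f" using assms by (simp add: lborel_distr_translate)
  then show ?thesis by (subst (asm) integrable_distr_eq) auto
qed

text \<open>The factor \<open>c\<close> may be negative; \<open>c = -1\<close> provides the
  substitutions that exchange a point and a shift.\<close>

lemma lborel_integral_scale:
  fixes f :: "'a::euclidean_space \<Rightarrow> 'b::{banach, second_countable_topology}"
  assumes "f \<in> borel_measurable borel" "c \<noteq> 0"
  shows "(LINT x|lborel. f x) = \<bar>c\<bar> ^ DIM('a) *\<^sub>R (LINT x|lborel. f (t + c *\<^sub>R x))"
proof -
  have [measurable]: "f \<in> borel_measurable borel" by fact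
  have "(LINT x|lborel. f x) = (LINT x|density (distr lborel borel (\<lambda>x. t + c *\<^sub>R x)) (\<lambda>_. \<bar>c\<bar>^DIM('a)). f x)"
    by (subst lborel_affine[OF assms(2), of t]) (simp add: ennreal_power)
  also have "\<dots> = (LINT x|distr lborel borel (\<lambda>x. t + c *\<^sub>R x). \<bar>c\<bar>^DIM('a) *\<^sub>R f x)"
    by (subst integral_density) auto
  also have "\<dots> = \<bar>c\<bar> ^ DIM('a) *\<^sub>R (LINT x|lborel. f (t + c *\<^sub>R x))"
    by (subst integral_distr) auto
  finally show ?thesis .
qed

lemma lborel_integrable_scale:
  fixes f :: "'a::euclidean_space \<Rightarrow> 'b::{banach, second_countable_topology}"
  assumes "integrable lborel f" "c \<noteq> 0"
  shows "integrable lborel (\<lambda>x. f (t + c *\<^sub>R x))"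
proof -
  have [measurable]: "f \<in> borel_measurable borel" using assms by auto
  have "integrable (density (distr lborel borel (\<lambda>x. t + c *\<^sub>R x)) (\<lambda>_. ennreal (\<bar>c\<bar>^DIM('a)))) f"
    using assms(1) lborel_affine[OF assms(2), of t] by (simp add: ennreal_power)
  then have "integrable (distr lborel borel (\<lambda>x. t + c *\<^sub>R x)) (\<lambda>x. \<bar>c\<bar>^DIM('a) *\<^sub>R f x)"
    by (subst (asm) integrable_density) auto
  from integrable_scaleR_right[OF this, of "inverse (\<bar>c\<bar>^DIM('a))"]
  have "integrable (distr lborel borel (\<lambda>x. t + c *\<^sub>R x)) f" using assms(2) by simp
  then show ?thesis by (subst (asm) integrable_distr_eq) auto
qed

text \<open>A point of an open set stays in it under small shifts, so the overlap of
  \<open>U\<close> with its translates converges by dominated convergence. Since indicators take the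
  values 0 and 1, the L1 distance is the sum of the two measures minus twice the overlap.\<close>

lemma L1_translation_continuous_open:
  fixes U :: "'a::euclidean_space set" and X :: "nat \<Rightarrow> 'a"
  assumes U: "open U" "emeasure lborel U < \<infinity>" and X: "X \<longlonglongrightarrow> 0"
  shows "(\<lambda>k. LINT x|lborel. norm (indicat_real U (x - X k) - indicat_real U x)) \<longlonglongrightarrow> 0"
proof -
  have [measurable]: "U \<in> sets borel" using U by simp
  have iU: "integrable lborel (indicat_real U)" using U by simp
  have iUt: "integrable lborel (\<lambda>x. indicat_real U (x - v))" for v by (rule lborel_integrable_translate[OF iU])
  have im: "integrable lborel (\<lambda>x. indicat_real U x * indicat_real U (x - v))" for v
    by (rule Bochner_Integration.integrable_bound[OF iU]) (auto simp: indicator_def)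
  have eq: "norm (indicat_real U (x - v) - indicat_real U x)
     = indicat_real U (x - v) + indicat_real U x - 2 * (indicat_real U x * indicat_real U (x - v))" for x v
    by (auto simp: indicator_def)
  have "(\<lambda>k. LINT x|lborel. indicat_real U x * indicat_real U (x - X k)) \<longlonglongrightarrow> (LINT x|lborel. indicat_real U x)"
  proof (rule integral_dominated_convergence[where w="indicat_real U"])
    show "AE x in lborel. (\<lambda>k. indicat_real U x * indicat_real U (x - X k)) \<longlonglongrightarrow> indicat_real U x"
    proof (rule AE_I2)
      fix x
      show "(\<lambda>k. indicat_real U x * indicat_real U (x - X k)) \<longlonglongrightarrow> indicat_real U x"
      proof (cases "x \<in> U")
        case True
        have "(\<lambda>k. x - X k) \<longlonglongrightarrow> x - 0" by (intro tendsto_intros X)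
        then have "eventually (\<lambda>k. x - X k \<in> U) sequentially"
          using topological_tendstoD[OF _ U(1)] True by simp
        then have "eventually (\<lambda>k. indicat_real U x * indicat_real U (x - X k) = indicat_real U x) sequentially"
          by eventually_elim simp
        then show ?thesis by (rule tendsto_eventually)
      qed simp
    qed
  qed (use iU in \<open>auto simp: indicator_def\<close>)
  then have "(\<lambda>k. (LINT x|lborel. indicat_real U x) + (LINT x|lborel. indicat_real U x) - 2 * (LINT x|lborel. indicat_real U x * indicat_real U (x - X k)))
      \<longlonglongrightarrow> (LINT x|lborel. indicat_real U x) + (LINT x|lborel. indicat_real U x) - 2 * (LINT x|lborel. indicat_real U x)"
    by (intro tendsto_intros)
  moreover have "(LINT x|lborel. norm (indicat_real U (x - v) - indicat_real U x)) =
     (LINT x|lborel. indicat_real U x) + (LINT x|lborel. indicat_real U x) - 2 * (LINT x|lborel. indicat_real U x * indicat_real U (x - v))" for v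
    unfolding eq using iU iUt im lborel_integral_translate[of "indicat_real U" v]
    by (simp add: Bochner_Integration.integral_add Bochner_Integration.integral_diff)
  ultimately show ?thesis by simp
qed

lemma L1_translation_dist_le:
  fixes f g :: "'a::euclidean_space \<Rightarrow> complex"
  assumes f: "integrable lborel f" and g: "integrable lborel g"
  shows "(LINT x|lborel. norm (f (x - v) - f x)) \<le> (LINT x|lborel. norm (g (x - v) - g x)) + 2 * (LINT x|lborel. norm (f x - g x))"
proof -
  have [measurable]: "f \<in> borel_measurable borel" "g \<in> borel_measurable borel" using f g by auto
  note ft = lborel_integrable_translate[OF f, of v] and gt = lborel_integrable_translate[OF g, of v]
  have "(LINT x|lborel. norm (f (x - v) - f x)) \<le> (LINT x|lborel. norm (g (x - v) - g x) + norm (f (x - v) - g (x - v)) + norm (f x - g x))"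
  proof (rule integral_mono)
    show "norm (f (x - v) - f x) \<le> norm (g (x - v) - g x) + norm (f (x - v) - g (x - v)) + norm (f x - g x)" for x
    proof -
      have "f (x - v) - f x = (g (x - v) - g x) + (f (x - v) - g (x - v)) - (f x - g x)" by simp
      then show ?thesis by (metis norm_triangle_ineq norm_triangle_ineq4 add_right_mono order_trans)
    qed
  qed (use f g ft gt in auto)
  also have "\<dots> = (LINT x|lborel. norm (g (x - v) - g x)) + (LINT x|lborel. norm (f (x - v) - g (x - v))) + (LINT x|lborel. norm (f x - g x))"
    using f g ft gt by (simp add: Bochner_Integration.integral_add)
  also have "(LINT x|lborel. norm (f (x - v) - g (x - v))) = (LINT x|lborel. norm (f x - g x))"
    by (rule lborel_integral_translate[of "\<lambda>x. norm (f x - g x)"]) measurable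
  finally show ?thesis by simp
qed

text \<open>Stability under L1 approximation, isolated because the induction that follows uses it
  twice: for passing from open to measurable sets, and for limits of approximating
  functions.\<close>

lemma L1_translation_continuous_approx:
  fixes f :: "'a::euclidean_space \<Rightarrow> complex"
  assumes f: "integrable lborel f"
    and g: "\<And>e. e > 0 \<Longrightarrow> \<exists>g. integrable lborel g \<and> (LINT x|lborel. norm (f x - g x)) < e \<and>
         (\<lambda>k. LINT x|lborel. norm (g (x - X k) - g x)) \<longlonglongrightarrow> 0"
  shows "(\<lambda>k. LINT x|lborel. norm (f (x - X k) - f x)) \<longlonglongrightarrow> 0"
proof (rule LIMSEQ_I)
  fix r :: real assume r: "r > 0"
  obtain g where g: "integrable lborel g" "(LINT x|lborel. norm (f x - g x)) < r / 4"
    "(\<lambda>k. LINT x|lborel. norm (g (x - X k) - g x)) \<longlonglongrightarrow> 0" using g[of "r/4"] r by auto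
  obtain N where N: "\<And>k. k \<ge> N \<Longrightarrow> norm ((LINT x|lborel. norm (g (x - X k) - g x)) - 0) < r / 2"
    using LIMSEQ_D[OF g(3), of "r/2"] r by auto
  have "norm ((LINT x|lborel. norm (f (x - X k) - f x)) - 0) < r" if "k \<ge> N" for k
    using L1_translation_dist_le[OF f g(1), of "X k"] N[OF that] g(2) by (simp add: integral_nonneg_AE)
  then show "\<exists>N. \<forall>k\<ge>N. norm ((LINT x|lborel. norm (f (x - X k) - f x)) - 0) < r" by blast
qed

text \<open>Induction over integrable functions. In the base case outer regularity replaces the
  measurable set by an open superset of small excess measure.\<close>

lemma L1_translation_continuous:
  fixes f :: "'a::euclidean_space \<Rightarrow> complex" and X :: "nat \<Rightarrow> 'a"
  assumes f: "integrable lborel f" and X: "X \<longlonglongrightarrow> 0"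
  shows "(\<lambda>k. LINT x|lborel. norm (f (x - X k) - f x)) \<longlonglongrightarrow> 0"
  using f
proof (induction f rule: integrable_induct)
  case (base A c)
  then have [measurable]: "A \<in> sets borel" by simp
  have iA: "integrable lborel (\<lambda>x. indicat_real A x *\<^sub>R c)" using base by simp
  show ?case
  proof (rule L1_translation_continuous_approx[OF iA])
    fix e :: real assume e: "e > 0"
    \<comment> \<open>The summand 1 keeps the quotient meaningful when \<open>c\<close> is
      0.\<close>
    define d where "d = e / (norm c + 1)"
    have d: "d > 0" using e by (simp add: d_def add_nonneg_pos)
    obtain U where U: "open U" "A \<subseteq> U" "emeasure lborel (U - A) < d"
      using outer_regular_lborel[of A d] d by auto
    have [measurable]: "U \<in> sets borel" using U by simp
    have "emeasure lborel U = emeasure lborel A + emeasure lborel (U - A)"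
      using U by (subst plus_emeasure) (auto simp: Un_absorb1)
    then have fU: "emeasure lborel U < \<infinity>" using base U(3) by (simp add: less_top[symmetric]) (metis ennreal_add_eq_top ennreal_less_top less_trans top.not_eq_extremum)
    let ?g = "\<lambda>x. indicat_real U x *\<^sub>R c"
    have "(LINT x|lborel. norm (indicat_real A x *\<^sub>R c - ?g x)) = (LINT x|lborel. norm c * indicat_real (U - A) x)"
      using U(2) by (intro Bochner_Integration.integral_cong) (auto simp: indicator_def)
    also have "\<dots> = norm c * measure lborel (U - A)" by simp
    also have "\<dots> < e"
    proof -
      have "measure lborel (U - A) < d" using U(3) d
        by (simp add: measure_def enn2real_less_iff) (metis enn2real_ennreal enn2real_less_iff ennreal_less_top less_imp_le less_trans)
      then have "norm c * measure lborel (U - A) \<le> norm c * d" by (intro mult_left_mono) auto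
      also have "\<dots> < e"
      proof -
        have "norm c * d < (norm c + 1) * d" using d by simp
        also have "\<dots> = e" by (simp add: d_def add_nonneg_eq_0_iff)
        finally show ?thesis .
      qed
      finally show ?thesis .
    qed
    finally have 1: "(LINT x|lborel. norm (indicat_real A x *\<^sub>R c - ?g x)) < e" .
    have "(\<lambda>k. (LINT x|lborel. norm (indicat_real U (x - X k) - indicat_real U x)) * norm c) \<longlonglongrightarrow> 0"
      using L1_translation_continuous_open[OF U(1) fU X] tendsto_mult_left_zero by blast
    then have 2: "(\<lambda>k. LINT x|lborel. norm (?g (x - X k) - ?g x)) \<longlonglongrightarrow> 0"
      by (simp add: scaleR_diff_left[symmetric])
    show "\<exists>g. integrable lborel g \<and> (LINT x|lborel. norm (indicat_real A x *\<^sub>R c - g x)) < e \<and>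
         (\<lambda>k. LINT x|lborel. norm (g (x - X k) - g x)) \<longlonglongrightarrow> 0"
      using 1 2 fU by (intro exI[of _ ?g]) auto
  qed
next
  case (add f g)
  have fg: "(\<lambda>k. (LINT x|lborel. norm (f (x - X k) - f x)) + (LINT x|lborel. norm (g (x - X k) - g x))) \<longlonglongrightarrow> 0"
    using tendsto_add[OF add(3,4)] by simp
  show ?case
  proof (rule Lim_null_comparison[OF always_eventually fg], rule allI)
    fix k
    note t = lborel_integrable_translate[OF add(1), of "X k"] lborel_integrable_translate[OF add(2), of "X k"]
    have "(LINT x|lborel. norm (f (x - X k) + g (x - X k) - (f x + g x))) \<le> (LINT x|lborel. norm (f (x - X k) - f x) + norm (g (x - X k) - g x))"
    proof (rule integral_mono)
      show "norm (f (x - X k) + g (x - X k) - (f x + g x)) \<le> norm (f (x - X k) - f x) + norm (g (x - X k) - g x)" for x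
        by (metis add_diff_add norm_triangle_ineq)
    qed (use add t in auto)
    also have "\<dots> = (LINT x|lborel. norm (f (x - X k) - f x)) + (LINT x|lborel. norm (g (x - X k) - g x))"
      using add t by (simp add: Bochner_Integration.integral_add)
    finally show "norm (LINT x|lborel. norm (f (x - X k) + g (x - X k) - (f x + g x))) \<le> (LINT x|lborel. norm (f (x - X k) - f x)) + (LINT x|lborel. norm (g (x - X k) - g x))"
      by (simp add: integral_nonneg_AE)
  qed
next
  case (lim f s)
  have [measurable]: "\<And>i. s i \<in> borel_measurable lborel" "f \<in> borel_measurable lborel" using lim by auto
  \<comment> \<open>The approximants obey norm (s i x) <= 2 * norm (f x), whence the factor 3 in the
    dominating function.\<close>
  have c: "(\<lambda>i. LINT x|lborel. norm (f x - s i x)) \<longlonglongrightarrow> (LINT x|(lborel::'a measure). (0::real))"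
  proof (rule integral_dominated_convergence[where w="\<lambda>x. 3 * norm (f x)"])
    show "AE x in lborel. (\<lambda>i. norm (f x - s i x)) \<longlonglongrightarrow> 0"
    proof (rule AE_I2)
      fix x :: 'a
      have "(\<lambda>i. norm (f x - s i x)) \<longlonglongrightarrow> norm (f x - f x)" using lim(2)[of x] by (intro tendsto_intros) simp
      then show "(\<lambda>i. norm (f x - s i x)) \<longlonglongrightarrow> 0" by simp
    qed
    show "AE x in lborel. norm (norm (f x - s i x)) \<le> 3 * norm (f x)" for i
    proof (rule AE_I2)
      fix x :: 'a
      have "norm (f x - s i x) \<le> norm (f x) + norm (s i x)" by (rule norm_triangle_ineq4)
      then show "norm (norm (f x - s i x)) \<le> 3 * norm (f x)" using lim(3)[of x i] by simp
    qed
  qed (use lim in auto)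
  show ?case
  proof (rule L1_translation_continuous_approx[OF lim(4)])
    fix e :: real assume "e > 0"
    then obtain i where "(LINT x|lborel. norm (f x - s i x)) < e"
      using LIMSEQ_D[OF c, of e] by (auto simp: integral_nonneg_AE)
    then show "\<exists>g. integrable lborel g \<and> (LINT x|lborel. norm (f x - g x)) < e \<and> (\<lambda>k. LINT x|lborel. norm (g (x - X k) - g x)) \<longlonglongrightarrow> 0"
      using lim by blast
  qed
qed

lemma L2_translate:
  assumes "f \<in> L2"
  shows "(\<lambda>x. f (x - v)) \<in> L2" and "L2_norm (\<lambda>x. f (x - v)) = L2_norm f"
proof -
  note [measurable] = L2_measurable[OF assms]
  show "(\<lambda>x. f (x - v)) \<in> L2"
    using lborel_integrable_translate[OF L2_square_integrable[OF assms], of v] by (intro L2I) auto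
  show "L2_norm (\<lambda>x. f (x - v)) = L2_norm f"
    unfolding L2_norm_def using lborel_integral_translate[of "\<lambda>x. (cmod (f x))\<^sup>2" v] by simp
qed

lemma L2_triangle:
  assumes "f \<in> L2" "g \<in> L2"
  shows "L2_norm (\<lambda>x. f x + g x) \<le> L2_norm f + L2_norm g"
proof -
  have "(L2_norm (\<lambda>x. f x - (-1) * g x))\<^sup>2 = (L2_norm f)\<^sup>2 - 2 * Re (L2_inner f (\<lambda>x. (-1) * g x)) + (L2_norm (\<lambda>x. (-1) * g x))\<^sup>2"
    by (rule L2_norm_diff_power2) (use assms L2_cmult[OF assms(2), of "-1"] in auto)
  also have "\<dots> = (L2_norm f)\<^sup>2 + 2 * Re (L2_inner f g) + (L2_norm g)\<^sup>2"
    unfolding L2_inner_cmult_right L2_norm_cmult by simp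
  also have "\<dots> \<le> (L2_norm f)\<^sup>2 + 2 * (L2_norm f * L2_norm g) + (L2_norm g)\<^sup>2"
    using L2_cauchy_schwarz[OF assms] complex_Re_le_cmod[of "L2_inner f g"] by linarith
  also have "\<dots> = (L2_norm f + L2_norm g)\<^sup>2" by (simp add: power2_eq_square algebra_simps)
  finally show ?thesis by (intro power2_le_imp_le[of "L2_norm (\<lambda>x. f x + g x)"]) auto
qed

text \<open>Truncation in both argument and value puts \<open>g j\<close> into L1 as well as L2. As
  its values are at most \<open>j\<close>, the squared L2 distance to a translate is at most 2j
  times the L1 distance, and the L1 result applies.\<close>

lemma L2_translation_continuous:
  fixes X :: "nat \<Rightarrow> real^'n::finite"
  assumes f: "f \<in> L2" and X: "X \<longlonglongrightarrow> 0"
  shows "(\<lambda>k. L2_norm (\<lambda>x. f (x - X k) - f x)) \<longlonglongrightarrow> 0"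
proof -
  note [measurable] = L2_measurable[OF f]
  define g where "g j x = (if norm x \<le> real j \<and> cmod (f x) \<le> real j then f x else 0)" for j x
  have gm [measurable]: "g j \<in> borel_measurable borel" for j unfolding g_def[abs_def] by measurable
  have gle: "cmod (g j x) \<le> cmod (f x)" "cmod (g j x) \<le> real j" for j x by (auto simp: g_def)
  have gL2: "g j \<in> L2" for j
    by (rule L2I, simp, rule Bochner_Integration.integrable_bound[OF L2_square_integrable[OF f]])
      (auto intro!: power_mono gle)
  have gL1: "integrable lborel (g j)" for j
  proof (rule Bochner_Integration.integrable_bound)
    show "integrable lborel (\<lambda>x::real^'n. real j * indicat_real (cball 0 (real j)) x)"
      using emeasure_lborel_cball_finite[of "0::real^'n" "real j"] by simp
    show "AE x in lborel. norm (g j x) \<le> norm (real j * indicat_real (cball 0 (real j)) x)"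
      by (auto simp: g_def indicator_def)
  qed simp
  have gT: "(\<lambda>k. L2_norm (\<lambda>x. g j (x - X k) - g j x)) \<longlonglongrightarrow> 0" for j
  proof -
    have "(\<lambda>k. 2 * real j * (LINT x|lborel. norm (g j (x - X k) - g j x))) \<longlonglongrightarrow> 2 * real j * 0"
      by (intro tendsto_intros L1_translation_continuous[OF gL1 X])
    then have c: "(\<lambda>k. 2 * real j * (LINT x|lborel. norm (g j (x - X k) - g j x))) \<longlonglongrightarrow> 0" by simp
    have "(\<lambda>k. (L2_norm (\<lambda>x. g j (x - X k) - g j x))\<^sup>2) \<longlonglongrightarrow> 0"
    proof (rule Lim_null_comparison[OF always_eventually c], rule allI)
      fix k
      have "(LINT x|lborel. (cmod (g j (x - X k) - g j x))\<^sup>2) \<le> (LINT x|lborel. 2 * real j * norm (g j (x - X k) - g j x))"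
      proof (rule integral_mono)
        show "integrable lborel (\<lambda>x. (cmod (g j (x - X k) - g j x))\<^sup>2)"
          by (intro L2_square_integrable L2_diff L2_translate gL2)
        show "integrable lborel (\<lambda>x. 2 * real j * norm (g j (x - X k) - g j x))"
          using gL1[of j] lborel_integrable_translate[OF gL1[of j], of "X k"] by auto
        show "(cmod (g j (x - X k) - g j x))\<^sup>2 \<le> 2 * real j * norm (g j (x - X k) - g j x)" for x
        proof -
          have "cmod (g j (x - X k) - g j x) \<le> 2 * real j"
            using norm_triangle_ineq4[of "g j (x - X k)" "g j x"] gle(2)[of j x] gle(2)[of j "x - X k"] by simp
          then show ?thesis unfolding power2_eq_square by (intro mult_right_mono) auto
        qed
      qed
      then show "norm ((L2_norm (\<lambda>x. g j (x - X k) - g j x))\<^sup>2) \<le> 2 * real j * (LINT x|lborel. norm (g j (x - X k) - g j x))"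
        by (simp add: L2_norm_power2)
    qed
    from tendsto_real_sqrt[OF this] show ?thesis by simp
  qed
  have gc: "(\<lambda>j. L2_norm (\<lambda>x. f x - g j x)) \<longlonglongrightarrow> 0"
  proof -
    have "(\<lambda>j. LINT x|lborel. (cmod (f x - g j x))\<^sup>2) \<longlonglongrightarrow> (LINT x|(lborel :: (real^'n) measure). (0::real))"
    proof (rule integral_dominated_convergence[where w="\<lambda>x. (cmod (f x))\<^sup>2"])
      show "integrable lborel (\<lambda>x. (cmod (f x))\<^sup>2)" by (rule L2_square_integrable[OF f])
      show "AE x in lborel. (\<lambda>j. (cmod (f x - g j x))\<^sup>2) \<longlonglongrightarrow> 0"
      proof (rule AE_I2)
        fix x
        have "eventually (\<lambda>j. real j \<ge> max (norm x) (cmod (f x))) sequentially"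
          by (rule filterlim_real_sequentially[unfolded filterlim_at_top, rule_format])
        then have "eventually (\<lambda>j. (cmod (f x - g j x))\<^sup>2 = 0) sequentially"
          by eventually_elim (simp add: g_def)
        then show "(\<lambda>j. (cmod (f x - g j x))\<^sup>2) \<longlonglongrightarrow> 0" by (rule tendsto_eventually)
      qed
      show "AE x in lborel. norm ((cmod (f x - g j x))\<^sup>2) \<le> (cmod (f x))\<^sup>2" for j
        by (auto simp: g_def)
    qed measurable
    then have "(\<lambda>j. (L2_norm (\<lambda>x. f x - g j x))\<^sup>2) \<longlonglongrightarrow> 0" by (simp add: L2_norm_power2)
    from tendsto_real_sqrt[OF this] show ?thesis by simp
  qed
  show ?thesis
  proof (rule LIMSEQ_I)
    fix r :: real assume r: "r > 0"
    obtain j where j: "L2_norm (\<lambda>x. f x - g j x) < r / 4" using LIMSEQ_D[OF gc, of "r/4"] r by auto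
    obtain N where N: "\<And>k. k \<ge> N \<Longrightarrow> L2_norm (\<lambda>x. g j (x - X k) - g j x) < r / 2"
      using LIMSEQ_D[OF gT[of j], of "r/2"] r by auto
    have "norm (L2_norm (\<lambda>x. f (x - X k) - f x) - 0) < r" if k: "k \<ge> N" for k
    proof -
      let ?a = "\<lambda>x. (f (x - X k) - g j (x - X k))" and ?b = "\<lambda>x. g j (x - X k) - g j x" and ?c = "\<lambda>x. (-1) * (f x - g j x)"
      have L: "?a \<in> L2" "?b \<in> L2" "?c \<in> L2"
        by (intro L2_diff L2_cmult L2_translate f gL2)+
      have "L2_norm (\<lambda>x. f (x - X k) - f x) = L2_norm (\<lambda>x. (?a x + ?b x) + ?c x)"
        by (rule arg_cong[where f=L2_norm]) auto
      also have "\<dots> \<le> (L2_norm ?a + L2_norm ?b) + L2_norm ?c"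
        by (rule order_trans[OF L2_triangle[OF L2_add[OF L(1,2)] L(3)] add_right_mono[OF L2_triangle[OF L(1,2)]]])
      also have "L2_norm ?a = L2_norm (\<lambda>x. f x - g j x)" by (rule L2_translate(2)[OF L2_diff[OF f gL2]])
      also have "L2_norm ?c = L2_norm (\<lambda>x. f x - g j x)" by (subst L2_norm_cmult) simp
      finally show ?thesis using j N[OF k] by simp
    qed
    then show "\<exists>N. \<forall>k\<ge>N. norm (L2_norm (\<lambda>x. f (x - X k) - f x) - 0) < r" by blast
  qed
qed

lemma L2_autocorrelation_tendsto:
  fixes X :: "nat \<Rightarrow> real^'n::finite"
  assumes f: "f \<in> L2" and g: "g \<in> L2" and X: "X \<longlonglongrightarrow> 0"
  shows "(\<lambda>k. L2_inner f (\<lambda>x. g (x - X k))) \<longlonglongrightarrow> L2_inner f g"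
proof -
  have c: "(\<lambda>k. L2_norm f * L2_norm (\<lambda>x. g (x - X k) - g x)) \<longlonglongrightarrow> 0"
    by (rule tendsto_mult_right_zero[OF L2_translation_continuous[OF g X]])
  have "(\<lambda>k. L2_inner f (\<lambda>x. g (x - X k)) - L2_inner f g) \<longlonglongrightarrow> 0"
  proof (rule Lim_null_comparison[OF always_eventually c], rule allI)
    fix k
    show "norm (L2_inner f (\<lambda>x. g (x - X k)) - L2_inner f g) \<le> L2_norm f * L2_norm (\<lambda>x. g (x - X k) - g x)"
      using L2_cauchy_schwarz[OF f L2_diff[OF L2_translate(1)[OF g, of "X k"] g]] f g
      by (simp add: L2_inner_diff_right L2_translate)
  qed
  from tendsto_add[OF this tendsto_const[of "L2_inner f g"]] show ?thesis by simp
qed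

section \<open>Completeness of the Hermite functions\<close>

lemma L2_abs: "f \<in> L2 \<Longrightarrow> (\<lambda>x. of_real (cmod (f x))) \<in> L2"
  by (auto simp: L2_def)

lemma L2_inner_abs_bound:
  assumes "f \<in> L2" "g \<in> L2"
  shows "integrable lborel (\<lambda>x. cmod (f x * cnj (g x)))" "(LINT x|lborel. cmod (f x * cnj (g x))) \<le> L2_norm f * L2_norm g"
proof -
  show "integrable lborel (\<lambda>x. cmod (f x * cnj (g x)))"
    using L2_inner_integrable[OF assms] by (rule integrable_norm)
  have "L2_inner (\<lambda>x. of_real (cmod (f x))) (\<lambda>x. of_real (cmod (g x))) = of_real (LINT x|lborel. cmod (f x * cnj (g x)))"
    unfolding L2_inner_def integral_complex_of_real[symmetric] by (simp add: norm_mult)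
  moreover have "L2_norm (\<lambda>x. of_real (cmod (f x))) = L2_norm f" "L2_norm (\<lambda>x. of_real (cmod (g x))) = L2_norm g"
    by (simp_all add: L2_norm_def)
  ultimately show "(LINT x|lborel. cmod (f x * cnj (g x))) \<le> L2_norm f * L2_norm g"
    using L2_cauchy_schwarz[OF L2_abs[OF assms(1)] L2_abs[OF assms(2)]] by simp
qed

text \<open>Cauchy-Schwarz bounds the integral over \<open>s\<close> uniformly in the shift
  \<open>v\<close>, since translation preserves the L2 norm. Joint integrability thus rests on the
  weight \<open>k\<close> in \<open>v\<close> alone. This justifies the exchanges of integrals for
  \<open>gform\<close> and for the Wigner distribution.\<close>

lemma correlation_integrable:
  fixes f g :: "('n::finite) fn"
  assumes f: "f \<in> L2" and g: "g \<in> L2" and k: "integrable lborel k"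
    and m: "m \<in> borel_measurable (borel \<Otimes>\<^sub>M borel)" "\<And>v s. cmod (m (v, s)) \<le> k v"
  shows "integrable (lborel \<Otimes>\<^sub>M lborel) (\<lambda>(v, s). m (v, s) * (f s * cnj (g (s - v))))"
proof -
  note [measurable] = f[THEN L2_measurable] g[THEN L2_measurable] m(1)
  have [measurable]: "k \<in> borel_measurable borel" using k by auto
  have k0: "k v \<ge> 0" for v using order_trans[OF norm_ge_zero m(2)] .
  let ?F = "\<lambda>(v, s). m (v, s) * (f s * cnj (g (s - v)))"
  have meas: "?F \<in> borel_measurable (lborel \<Otimes>\<^sub>M lborel)" by measurable
  note gt = L2_translate[OF g]
  show ?thesis
  proof (rule lborel_pair.Fubini_integrable[OF meas])
    have b: "cmod (?F (v, s)) \<le> k v * cmod (f s * cnj (g (s - v)))" for v s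
      by (simp add: norm_mult[of "m (v, s)"] mult_right_mono m(2))
    have i: "integrable lborel (\<lambda>s. ?F (v, s))" for v
    proof (rule Bochner_Integration.integrable_bound)
      show "integrable lborel (\<lambda>s. k v * cmod (f s * cnj (g (s - v))))"
        using L2_inner_abs_bound(1)[OF f gt(1)] by (rule integrable_mult_right)
      show "AE s in lborel. norm (?F (v, s)) \<le> norm (k v * cmod (f s * cnj (g (s - v))))"
        using b k0 by (auto simp: abs_mult)
      show "(\<lambda>s. ?F (v, s)) \<in> borel_measurable lborel"
        by (rule measurable_compose[OF measurable_Pair1' meas]) simp
    qed
    show "AE v in lborel. integrable lborel (\<lambda>s. ?F (v, s))" using i by simp
    show "integrable lborel (\<lambda>v. LINT s|lborel. norm (?F (v, s)))"
    proof (rule Bochner_Integration.integrable_bound)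
      show "integrable lborel (\<lambda>v. k v * (L2_norm f * L2_norm g))" using k by simp
      show "(\<lambda>v. LINT s|lborel. norm (?F (v, s))) \<in> borel_measurable lborel" by measurable
      show "AE v in lborel. norm (LINT s|lborel. norm (?F (v, s))) \<le> norm (k v * (L2_norm f * L2_norm g))"
      proof (rule AE_I2)
        fix v
        have "(LINT s|lborel. norm (?F (v, s))) \<le> (LINT s|lborel. k v * cmod (f s * cnj (g (s - v))))"
          by (rule integral_mono[OF integrable_norm[OF i] integrable_mult_right[OF L2_inner_abs_bound(1)[OF f gt(1)]] b])
        also have "\<dots> \<le> k v * (L2_norm f * L2_norm g)"
          using L2_inner_abs_bound(2)[OF f gt(1)[of v]] k0[of v] gt(2)[of v] by (simp add: mult_left_mono)
        finally show "norm (LINT s|lborel. norm (?F (v, s))) \<le> norm (k v * (L2_norm f * L2_norm g))"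
          using k0[of v] by (simp add: integral_nonneg_AE abs_mult)
      qed
    qed
  qed
qed

section \<open>A regularised coherent state resolution of the identity\<close>

lemma gauss_integral_vec:
  fixes A :: real
  assumes A: "A > 0"
  shows "has_bochner_integral lborel (\<lambda>x::real^'n::finite. exp (- A * (norm x)\<^sup>2)) ((pi / A) powr (real CARD('n) / 2))"
proof -
  have "has_bochner_integral lborel (\<lambda>x::real^'n. (\<Prod>i\<in>UNIV. exp (- of_real A * (of_real (x $ i))\<^sup>2 + 0 * of_real (x $ i))))
     (\<Prod>i\<in>(UNIV::'n set). LINT y|lborel. exp (- of_real A * (of_real y)\<^sup>2 + 0 * of_real y) :: complex)"
    by (rule lborel_integral_prod_vec) (use gauss_integral[OF A, of 0] in \<open>simp only: has_bochner_integral_iff\<close>)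
  moreover have "(\<Prod>i\<in>(UNIV::'n set). LINT y|lborel. exp (- of_real A * (of_real y)\<^sup>2 + 0 * of_real y) :: complex) = of_real ((pi / A) powr (real CARD('n) / 2))"
  proof -
    have "(LINT y|lborel. exp (- of_real A * (of_real y)\<^sup>2 + 0 * of_real y)) = complex_of_real (sqrt (pi / A))"
      using gauss_integral[OF A, of 0] by (simp only: has_bochner_integral_iff) simp
    moreover have "sqrt (pi / A) ^ CARD('n) = (pi / A) powr (real CARD('n) / 2)"
      using A by (simp add: sqrt_power_eq_powr)
    ultimately show ?thesis by (simp only: prod_constant of_real_power[symmetric])
  qed
  moreover have "(\<Prod>i\<in>UNIV. exp (- of_real A * (of_real (x $ i))\<^sup>2 + 0 * of_real (x $ i))) = complex_of_real (exp (- A * (norm x)\<^sup>2))" for x :: "real^'n"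
    unfolding norm_power2_vec exp_of_real[symmetric] by (simp add: sum_distrib_left exp_sum sum_negf[symmetric])
  ultimately have "has_bochner_integral lborel (\<lambda>x::real^'n. complex_of_real (exp (- A * (norm x)\<^sup>2))) (of_real ((pi / A) powr (real CARD('n) / 2)))"
    by simp
  from has_bochner_integral_Re[OF this] show ?thesis by simp
qed

text \<open>A regularised resolution of the identity: the Gaussian weight makes the phase space
  integral absolutely convergent, and as \<open>e\<close> tends to \<open>0\<close> it tends to a multiple of the inner product.\<close>

definition gform :: "real \<Rightarrow> ('n::finite) fn \<Rightarrow> 'n fn \<Rightarrow> complex" where
  "gform e f g = (LINT z|lborel. L2_inner f (coherent z) * cnj (L2_inner g (coherent z)) * of_real (exp (- e * (norm (im_part z))\<^sup>2)))"

lemma im_part_measurable [measurable]: "im_part \<in> borel_measurable borel"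
  unfolding im_part_def[abs_def] by (intro borel_measurable_continuous_onI continuous_intros)

lemma re_part_measurable [measurable]: "re_part \<in> borel_measurable borel"
  unfolding re_part_def[abs_def] by (intro borel_measurable_continuous_onI continuous_intros)

text \<open>Both inner products are expanded and \<open>z\<close> is integrated first. By
  \<open>coherent_kernel\<close> the coherent states collapse to a Gaussian in the difference of the
  two points, so an average of correlations of \<open>f\<close> with translates of \<open>g\<close>
  remains.\<close>

lemma gform_correlation:
  fixes f g :: "('n::finite) fn"
  assumes f: "f \<in> L2" and g: "g \<in> L2" and e: "e > 0"
  shows "integrable lborel (\<lambda>z. L2_inner f (coherent z) * cnj (L2_inner g (coherent z)) * of_real (exp (- e * (norm (im_part z))\<^sup>2)))"
    and "gform e f g = (LINT v|lborel. of_real ((pi / e) powr (real CARD('n) / 2) * exp (- (1/4 + 1/(4*e)) * (norm v)\<^sup>2)) * L2_inner f (\<lambda>x. g (x - v)))"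
proof -
  note [measurable] = f[THEN L2_measurable] g[THEN L2_measurable]
  define \<kappa> where "\<kappa> = (pi / e) powr (real CARD('n) / 2)"
  have \<kappa>: "\<kappa> \<ge> 0" by (simp add: \<kappa>_def)
  define w where "w z = exp (- e * (norm (im_part z))\<^sup>2)" for z :: "real^('n+'n)"
  have w [measurable]: "w \<in> borel_measurable borel" unfolding w_def[abs_def] by measurable
  have w0: "w z > 0" for z by (simp add: w_def)
  define k where "k z s s' = cnj (coherent z s) * coherent z s' * of_real (w z)" for z and s s' :: "real^'n"
  have [measurable]: "(\<lambda>(z, s). coherent z s) \<in> borel_measurable (borel \<Otimes>\<^sub>M (borel :: (real^'n) measure))" by (rule coherent_measurable2)
  have km [measurable]: "(\<lambda>x. k (p x) (q x) (r x)) \<in> borel_measurable M" if [measurable]: "p \<in> borel_measurable M" "q \<in> borel_measurable M" "r \<in> borel_measurable M" for M p q r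
  proof -
    have c: "(\<lambda>x. coherent (p x) (q x)) \<in> borel_measurable M" if "p \<in> borel_measurable M" "q \<in> borel_measurable M" for p and q :: "_ \<Rightarrow> real^'n"
      using measurable_compose[OF measurable_Pair[OF that] coherent_measurable2] by simp
    note [measurable] = c[OF that(1,2)] c[OF that(1,3)]
    show ?thesis unfolding k_def by measurable
  qed
  have ki: "has_bochner_integral lborel (\<lambda>z. k z s s') (of_real (\<kappa> * exp (- (1/4 + 1/(4*e)) * (norm (s - s'))\<^sup>2)))" for s s'
    using coherent_kernel[OF e, of s s' 0] by (simp add: k_def w_def \<kappa>_def)
  \<comment> \<open>Multiplied by the exponential with \<tau> = 1, the kernel \<open>k\<close>
    becomes its own modulus, so the absolute integral comes from the same formula.\<close>
  have ka: "(LINT z|lborel. cmod (k z s s')) = \<kappa> * exp (- (1/4) * (norm (s - s'))\<^sup>2)" for s s'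
  proof -
    have "has_bochner_integral lborel (\<lambda>z. k z s s' * exp (\<i> * of_real ((s - s') \<bullet> im_part z))) (of_real (\<kappa> * exp (- (1/4) * (norm (s - s'))\<^sup>2)))"
      using coherent_kernel[OF e, of s s' 1] by (simp add: k_def w_def \<kappa>_def)
    moreover have "k z s s' * exp (\<i> * of_real ((s - s') \<bullet> im_part z)) = of_real (cmod (k z s s'))" for z
    proof -
      have c1: "cnj (coherent1 x y a) * coherent1 x y b * exp (\<i> * of_real ((a - b) * y)) = of_real (cmod (cnj (coherent1 x y a) * coherent1 x y b))" for x y a b
      proof -
        have n: "cmod (coherent1 x y a) = pi powr (-1/4) * exp (- (a - x)\<^sup>2 / 2)" for a
          unfolding coherent1_def norm_mult norm_exp_eq_Re by (simp add: power2_eq_square)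
        have r: "p * u * (p * t) * t' = (p * p) * (u * t * t')" for p u t t' :: complex by (simp add: mult_ac)
        have "cnj (coherent1 x y a) * coherent1 x y b * exp (\<i> * of_real ((a - b) * y)) =
          (of_real (pi powr (-1/4)) * of_real (pi powr (-1/4))) * exp (cnj (- (of_real (a - x))\<^sup>2 / 2 + \<i> * of_real (a * y) - \<i> * of_real (x * y) / 2) +
          (- (of_real (b - x))\<^sup>2 / 2 + \<i> * of_real (b * y) - \<i> * of_real (x * y) / 2) + \<i> * of_real ((a - b) * y))"
          unfolding coherent1_def complex_cnj_mult complex_cnj_complex_of_real r exp_cnj mult_exp_exp ..
        also have "cnj (- (of_real (a - x))\<^sup>2 / 2 + \<i> * of_real (a * y) - \<i> * of_real (x * y) / 2) +
          (- (of_real (b - x))\<^sup>2 / 2 + \<i> * of_real (b * y) - \<i> * of_real (x * y) / 2) + \<i> * of_real ((a - b) * y) = of_real (- (a - x)\<^sup>2 / 2 + - (b - x)\<^sup>2 / 2)"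
          by (simp add: power2_eq_square field_simps)
        finally show ?thesis unfolding norm_mult complex_mod_cnj n exp_of_real by (simp only: of_real_mult exp_add mult_ac)
      qed
      have 4: "exp (\<i> * of_real ((s - s') \<bullet> im_part z)) = (\<Prod>i\<in>UNIV. exp (\<i> * complex_of_real ((s $ i - s' $ i) * z $ Inr i)))"
        by (simp add: im_part_def inner_vec_def sum_distrib_left exp_sum)
      have "cnj (coherent z s) * coherent z s' * exp (\<i> * of_real ((s - s') \<bullet> im_part z)) = of_real (cmod (cnj (coherent z s) * coherent z s'))"
        unfolding 4 coherent_def cnj_prod prod.distrib[symmetric] c1 prod_norm[symmetric] of_real_prod ..
      then have "k z s s' * exp (\<i> * of_real ((s - s') \<bullet> im_part z)) = of_real (cmod (cnj (coherent z s) * coherent z s')) * of_real (w z)"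
        unfolding k_def by (metis mult.commute mult.left_commute)
      then show ?thesis using w0[of z] by (simp add: k_def norm_mult)
    qed
    ultimately have "has_bochner_integral lborel (\<lambda>z. complex_of_real (cmod (k z s s'))) (of_real (\<kappa> * exp (- (1/4) * (norm (s - s'))\<^sup>2)))" by simp
    from has_bochner_integral_Re[OF this] show ?thesis by (simp add: has_bochner_integral_iff)
  qed
  \<comment> \<open>The second point is written as \<open>s - v\<close>: in the variables shift and
    point, the integrated modulus is a correlation with a Gaussian weight, to which
    \<open>correlation_integrable\<close> applies.\<close>
  let ?P = "\<lambda>(p :: (real^'n) \<times> (real^'n), z). f (snd p) * cnj (g (snd p - fst p)) * k z (snd p) (snd p - fst p)"
  have Pm: "?P \<in> borel_measurable (lborel \<Otimes>\<^sub>M lborel)"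
  proof -
    let ?M = "lborel \<Otimes>\<^sub>M lborel :: (((real^'n) \<times> (real^'n)) \<times> (real^('n+'n))) measure"
    have mv: "(\<lambda>x. fst (fst x)) \<in> borel_measurable ?M" and ms: "(\<lambda>x. snd (fst x)) \<in> borel_measurable ?M"
      by (rule measurable_compose[OF measurable_fst], simp add: borel_measurable_continuous_onI continuous_on_fst continuous_on_snd)+
    have mz: "(\<lambda>x. snd x) \<in> borel_measurable ?M"
      using measurable_snd[of lborel lborel] by simp
    note md = borel_measurable_diff[OF ms mv]
    note [measurable] = measurable_compose[OF ms L2_measurable[OF f]] measurable_compose[OF md L2_measurable[OF g]] km[OF mz ms md]
    show ?thesis unfolding case_prod_beta' by measurable
  qed
  have gi: "integrable lborel (\<lambda>v::real^'n. \<kappa> * exp (- (1/4) * (norm v)\<^sup>2))"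
    using gauss_integral_vec[of "1/4", where 'n='n] by (simp add: has_bochner_integral_iff)
  have Pi: "integrable (lborel \<Otimes>\<^sub>M lborel) ?P"
  proof (rule lborel_pair.Fubini_integrable[OF Pm])
    have "integrable (lborel \<Otimes>\<^sub>M lborel) (\<lambda>(v, s). (\<lambda>(v, s). complex_of_real (\<kappa> * exp (- (1/4) * (norm v)\<^sup>2))) (v, s) * (f s * cnj (g (s - v))))"
      by (rule correlation_integrable[OF f g gi]) (use \<kappa> in \<open>auto simp: norm_mult\<close>)
    then have "integrable (lborel \<Otimes>\<^sub>M lborel) (\<lambda>p. cmod (of_real (\<kappa> * exp (- (1/4) * (norm (fst p))\<^sup>2)) * (f (snd p) * cnj (g (snd p - fst p)))))"
      by (intro integrable_norm) (simp add: case_prod_beta')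
    moreover have "cmod (of_real (\<kappa> * exp (- (1/4) * (norm (fst p))\<^sup>2)) * (f (snd p) * cnj (g (snd p - fst p)))) = (LINT z|lborel. norm (?P (p, z)))" for p
      using \<kappa> ka[of "snd p" "snd p - fst p"] by (simp add: norm_mult)
    ultimately show "integrable lborel (\<lambda>p. LINT z|lborel. norm (?P (p, z)))"
      unfolding lborel_prod by simp
    show "AE p in lborel. integrable lborel (\<lambda>z. ?P (p, z))"
      using ki by (simp add: has_bochner_integral_iff)
  qed
  have Qi: "integrable (lborel \<Otimes>\<^sub>M lborel) (\<lambda>(z, p). ?P (p, z))"
    using lborel_pair.integrable_product_swap[OF Pi] by simp
  \<comment> \<open>The slice in \<open>(v, s)\<close> is known to be integrable only for almost
    every \<open>z\<close>, hence the restriction.\<close>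
  have L: "AE z in lborel. (LINT p|lborel. ?P (p, z)) = L2_inner f (coherent z) * cnj (L2_inner g (coherent z)) * of_real (w z)"
    using lborel_pair.AE_integrable_fst'[OF Qi]
  proof eventually_elim
    case (elim z)
    have i: "integrable (lborel \<Otimes>\<^sub>M lborel) (\<lambda>(v, s). f s * cnj (g (s - v)) * k z s (s - v))"
      using elim by (simp add: lborel_prod case_prod_beta')
    have "(LINT p|lborel. ?P (p, z)) = (LINT p|(lborel \<Otimes>\<^sub>M lborel). (\<lambda>(v, s). f s * cnj (g (s - v)) * k z s (s - v)) p)"
      by (simp add: lborel_prod case_prod_beta')
    also have "\<dots> = (LINT s|lborel. LINT v|lborel. f s * cnj (g (s - v)) * k z s (s - v))"
      by (rule lborel_pair.integral_snd[symmetric]) (rule i)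
    also have "\<dots> = (LINT s|lborel. f s * cnj (coherent z s) * (cnj (L2_inner g (coherent z)) * of_real (w z)))"
    proof (rule Bochner_Integration.integral_cong[OF refl])
      fix s :: "real^'n"
      have "(LINT v|lborel. f s * cnj (g (s - v)) * k z s (s - v)) = (f s * cnj (coherent z s) * of_real (w z)) * (LINT v|lborel. cnj (g (s - v) * cnj (coherent z (s - v))))"
        unfolding integral_mult_right_zero[symmetric] by (simp add: k_def mult_ac)
      also have "(LINT v|lborel. cnj (g (s - v) * cnj (coherent z (s - v)))) = cnj (L2_inner g (coherent z))"
        unfolding L2_inner_def Bochner_Integration.integral_cnj[symmetric]
        using lborel_integral_scale[of "\<lambda>v. cnj (g v * cnj (coherent z v))" "-1" s] by simp
      finally show "(LINT v|lborel. f s * cnj (g (s - v)) * k z s (s - v)) = f s * cnj (coherent z s) * (cnj (L2_inner g (coherent z)) * of_real (w z))"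
        by (simp add: mult_ac)
    qed
    also have "\<dots> = L2_inner f (coherent z) * cnj (L2_inner g (coherent z)) * of_real (w z)"
      unfolding integral_mult_left_zero by (simp add: L2_inner_def mult.assoc)
    finally show ?case .
  qed
  have lm: "(\<lambda>z. L2_inner h (coherent z)) \<in> borel_measurable borel" if [measurable]: "h \<in> borel_measurable borel" for h :: "'n fn"
    unfolding L2_inner_def by measurable
  note [measurable] = lm[OF L2_measurable[OF f]] lm[OF L2_measurable[OF g]]
  have m1: "(\<lambda>z. LINT p|lborel. ?P (p, z)) \<in> borel_measurable lborel"
    using borel_measurable_integrable[OF lborel_pair.integrable_fst'[OF Qi]] by simp
  have m2: "(\<lambda>z. L2_inner f (coherent z) * cnj (L2_inner g (coherent z)) * of_real (w z)) \<in> borel_measurable lborel"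
    by measurable
  have "integrable lborel (\<lambda>z. LINT p|lborel. ?P (p, z))"
    using lborel_pair.integrable_fst'[OF Qi] by simp
  then have "integrable lborel (\<lambda>z. L2_inner f (coherent z) * cnj (L2_inner g (coherent z)) * of_real (w z))"
    by (subst (asm) integrable_cong_AE[OF m1 m2 L])
  then show "integrable lborel (\<lambda>z. L2_inner f (coherent z) * cnj (L2_inner g (coherent z)) * of_real (exp (- e * (norm (im_part z))\<^sup>2)))"
    unfolding w_def .
  have "gform e f g = (LINT z|lborel. LINT p|lborel. ?P (p, z))"
    unfolding gform_def w_def[symmetric] by (rule integral_cong_AE[OF m2 m1]) (use L in \<open>auto elim: eventually_mono\<close>)
  also have "\<dots> = (LINT p|lborel. LINT z|lborel. ?P (p, z))"
    using lborel_pair.Fubini_integral[of "\<lambda>p z. ?P (p, z)"] Pi by simp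
  also have "\<dots> = (LINT p|(lborel \<Otimes>\<^sub>M lborel). (\<lambda>(v, s). (\<lambda>(v, s). complex_of_real (\<kappa> * exp (- (1/4 + 1/(4*e)) * (norm v)\<^sup>2))) (v, s) * (f s * cnj (g (s - v)))) p)"
    unfolding lborel_prod
  proof (rule Bochner_Integration.integral_cong[OF refl])
    fix p :: "(real^'n) \<times> (real^'n)"
    show "(LINT z|lborel. ?P (p, z)) = (\<lambda>(v, s). (\<lambda>(v, s). complex_of_real (\<kappa> * exp (- (1/4 + 1/(4*e)) * (norm v)\<^sup>2))) (v, s) * (f s * cnj (g (s - v)))) p"
      using ki[of "snd p" "snd p - fst p"] by (simp add: has_bochner_integral_iff case_prod_beta' mult_ac)
  qed
  also have "\<dots> = (LINT v|lborel. LINT s|lborel. complex_of_real (\<kappa> * exp (- (1/4 + 1/(4*e)) * (norm v)\<^sup>2)) * (f s * cnj (g (s - v))))"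
  proof -
    have gi2: "integrable lborel (\<lambda>v::real^'n. \<kappa> * exp (- (1/4 + 1/(4*e)) * (norm v)\<^sup>2))"
      using gauss_integral_vec[of "1/4 + 1/(4*e)", where 'n='n] e by (simp add: has_bochner_integral_iff add_pos_pos)
    have "integrable (lborel \<Otimes>\<^sub>M lborel) (\<lambda>(v, s). (\<lambda>(v, s). complex_of_real (\<kappa> * exp (- (1/4 + 1/(4*e)) * (norm v)\<^sup>2))) (v, s) * (f s * cnj (g (s - v))))"
      by (rule correlation_integrable[OF f g gi2]) (use \<kappa> in \<open>auto simp: norm_mult\<close>)
    from lborel_pair.integral_fst'[OF this] show ?thesis by simp
  qed
  also have "\<dots> = (LINT v|lborel. of_real (\<kappa> * exp (- (1/4 + 1/(4*e)) * (norm v)\<^sup>2)) * L2_inner f (\<lambda>x. g (x - v)))"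
    by (simp add: L2_inner_def)
  finally show "gform e f g = (LINT v|lborel. of_real ((pi / e) powr (real CARD('n) / 2) * exp (- (1/4 + 1/(4*e)) * (norm v)\<^sup>2)) * L2_inner f (\<lambda>x. g (x - v)))"
    unfolding \<kappa>_def .
qed

text \<open>Rescaling the shift replaces the Gaussian depending on \<open>e\<close> by a fixed one.
  The prefactor stays bounded while the size of the shifts tends to 0 with \<open>e\<close>: the
  weight is an approximate identity.\<close>

lemma gform_scaled:
  fixes f g :: "('n::finite) fn"
  assumes f: "f \<in> L2" and g: "g \<in> L2" and e: "e > 0"
  shows "gform e f g = of_real ((4 * pi / (1 + e)) powr (real CARD('n) / 2)) *
    (LINT u|lborel. of_real (exp (- 1 * (norm u)\<^sup>2)) * L2_inner f (\<lambda>x. g (x - (1 / sqrt (1/4 + 1/(4*e))) *\<^sub>R u)))"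
proof -
  define \<gamma> where "\<gamma> = 1/4 + 1/(4*e)"
  have \<gamma>: "\<gamma> > 0" using e by (simp add: \<gamma>_def add_pos_pos)
  note [measurable] = f[THEN L2_measurable] g[THEN L2_measurable]
  define c where "c = 1 / sqrt \<gamma>"
  have c: "c > 0" using \<gamma> by (simp add: c_def)
  let ?h = "\<lambda>v::real^'n. of_real ((pi / e) powr (real CARD('n) / 2) * exp (- \<gamma> * (norm v)\<^sup>2)) * L2_inner f (\<lambda>x. g (x - v))"
  have hm: "?h \<in> borel_measurable borel"
    unfolding L2_inner_def by measurable
  have "gform e f g = (LINT v|lborel. ?h v)"
    using gform_correlation(2)[OF f g e] by (simp add: \<gamma>_def)
  also have "\<dots> = (\<bar>c\<bar> ^ CARD('n)) *\<^sub>R (LINT u|lborel. ?h (0 + c *\<^sub>R u))"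
    unfolding lborel_integral_scale[OF hm, of c 0, OF less_imp_neq[OF c, symmetric]] DIM_cart by (simp only: DIM_real mult_1_right)
  also have "\<dots> = (LINT u|lborel. of_real ((4 * pi / (1 + e)) powr (real CARD('n) / 2)) * (of_real (exp (- 1 * (norm u)\<^sup>2)) * L2_inner f (\<lambda>x. g (x - c *\<^sub>R u))))"
    unfolding integral_scaleR_right[symmetric]
  proof (rule Bochner_Integration.integral_cong[OF refl])
    fix u :: "real^'n"
    have e1: "\<gamma> * (norm (c *\<^sub>R u))\<^sup>2 = (norm u)\<^sup>2"
      using \<gamma> by (simp add: c_def power_mult_distrib power_divide)
    have "c ^ CARD('n) = (1 / \<gamma>) powr (real CARD('n) / 2)"
    proof -
      have "c = (1 / \<gamma>) powr (1/2)" using \<gamma> by (simp add: c_def powr_half_sqrt real_sqrt_divide)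
      then show ?thesis using \<gamma> by (simp add: powr_power)
    qed
    then have "c ^ CARD('n) * (pi / e) powr (real CARD('n) / 2) = (1 / \<gamma> * (pi / e)) powr (real CARD('n) / 2)"
      using \<gamma> e by (subst powr_mult) auto
    also have "1 / \<gamma> * (pi / e) = 4 * pi / (1 + e)"
    proof -
      have "\<gamma> * e = (1 + e) / 4" using e by (simp add: \<gamma>_def field_simps)
      moreover have "1 / \<gamma> * (pi / e) = pi / (\<gamma> * e)" by simp
      ultimately have "1 / \<gamma> * (pi / e) = pi / ((1 + e) / 4)" by (simp only:)
      then show ?thesis by simp
    qed
    finally have e2: "c ^ CARD('n) * (pi / e) powr (real CARD('n) / 2) = (4 * pi / (1 + e)) powr (real CARD('n) / 2)" .
    show "\<bar>c\<bar> ^ CARD('n) *\<^sub>R ?h (0 + c *\<^sub>R u) = of_real ((4 * pi / (1 + e)) powr (real CARD('n) / 2)) * (of_real (exp (- 1 * (norm u)\<^sup>2)) * L2_inner f (\<lambda>x. g (x - c *\<^sub>R u)))"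
      using c unfolding e2[symmetric] add_0 mult_minus_left e1 by (simp add: scaleR_conv_of_real mult.assoc)
  qed
  also have "\<dots> = of_real ((4 * pi / (1 + e)) powr (real CARD('n) / 2)) * (LINT u|lborel. of_real (exp (- 1 * (norm u)\<^sup>2)) * L2_inner f (\<lambda>x. g (x - c *\<^sub>R u)))"
    by simp
  finally show ?thesis unfolding c_def \<gamma>_def .
qed

text \<open>The bound is uniform in \<open>e\<close> and carries exactly the constant of the limit
  in \<open>gform_tendsto\<close>. A larger constant would not suffice for
  \<open>hcoeff_parseval\<close>.\<close>

lemma gform_bound:
  fixes f :: "('n::finite) fn"
  assumes f: "f \<in> L2" and e: "e > 0"
  shows "cmod (gform e f f) \<le> (4 * pi) powr (real CARD('n) / 2) * pi powr (real CARD('n) / 2) * (L2_norm f)\<^sup>2"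
proof -
  note [measurable] = f[THEN L2_measurable]
  let ?h = "\<lambda>u. of_real (exp (- 1 * (norm u)\<^sup>2)) * L2_inner f (\<lambda>x. f (x - (1 / sqrt (1/4 + 1/(4*e))) *\<^sub>R u))"
  have g: "has_bochner_integral lborel (\<lambda>u::real^'n. exp (- 1 * (norm u)\<^sup>2)) (pi powr (real CARD('n) / 2))"
    using gauss_integral_vec[of 1, where 'n='n] by simp
  have b: "cmod (?h u) \<le> exp (- 1 * (norm u)\<^sup>2) * (L2_norm f)\<^sup>2" for u
    using L2_cauchy_schwarz[OF f L2_translate(1)[OF f]] L2_translate(2)[OF f]
    by (simp add: norm_mult power2_eq_square mult_left_mono)
  have "cmod (LINT u|lborel. ?h u) \<le> (LINT u|lborel. cmod (?h u))" by (rule integral_norm_bound)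
  also have "\<dots> \<le> (LINT u|(lborel::(real^'n) measure). exp (- 1 * (norm u)\<^sup>2) * (L2_norm f)\<^sup>2)"
  proof (rule integral_mono')
    show "integrable lborel (\<lambda>u::real^'n. exp (- 1 * (norm u)\<^sup>2) * (L2_norm f)\<^sup>2)"
      using g by (simp add: has_bochner_integral_iff)
  qed (use b in auto)
  also have "\<dots> = pi powr (real CARD('n) / 2) * (L2_norm f)\<^sup>2" using g by (simp add: has_bochner_integral_iff)
  finally have 1: "cmod (LINT u|lborel. ?h u) \<le> pi powr (real CARD('n) / 2) * (L2_norm f)\<^sup>2" .
  have "4 * pi / (1 + e) \<le> 4 * pi" using e by (simp add: divide_le_eq mult_le_cancel_left1)
  then have 2: "(4 * pi / (1 + e)) powr (real CARD('n) / 2) \<le> (4 * pi) powr (real CARD('n) / 2)"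
    using e by (intro powr_mono2) auto
  have "cmod (gform e f f) = (4 * pi / (1 + e)) powr (real CARD('n) / 2) * cmod (LINT u|lborel. ?h u)"
    unfolding gform_scaled[OF f f e] norm_mult by simp
  also have "\<dots> \<le> (4 * pi) powr (real CARD('n) / 2) * (pi powr (real CARD('n) / 2) * (L2_norm f)\<^sup>2)"
    by (rule mult_mono[OF 2 1]) auto
  finally show ?thesis by (simp add: mult.assoc)
qed

text \<open>In the form of \<open>gform_scaled\<close> only the shifts vary with \<open>e\<close>,
  so continuity of translations in L2 gives the pointwise limit and the fixed Gaussian
  dominates.\<close>

lemma gform_tendsto:
  fixes f g :: "('n::finite) fn"
  assumes f: "f \<in> L2" and g: "g \<in> L2"
  shows "(\<lambda>j. gform (1 / real (Suc j)) f g) \<longlonglongrightarrow> of_real ((4 * pi) powr (real CARD('n) / 2) * pi powr (real CARD('n) / 2)) * L2_inner f g"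
proof -
  note [measurable] = f[THEN L2_measurable] g[THEN L2_measurable]
  define e where "e j = 1 / real (Suc j)" for j
  have e: "e j > 0" for j by (simp add: e_def)
  have e0: "e \<longlonglongrightarrow> 0" unfolding e_def[abs_def] by (rule LIMSEQ_inverse_real_of_nat[unfolded inverse_eq_divide])
  define c where "c j = 1 / sqrt (1/4 + 1/(4 * e j))" for j
  have c0: "c \<longlonglongrightarrow> 0"
  proof -
    have "c j = sqrt (4 * e j / (1 + e j))" for j
    proof -
      have "1 / (1/4 + 1/(4 * e j)) = 4 * e j / (1 + e j)" using e[of j] by (simp add: field_simps)
      then show ?thesis unfolding c_def by (metis real_sqrt_divide real_sqrt_one)
    qed
    then have ce: "c = (\<lambda>j. sqrt (4 * e j / (1 + e j)))" by auto
    have "(\<lambda>j. sqrt (4 * e j / (1 + e j))) \<longlonglongrightarrow> sqrt (4 * 0 / (1 + 0))" by (intro tendsto_intros e0) auto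
    then show ?thesis unfolding ce by simp
  qed
  have ga: "has_bochner_integral lborel (\<lambda>u::real^'n. exp (- 1 * (norm u)\<^sup>2)) (pi powr (real CARD('n) / 2))"
    using gauss_integral_vec[of 1, where 'n='n] by simp
  have "(\<lambda>j. LINT u|lborel. complex_of_real (exp (- 1 * (norm u)\<^sup>2)) * L2_inner f (\<lambda>x. g (x - c j *\<^sub>R u)))
     \<longlonglongrightarrow> (LINT u|(lborel::(real^'n) measure). complex_of_real (exp (- 1 * (norm u)\<^sup>2)) * L2_inner f g)"
  proof (rule integral_dominated_convergence[where w="\<lambda>u. exp (- 1 * (norm u)\<^sup>2) * (L2_norm f * L2_norm g)"])
    show "integrable lborel (\<lambda>u::real^'n. exp (- 1 * (norm u)\<^sup>2) * (L2_norm f * L2_norm g))"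
      using ga by (simp add: has_bochner_integral_iff)
    show "AE u in lborel. (\<lambda>j. complex_of_real (exp (- 1 * (norm u)\<^sup>2)) * L2_inner f (\<lambda>x. g (x - c j *\<^sub>R u)))
       \<longlonglongrightarrow> complex_of_real (exp (- 1 * (norm u)\<^sup>2)) * L2_inner f g"
    proof (rule AE_I2)
      fix u :: "real^'n"
      have "(\<lambda>j. c j *\<^sub>R u) \<longlonglongrightarrow> 0 *\<^sub>R u" by (intro tendsto_intros c0)
      then have "(\<lambda>j. c j *\<^sub>R u) \<longlonglongrightarrow> 0" by simp
      then show "(\<lambda>j. complex_of_real (exp (- 1 * (norm u)\<^sup>2)) * L2_inner f (\<lambda>x. g (x - c j *\<^sub>R u)))
       \<longlonglongrightarrow> complex_of_real (exp (- 1 * (norm u)\<^sup>2)) * L2_inner f g"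
        by (intro tendsto_mult tendsto_const L2_autocorrelation_tendsto[OF f g])
    qed
    show "AE u in lborel. cmod (complex_of_real (exp (- 1 * (norm u)\<^sup>2)) * L2_inner f (\<lambda>x. g (x - c j *\<^sub>R u)))
       \<le> exp (- 1 * (norm u)\<^sup>2) * (L2_norm f * L2_norm g)" for j
      using L2_cauchy_schwarz[OF f L2_translate(1)[OF g]] L2_translate(2)[OF g]
      by (simp add: norm_mult mult_left_mono)
    show "(\<lambda>u::real^'n. complex_of_real (exp (- 1 * (norm u)\<^sup>2)) * L2_inner f (\<lambda>x. g (x - c j *\<^sub>R u))) \<in> borel_measurable lborel" for j
      unfolding L2_inner_def by measurable
  qed measurable
  also have "(LINT u|(lborel::(real^'n) measure). complex_of_real (exp (- 1 * (norm u)\<^sup>2)) * L2_inner f g) = of_real (pi powr (real CARD('n) / 2)) * L2_inner f g"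
    using has_bochner_integral_integral_eq[OF has_bochner_integral_of_real[OF ga, where 'a=complex]] by simp
  finally have "(\<lambda>j. of_real ((4 * pi / (1 + e j)) powr (real CARD('n) / 2)) * (LINT u|lborel. complex_of_real (exp (- 1 * (norm u)\<^sup>2)) * L2_inner f (\<lambda>x. g (x - c j *\<^sub>R u))))
    \<longlonglongrightarrow> of_real ((4 * pi / (1 + 0)) powr (real CARD('n) / 2)) * (of_real (pi powr (real CARD('n) / 2)) * L2_inner f g)"
    by (intro tendsto_mult tendsto_of_real tendsto_powr tendsto_divide tendsto_add tendsto_const e0) auto
  then show ?thesis
    unfolding c_def gform_scaled[OF f g e, symmetric] by (simp add: e_def mult.assoc)
qed

lemma coherent_total:
  assumes f: "f \<in> L2" and z: "\<And>z. L2_inner f (coherent z) = 0"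
  shows "L2_norm f = 0"
proof -
  have "gform e f f = 0" for e unfolding gform_def z by simp
  then have "of_real ((4 * pi) powr (real CARD('a) / 2) * pi powr (real CARD('a) / 2)) * L2_inner f f = 0"
    using LIMSEQ_unique[OF gform_tendsto[OF f f], of 0] by simp
  then have "L2_inner f f = 0" by simp
  then show ?thesis by (simp add: L2_inner_self)
qed

text \<open>Fatou's lemma: at this stage the projections are known to converge only in their
  coherent state coefficients, at each \<open>z\<close>, while their norms are controlled by
  \<open>S\<close>.\<close>

lemma gform_hproj_le:
  fixes f :: "('n::finite) fn"
  assumes f: "f \<in> L2" and e: "e > 0" and S: "\<And>N. (\<Sum>\<alpha>\<in>cube N. (cmod (hcoeff f \<alpha>))\<^sup>2) \<le> S"
  shows "Re (gform e f f) \<le> (4 * pi) powr (real CARD('n) / 2) * pi powr (real CARD('n) / 2) * S"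
proof -
  define C where "C = (4 * pi) powr (real CARD('n) / 2) * pi powr (real CARD('n) / 2)"
  define d where "d h z = (cmod (L2_inner h (coherent z)))\<^sup>2 * exp (- e * (norm (im_part z))\<^sup>2)" for h :: "'n fn" and z
  have d0: "d h z \<ge> 0" for h z by (simp add: d_def)
  have dm [measurable]: "d h \<in> borel_measurable borel" if "h \<in> L2" for h
  proof -
    note [measurable] = that[THEN L2_measurable]
    have [measurable]: "(\<lambda>z. L2_inner h (coherent z)) \<in> borel_measurable borel" unfolding L2_inner_def by measurable
    show ?thesis unfolding d_def[abs_def] by measurable
  qed
  have dg: "has_bochner_integral lborel (d h) (Re (gform e h h))" if "h \<in> L2" for h
  proof -
    have "has_bochner_integral lborel (\<lambda>z. complex_of_real (d h z)) (gform e h h)"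
    proof -
      have "complex_of_real (d h z) = L2_inner h (coherent z) * cnj (L2_inner h (coherent z)) * of_real (exp (- e * (norm (im_part z))\<^sup>2))" for z
        unfolding d_def of_real_mult complex_norm_square ..
      then show ?thesis using gform_correlation(1)[OF that that e] by (simp add: has_bochner_integral_iff gform_def)
    qed
    from has_bochner_integral_Re[OF this] show ?thesis by simp
  qed
  have nn: "(\<integral>\<^sup>+ z. ennreal (d h z) \<partial>lborel) = ennreal (Re (gform e h h))" if "h \<in> L2" for h
    using dg[OF that] d0 by (subst nn_integral_eq_integral) (auto simp: has_bochner_integral_iff)
  have lim: "(\<lambda>N. d (hproj N f) z) \<longlonglongrightarrow> d f z" for z
    unfolding d_def by (intro tendsto_intros coherent_hproj_tendsto f)
  have "ennreal (Re (gform e f f)) = (\<integral>\<^sup>+ z. liminf (\<lambda>N. ennreal (d (hproj N f) z)) \<partial>lborel)"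
    unfolding nn[OF f, symmetric] using lim by (intro nn_integral_cong lim_imp_Liminf[symmetric]) (auto simp: d0)
  also have "\<dots> \<le> liminf (\<lambda>N. \<integral>\<^sup>+ z. ennreal (d (hproj N f) z) \<partial>lborel)"
    by (rule nn_integral_liminf) (use dm[OF hproj_L2] in measurable)
  also have "\<dots> \<le> ennreal (C * S)"
  proof (rule order_trans[OF Liminf_le_Limsup Limsup_bounded])
    show "\<forall>\<^sub>F N in sequentially. (\<integral>\<^sup>+ z. ennreal (d (hproj N f) z) \<partial>lborel) \<le> ennreal (C * S)"
    proof (rule always_eventually, rule allI)
      fix N
      have "Re (gform e (hproj N f) (hproj N f)) \<le> C * (L2_norm (hproj N f))\<^sup>2"
        using gform_bound[OF hproj_L2 e, of N f] complex_Re_le_cmod[of "gform e (hproj N f) (hproj N f)"] unfolding C_def by linarith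
      also have "\<dots> \<le> C * S" unfolding hproj_norm using S by (intro mult_left_mono) (auto simp: C_def)
      finally show "(\<integral>\<^sup>+ z. ennreal (d (hproj N f) z) \<partial>lborel) \<le> ennreal (C * S)"
        unfolding nn[OF hproj_L2] by (rule ennreal_leI)
    qed
  qed simp
  finally show ?thesis
  proof -
    assume *: "ennreal (Re (gform e f f)) \<le> ennreal (C * S)"
    have "0 \<le> S" by (rule order_trans[OF sum_nonneg S[of 0]]) simp
    then have "0 \<le> C * S" by (simp add: C_def)
    with * show ?thesis unfolding C_def[symmetric] by (simp add: ennreal_le_iff)
  qed
qed

section \<open>Parseval's identity for Hermite functions\<close>

lemma cube_mono: "N \<le> M \<Longrightarrow> cube N \<subseteq> cube M"
  unfolding cube_def by (intro PiE_mono) auto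

text \<open>Bessel's inequality bounds the limit \<open>S\<close> from above. For the converse
  \<open>e\<close> tends to 0 in \<open>gform_hproj_le\<close>: the left side tends to
  \<open>C\<close> times the squared norm, the right side is \<open>C * S\<close> with the same
  \<open>C\<close>.\<close>

lemma hcoeff_parseval:
  fixes f :: "('n::finite) fn"
  assumes f: "f \<in> L2"
  shows "(\<lambda>N. \<Sum>\<alpha>\<in>cube N. (cmod (hcoeff f \<alpha>))\<^sup>2) \<longlonglongrightarrow> (L2_norm f)\<^sup>2"
proof -
  let ?s = "\<lambda>N. \<Sum>\<alpha>\<in>cube N. (cmod (hcoeff f \<alpha>))\<^sup>2"
  have inc: "incseq ?s" by (intro incseq_SucI sum_mono2 cube_mono) auto
  obtain S where S: "?s \<longlonglongrightarrow> S" "\<And>N. ?s N \<le> S"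
    using incseq_convergent[OF inc, of "(L2_norm f)\<^sup>2"] hcoeff_bessel[OF f] by blast
  have "S \<le> (L2_norm f)\<^sup>2" using LIMSEQ_le_const2[OF S(1)] hcoeff_bessel[OF f] by blast
  moreover have "(L2_norm f)\<^sup>2 \<le> S"
  proof -
    define C where "C = (4 * pi) powr (real CARD('n) / 2) * pi powr (real CARD('n) / 2)"
    have C: "C > 0" by (simp add: C_def)
    have "(\<lambda>j. Re (gform (1 / real (Suc j)) f f)) \<longlonglongrightarrow> Re (of_real C * L2_inner f f)"
      unfolding C_def by (intro tendsto_Re gform_tendsto[OF f f])
    moreover have "Re (gform (1 / real (Suc j)) f f) \<le> C * S" for j
      unfolding C_def by (rule gform_hproj_le[OF f]) (use S in auto)
    ultimately have "Re (of_real C * L2_inner f f) \<le> C * S" using LIMSEQ_le_const2 by blast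
    then show ?thesis using C by (simp add: L2_inner_self del: of_real_power)
  qed
  ultimately show ?thesis using S by simp
qed

lemma hproj_tendsto:
  assumes "f \<in> L2"
  shows "(\<lambda>N. L2_norm (\<lambda>x. f x - hproj N f x)) \<longlonglongrightarrow> 0"
proof -
  have "(\<lambda>N. (L2_norm (\<lambda>x. f x - hproj N f x))\<^sup>2) \<longlonglongrightarrow> (L2_norm f)\<^sup>2 - (L2_norm f)\<^sup>2"
    unfolding hproj_diff_norm[OF assms] by (intro tendsto_intros hcoeff_parseval assms)
  from tendsto_real_sqrt[OF this] show ?thesis by simp
qed

lemma hcoeff_parseval_inner:
  assumes f: "f \<in> L2" and g: "g \<in> L2"
  shows "(\<lambda>N. \<Sum>\<alpha>\<in>cube N. hcoeff f \<alpha> * cnj (hcoeff g \<alpha>)) \<longlonglongrightarrow> L2_inner f g"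
proof -
  have c: "(\<lambda>N. L2_norm (\<lambda>x. f x - hproj N f x) * L2_norm g) \<longlonglongrightarrow> 0"
    by (rule tendsto_mult_left_zero[OF hproj_tendsto[OF f]])
  have "(\<lambda>N. L2_inner f g - L2_inner (hproj N f) g) \<longlonglongrightarrow> 0"
    by (rule Lim_null_comparison[OF always_eventually c])
      (use L2_cauchy_schwarz[OF L2_diff[OF f hproj_L2] g] f g in \<open>simp add: L2_inner_diff_left\<close>)
  from tendsto_diff[OF tendsto_const[of "L2_inner f g"] this] show ?thesis by (simp add: hproj_inner_left g)
qed

section \<open>The Wigner distribution and coherent states\<close>

lemma Basis_cart_image: "(Basis :: (real^'n) set) = (\<lambda>i. axis i 1) ` UNIV"
  by (auto simp: Basis_vec_def)

lemma prod_Basis_cart: "(\<Prod>b\<in>Basis. x \<bullet> b) = (\<Prod>i\<in>UNIV. x $ i)" for x :: "real^'n::finite"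
  unfolding Basis_cart_image by (subst prod.reindex) (auto intro!: injI simp: axis_eq_axis inner_axis)

lemma Basis_cart_le: "(\<forall>b\<in>Basis. l \<bullet> b \<le> u \<bullet> b) \<longleftrightarrow> (\<forall>i. l $ i \<le> u $ i)" for l u :: "real^'n::finite"
  unfolding Basis_cart_image by (auto simp: inner_axis)

definition join_part :: "(real^'n::finite) \<times> (real^'n) \<Rightarrow> real^('n + 'n)" where
  "join_part p = (\<chi> j. case j of Inl i \<Rightarrow> fst p $ i | Inr i \<Rightarrow> snd p $ i)"

lemma re_part_join [simp]: "re_part (join_part (x, y)) = x"
  and im_part_join [simp]: "im_part (join_part (x, y)) = y"
  by (simp_all add: re_part_def im_part_def join_part_def)

lemma join_part_measurable: "join_part \<in> borel_measurable borel"
proof -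
  have "continuous_on UNIV (\<lambda>p. (case j of Inl i \<Rightarrow> fst p $ i | Inr i \<Rightarrow> snd p $ i) :: real)" for j :: "'a + 'a"
    by (cases j) (auto intro!: continuous_intros)
  then show ?thesis
    unfolding join_part_def[abs_def] by (intro borel_measurable_continuous_onI continuous_on_vec_lambda)
qed

lemma distr_join_part: "distr (lborel \<Otimes>\<^sub>M lborel) borel join_part = (lborel :: (real^('n::finite + 'n)) measure)"
proof (rule lborel_eqI[symmetric])
  fix l u :: "real^('n + 'n)"
  assume "\<And>b. b \<in> Basis \<Longrightarrow> l \<bullet> b \<le> u \<bullet> b"
  then have lu: "\<And>i. l $ i \<le> u $ i" using Basis_cart_le by blast
  have [measurable]: "join_part \<in> measurable (lborel \<Otimes>\<^sub>M lborel) (borel :: (real^('n + 'n)) measure)"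
    using join_part_measurable by (simp add: lborel_prod)
  have v: "join_part -` box l u \<inter> space (lborel \<Otimes>\<^sub>M lborel) = box (re_part l) (re_part u) \<times> box (im_part l) (im_part u)"
    by (auto simp: space_pair_measure mem_box_cart join_part_def re_part_def im_part_def split: sum.splits)
  have "emeasure (distr (lborel \<Otimes>\<^sub>M lborel) borel join_part) (box l u) = emeasure lborel (box (re_part l) (re_part u)) * emeasure lborel (box (im_part l) (im_part u))"
    by (subst emeasure_distr) (simp_all add: v lborel.emeasure_pair_measure_Times)
  also have "\<dots> = ennreal (\<Prod>i\<in>UNIV. (re_part u - re_part l) $ i) * ennreal (\<Prod>i\<in>UNIV. (im_part u - im_part l) $ i)"
  proof -
    have "\<forall>b\<in>Basis. re_part l \<bullet> b \<le> re_part u \<bullet> b" "\<forall>b\<in>Basis. im_part l \<bullet> b \<le> im_part u \<bullet> b"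
      unfolding Basis_cart_le using lu by (auto simp: re_part_def im_part_def)
    then show ?thesis by (simp add: emeasure_lborel_box_eq prod_Basis_cart)
  qed
  also have "\<dots> = ennreal ((\<Prod>i\<in>UNIV. (re_part u - re_part l) $ i) * (\<Prod>i\<in>UNIV. (im_part u - im_part l) $ i))"
    by (rule ennreal_mult[symmetric]) (auto intro!: prod_nonneg simp: re_part_def im_part_def lu)
  also have "\<dots> = ennreal (\<Prod>b\<in>Basis. (u - l) \<bullet> b)"
    unfolding prod_Basis_cart prod_UNIV_Plus by (simp add: re_part_def im_part_def)
  finally show "emeasure (distr (lborel \<Otimes>\<^sub>M lborel) borel join_part) (box l u) = ennreal (\<Prod>b\<in>Basis. (u - l) \<bullet> b)" .
qed simp

lemma lborel_integral_join:
  fixes F :: "real^('n::finite + 'n) \<Rightarrow> complex"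
  assumes F: "integrable lborel F"
  shows "(LINT z|lborel. F z) = (LINT x|lborel. LINT y|lborel. F (join_part (x, y)))"
proof -
  have Fm: "F \<in> borel_measurable borel" using F by auto
  have jm: "join_part \<in> measurable (lborel \<Otimes>\<^sub>M lborel) (borel :: (real^('n + 'n)) measure)"
    using join_part_measurable by (simp add: lborel_prod)
  have "(LINT z|lborel. F z) = (LINT p|(lborel \<Otimes>\<^sub>M lborel). F (join_part p))"
    unfolding distr_join_part[symmetric] by (rule integral_distr[OF jm Fm])
  moreover have "integrable (lborel \<Otimes>\<^sub>M lborel) (\<lambda>p. F (join_part p))"
    using F unfolding distr_join_part[symmetric] by (subst (asm) integrable_distr_eq[OF jm Fm])
  ultimately show ?thesis using lborel_pair.integral_fst'[of "\<lambda>p. F (join_part p)"] by simp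
qed

section \<open>Gaussian smoothing of the Wigner distribution\<close>

lemma scaleR_half_double: "(1/2) *\<^sub>R s + (1/2) *\<^sub>R s = (s::'a::real_vector)"
  by (simp flip: scaleR_left_distrib)

lemma L2_scale:
  fixes f :: "('n::finite) fn"
  assumes f: "f \<in> L2" and c: "c \<noteq> 0"
  shows "(\<lambda>x. f (t + c *\<^sub>R x)) \<in> L2"
    and "L2_norm (\<lambda>x. f (t + c *\<^sub>R x)) = sqrt (1 / \<bar>c\<bar> ^ CARD('n)) * L2_norm f"
proof -
  note [measurable] = L2_measurable[OF f]
  show "(\<lambda>x. f (t + c *\<^sub>R x)) \<in> L2"
    using lborel_integrable_scale[OF L2_square_integrable[OF f] c, of t] by (intro L2I) auto
  have hm: "(\<lambda>x. (cmod (f x))\<^sup>2) \<in> borel_measurable borel" by measurable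
  have "(LINT x|lborel. (cmod (f x))\<^sup>2) = \<bar>c\<bar> ^ CARD('n) * (LINT x|lborel. (cmod (f (t + c *\<^sub>R x)))\<^sup>2)"
    unfolding lborel_integral_scale[OF hm c, of t] DIM_cart by simp
  then have "(LINT x|lborel. (cmod (f (t + c *\<^sub>R x)))\<^sup>2) = 1 / \<bar>c\<bar> ^ CARD('n) * (LINT x|lborel. (cmod (f x))\<^sup>2)"
    using c by simp
  then show "L2_norm (\<lambda>x. f (t + c *\<^sub>R x)) = sqrt (1 / \<bar>c\<bar> ^ CARD('n)) * L2_norm f"
    unfolding L2_norm_def real_sqrt_mult[symmetric] by simp
qed

lemma gauss_fourier_vec:
  fixes s y0 :: "real^'n::finite"
  shows "(LINT y|lborel. exp (- \<i> * of_real (s \<bullet> y)) * of_real (exp (- (norm (y - y0))\<^sup>2)))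
    = of_real (pi powr (real CARD('n) / 2)) * (exp (- \<i> * of_real (s \<bullet> y0)) * of_real (exp (- (norm s)\<^sup>2 / 4)))"
proof -
  have 1: "has_bochner_integral lborel (\<lambda>y::real. exp (- \<i> * of_real (a * y) + of_real (- (y - b)\<^sup>2)))
    (of_real (sqrt pi) * exp (- \<i> * of_real (a * b) + of_real (- a\<^sup>2 / 4)))" for a b :: real
  proof -
    have "has_bochner_integral lborel (\<lambda>y. exp (of_real (- b\<^sup>2)) * exp (- of_real 1 * (of_real y)\<^sup>2 + (of_real (2 * b) - \<i> * of_real a) * of_real y))
      (exp (of_real (- b\<^sup>2)) * (of_real (sqrt (pi / 1)) * exp ((of_real (2 * b) - \<i> * of_real a)\<^sup>2 / (4 * of_real 1))))"
      by (rule has_bochner_integral_mult_right, rule gauss_integral) simp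
    moreover have "exp (of_real (- b\<^sup>2)) * exp (- of_real 1 * (of_real y)\<^sup>2 + (of_real (2 * b) - \<i> * of_real a) * of_real y)
      = exp (- \<i> * of_real (a * y) + of_real (- (y - b)\<^sup>2))" for y
      unfolding mult_exp_exp by (rule arg_cong[where f=exp]) (simp add: power2_eq_square algebra_simps)
    moreover have "exp (of_real (- b\<^sup>2)) * (of_real (sqrt (pi / 1)) * exp ((of_real (2 * b) - \<i> * of_real a)\<^sup>2 / (4 * of_real 1)))
      = of_real (sqrt pi) * exp (- \<i> * of_real (a * b) + of_real (- a\<^sup>2 / 4))"
    proof -
      have "of_real (- b\<^sup>2) + (of_real (2 * b) - \<i> * of_real a)\<^sup>2 / (4 * of_real 1) = - \<i> * of_real (a * b) + of_real (- a\<^sup>2 / 4)"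
        by (simp add: power2_eq_square field_simps)
      then show ?thesis by (metis mult.left_commute mult_exp_exp div_by_1)
    qed
    ultimately show ?thesis by (simp only:)
  qed
  have "(LINT y|lborel. exp (- \<i> * of_real (s \<bullet> y)) * of_real (exp (- (norm (y - y0))\<^sup>2)))
    = (LINT y|lborel. (\<Prod>i\<in>UNIV. exp (- \<i> * of_real (s $ i * y $ i) + of_real (- (y $ i - y0 $ i)\<^sup>2))))"
    unfolding exp_of_real[symmetric] mult_exp_exp exp_sum[OF finite, symmetric] norm_power2_vec inner_vec_def
    by (simp add: sum_distrib_left sum.distrib sum_negf sum_subtractf)
  also have "\<dots> = (\<Prod>i\<in>UNIV. of_real (sqrt pi) * exp (- \<i> * of_real (s $ i * y0 $ i) + of_real (- (s $ i)\<^sup>2 / 4)))"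
  proof -
    have "(LINT y|lborel. (\<Prod>i\<in>UNIV. exp (- \<i> * of_real (s $ i * y $ i) + of_real (- (y $ i - y0 $ i)\<^sup>2))))
      = (\<Prod>i\<in>UNIV. LINT y|lborel. exp (- \<i> * of_real (s $ i * y) + of_real (- (y - y0 $ i)\<^sup>2)))"
      by (rule has_bochner_integral_integral_eq, rule lborel_integral_prod_vec) (use 1 in \<open>simp only: has_bochner_integral_iff\<close>)
    then show ?thesis using 1 by (simp only: has_bochner_integral_iff)
  qed
  also have "\<dots> = of_real (sqrt pi ^ CARD('n)) * exp (\<Sum>i\<in>UNIV. - \<i> * of_real (s $ i * y0 $ i) + of_real (- (s $ i)\<^sup>2 / 4))"
    unfolding exp_sum[OF finite] by (simp add: prod.distrib)
  also have "(\<Sum>i\<in>UNIV. - \<i> * of_real (s $ i * y0 $ i) + of_real (- (s $ i)\<^sup>2 / 4)) = - \<i> * of_real (s \<bullet> y0) + of_real (- (norm s)\<^sup>2 / 4)"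
    unfolding norm_power2_vec inner_vec_def by (simp add: sum_distrib_left sum.distrib sum_negf sum_divide_distrib sum_subtractf)
  also have "sqrt pi ^ CARD('n) = pi powr (real CARD('n) / 2)"
    by (simp add: sqrt_power_eq_powr)
  finally show ?thesis by (simp only: exp_add exp_of_real)
qed

text \<open>The left side is the kernel of the smoothed Wigner distribution in midpoint and
  difference coordinates. The parallelogram law, |p - x|^2 + |p' - x|^2 = 2|m - x|^2 + |p - p'|^2 /
  2 for the midpoint m, separates it into one factor for each point.\<close>

lemma coherent_pair:
  fixes p p' :: "real^'n::finite"
  shows "exp (- \<i> * of_real ((p - p') \<bullet> im_part z)) * of_real (exp (- (norm (p - p'))\<^sup>2 / 4)) * of_real (exp (- (norm ((1/2) *\<^sub>R (p + p') - re_part z))\<^sup>2))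
    = of_real (pi powr (real CARD('n) / 2)) * (cnj (coherent z p) * coherent z p')"
proof -
  have c1: "cnj (coherent1 x y a) * coherent1 x y b = of_real (1 / sqrt pi) * exp (- \<i> * of_real ((a - b) * y) + of_real (- (a - b)\<^sup>2 / 4) + of_real (- ((1/2) * (a + b) - x)\<^sup>2))" for x y a b
  proof -
    have pp: "complex_of_real (pi powr (-1/4)) * of_real (pi powr (-1/4)) = of_real (1 / sqrt pi)"
      by (simp only: of_real_mult[symmetric] pi_powr_quarter_square)
    have r: "P * U * (P * V) = (P * P) * (U * V)" for P U V :: complex by (simp add: mult_ac)
    have "cnj (coherent1 x y a) * coherent1 x y b = of_real (1 / sqrt pi) * exp (cnj (- (of_real (a - x))\<^sup>2 / 2 + \<i> * of_real (a * y) - \<i> * of_real (x * y) / 2) +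
          (- (of_real (b - x))\<^sup>2 / 2 + \<i> * of_real (b * y) - \<i> * of_real (x * y) / 2))"
      unfolding coherent1_def complex_cnj_mult complex_cnj_complex_of_real r pp exp_cnj mult_exp_exp ..
    also have "cnj (- (of_real (a - x))\<^sup>2 / 2 + \<i> * of_real (a * y) - \<i> * of_real (x * y) / 2) +
          (- (of_real (b - x))\<^sup>2 / 2 + \<i> * of_real (b * y) - \<i> * of_real (x * y) / 2)
       = - \<i> * of_real ((a - b) * y) + of_real (- (a - b)\<^sup>2 / 4) + of_real (- ((1/2) * (a + b) - x)\<^sup>2)"
      by (simp add: power2_eq_square field_simps)
    finally show ?thesis .
  qed
  have "cnj (coherent z p) * coherent z p' = (\<Prod>i\<in>UNIV. of_real (1 / sqrt pi) * exp (- \<i> * of_real ((p $ i - p' $ i) * z $ Inr i) + of_real (- (p $ i - p' $ i)\<^sup>2 / 4) + of_real (- ((1/2) * (p $ i + p' $ i) - z $ Inl i)\<^sup>2)))"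
    unfolding coherent_def cnj_prod prod.distrib[symmetric] c1 ..
  also have "\<dots> = of_real ((1 / sqrt pi) ^ CARD('n)) * exp (\<Sum>i\<in>UNIV. - \<i> * of_real ((p $ i - p' $ i) * z $ Inr i) + of_real (- (p $ i - p' $ i)\<^sup>2 / 4) + of_real (- ((1/2) * (p $ i + p' $ i) - z $ Inl i)\<^sup>2))"
    unfolding exp_sum[OF finite] by (simp add: prod.distrib prod_dividef power_divide)
  also have "(\<Sum>i\<in>UNIV. - \<i> * of_real ((p $ i - p' $ i) * z $ Inr i) + of_real (- (p $ i - p' $ i)\<^sup>2 / 4) + of_real (- ((1/2) * (p $ i + p' $ i) - z $ Inl i)\<^sup>2))
     = - \<i> * of_real ((p - p') \<bullet> im_part z) + of_real (- (norm (p - p'))\<^sup>2 / 4) + of_real (- (norm ((1/2) *\<^sub>R (p + p') - re_part z))\<^sup>2)"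
    unfolding norm_power2_vec inner_vec_def by (simp add: sum_distrib_left sum.distrib sum_negf sum_divide_distrib sum_subtractf im_part_def re_part_def)
  finally have "cnj (coherent z p) * coherent z p' = of_real ((1 / sqrt pi) ^ CARD('n)) * (exp (- \<i> * of_real ((p - p') \<bullet> im_part z)) * of_real (exp (- (norm (p - p'))\<^sup>2 / 4)) * of_real (exp (- (norm ((1/2) *\<^sub>R (p + p') - re_part z))\<^sup>2)))"
    by (simp only: exp_add exp_of_real)
  moreover have "pi powr (real CARD('n) / 2) * (1 / sqrt pi) ^ CARD('n) = 1"
  proof -
    have "sqrt pi ^ CARD('n) = pi powr (real CARD('n) / 2)"
      by (simp add: sqrt_power_eq_powr)
    then show ?thesis by (simp add: power_divide)
  qed
  then have "complex_of_real (pi powr (real CARD('n) / 2)) * of_real ((1 / sqrt pi) ^ CARD('n)) = 1" by (simp only: of_real_mult[symmetric] of_real_1)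
  ultimately show ?thesis by (simp only: mult.assoc[symmetric] mult_1)
qed

text \<open>\<open>cross_wigner\<close> stripped of its constant, with the two halves of
  \<open>z\<close> as separate arguments so that momentum and position can be integrated in
  turn.\<close>

definition wigner_core :: "('n::finite) fn \<Rightarrow> 'n fn \<Rightarrow> real^'n \<Rightarrow> real^'n \<Rightarrow> complex" where
  "wigner_core f g x y = (LINT s|lborel. exp (- \<i> * of_real (s \<bullet> y)) * (f (x + (1/2) *\<^sub>R s) * cnj (g (x - (1/2) *\<^sub>R s))))"

lemma cross_wigner_core:
  fixes f g :: "('n::finite) fn"
  shows "cross_wigner f g z = of_real ((2 * pi) powr (- real CARD('n) / 2)) * wigner_core f g (re_part z) (im_part z)"
  unfolding cross_wigner_def wigner_core_def by (simp only: mult.assoc inverse_eq_divide)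

text \<open>Halving the variable costs a factor 2^(n/2) in the norm of each function; Cauchy-Schwarz
  then gives a bound uniform in \<open>x\<close>, valid for Wigner values at single points.\<close>

lemma wigner_core_integrable:
  fixes f g :: "('n::finite) fn"
  assumes f: "f \<in> L2" and g: "g \<in> L2"
  shows "integrable lborel (\<lambda>s. f (x + (1/2) *\<^sub>R s) * cnj (g (x - (1/2) *\<^sub>R s)))"
    and "(LINT s|lborel. cmod (f (x + (1/2) *\<^sub>R s) * cnj (g (x - (1/2) *\<^sub>R s)))) \<le> 2 ^ CARD('n) * (L2_norm f * L2_norm g)"
proof -
  have 1: "(\<lambda>s. f (x + (1/2) *\<^sub>R s)) \<in> L2" "(\<lambda>s. g (x + (-1/2) *\<^sub>R s)) \<in> L2"
    by (rule L2_scale(1)[OF f], simp, rule L2_scale(1)[OF g], simp)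
  show "integrable lborel (\<lambda>s. f (x + (1/2) *\<^sub>R s) * cnj (g (x - (1/2) *\<^sub>R s)))"
    using L2_inner_integrable[OF 1] by simp
  have n: "L2_norm (\<lambda>s. f (x + (1/2) *\<^sub>R s)) = sqrt (2 ^ CARD('n)) * L2_norm f"
    "L2_norm (\<lambda>s. g (x + (-1/2) *\<^sub>R s)) = sqrt (2 ^ CARD('n)) * L2_norm g"
    by (subst L2_scale(2)[OF f], simp, simp add: power_divide, subst L2_scale(2)[OF g], simp, simp add: power_divide)
  have "(LINT s|lborel. cmod (f (x + (1/2) *\<^sub>R s) * cnj (g (x - (1/2) *\<^sub>R s)))) \<le> L2_norm (\<lambda>s. f (x + (1/2) *\<^sub>R s)) * L2_norm (\<lambda>s. g (x + (-1/2) *\<^sub>R s))"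
    using L2_inner_abs_bound(2)[OF 1] by simp
  also have "\<dots> = (sqrt (2 ^ CARD('n)) * sqrt (2 ^ CARD('n))) * (L2_norm f * L2_norm g)"
    unfolding n by (simp only: mult_ac)
  finally show "(LINT s|lborel. cmod (f (x + (1/2) *\<^sub>R s) * cnj (g (x - (1/2) *\<^sub>R s)))) \<le> 2 ^ CARD('n) * (L2_norm f * L2_norm g)"
    by simp
qed

lemma wigner_core_bound:
  fixes f g :: "('n::finite) fn"
  assumes f: "f \<in> L2" and g: "g \<in> L2"
  shows "cmod (wigner_core f g x y) \<le> 2 ^ CARD('n) * (L2_norm f * L2_norm g)"
proof -
  have "cmod (wigner_core f g x y) \<le> (LINT s|lborel. cmod (exp (- \<i> * of_real (s \<bullet> y)) * (f (x + (1/2) *\<^sub>R s) * cnj (g (x - (1/2) *\<^sub>R s)))))"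
    unfolding wigner_core_def by (rule integral_norm_bound)
  also have "\<dots> = (LINT s|lborel. cmod (f (x + (1/2) *\<^sub>R s) * cnj (g (x - (1/2) *\<^sub>R s))))"
    by (simp add: norm_mult)
  also have "\<dots> \<le> 2 ^ CARD('n) * (L2_norm f * L2_norm g)" by (rule wigner_core_integrable[OF f g])
  finally show ?thesis .
qed

text \<open>The momentum half of the smoothing: the Fourier transform of the Gaussian in
  \<open>y\<close> appears as a Gaussian weight on the lag \<open>s\<close>.\<close>

lemma wigner_core_gauss_y:
  fixes f g :: "('n::finite) fn"
  assumes f: "f \<in> L2" and g: "g \<in> L2"
  shows "(LINT y|lborel. wigner_core f g x y * of_real (exp (- (norm (y - y0))\<^sup>2)))
   = of_real (pi powr (real CARD('n) / 2)) * (LINT s|lborel. exp (- \<i> * of_real (s \<bullet> y0)) * of_real (exp (- (norm s)\<^sup>2 / 4)) * (f (x + (1/2) *\<^sub>R s) * cnj (g (x - (1/2) *\<^sub>R s))))"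
proof -
  note [measurable] = f[THEN L2_measurable] g[THEN L2_measurable]
  define h where "h s = f (x + (1/2) *\<^sub>R s) * cnj (g (x - (1/2) *\<^sub>R s))" for s
  have [measurable]: "h \<in> borel_measurable borel" unfolding h_def[abs_def] by measurable
  have hi: "integrable lborel h" using wigner_core_integrable(1)[OF f g, of x] by (simp add: h_def[abs_def])
  let ?w = "\<lambda>y. exp (- (norm (y - y0))\<^sup>2)"
  have wi: "integrable lborel ?w"
    using lborel_integrable_translate[of "\<lambda>y::real^'n. exp (- 1 * (norm y)\<^sup>2)" y0] gauss_integral_vec[of 1, where 'n='n]
    by (simp add: has_bochner_integral_iff)
  let ?F = "\<lambda>(y, s). exp (- \<i> * of_real (s \<bullet> y)) * h s * of_real (?w y)"
  have Fm: "?F \<in> borel_measurable (lborel \<Otimes>\<^sub>M lborel)" by measurable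
  have n: "norm (?F (y, s)) = ?w y * cmod (h s)" for y s by (simp add: norm_mult)
  have Fi: "integrable (lborel \<Otimes>\<^sub>M lborel) ?F"
  proof (rule lborel_pair.Fubini_integrable[OF Fm])
    show "integrable lborel (\<lambda>y. LINT s|lborel. norm (?F (y, s)))" unfolding n using wi by simp
    show "AE y in lborel. integrable lborel (\<lambda>s. ?F (y, s))"
    proof (rule AE_I2)
      fix y :: "real^'n"
      show "integrable lborel (\<lambda>s. ?F (y, s))"
      proof (rule Bochner_Integration.integrable_bound)
        show "integrable lborel (\<lambda>s. ?w y * cmod (h s))" using hi by simp
        show "(\<lambda>s. ?F (y, s)) \<in> borel_measurable lborel" by (rule measurable_compose[OF measurable_Pair1' Fm]) simp
      qed (use n in auto)
    qed
  qed
  have "(LINT y|lborel. wigner_core f g x y * of_real (?w y)) = (LINT y|lborel. LINT s|lborel. ?F (y, s))"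
    unfolding wigner_core_def h_def[symmetric] by simp
  also have "\<dots> = (LINT s|lborel. LINT y|lborel. ?F (y, s))"
    using lborel_pair.Fubini_integral[of "\<lambda>y s. ?F (y, s)"] Fi by simp
  also have "\<dots> = (LINT s|lborel. of_real (pi powr (real CARD('n) / 2)) * (exp (- \<i> * of_real (s \<bullet> y0)) * of_real (exp (- (norm s)\<^sup>2 / 4)) * h s))"
  proof (rule Bochner_Integration.integral_cong[OF refl])
    fix s :: "real^'n"
    have "(LINT y|lborel. ?F (y, s)) = h s * (LINT y|lborel. exp (- \<i> * of_real (s \<bullet> y)) * of_real (?w y))"
      unfolding integral_mult_right_zero[symmetric] prod.case by (simp only: mult_ac)
    then show "(LINT y|lborel. ?F (y, s)) = of_real (pi powr (real CARD('n) / 2)) * (exp (- \<i> * of_real (s \<bullet> y0)) * of_real (exp (- (norm s)\<^sup>2 / 4)) * h s)"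
      unfolding gauss_fourier_vec by (simp only: mult_ac)
  qed
  finally show ?thesis unfolding h_def by simp
qed

text \<open>Smoothing the Wigner distribution with a Gaussian, an operation commuting with orthogonal
  changes of variables, produces coherent state coefficients.\<close>

lemma husimi_wigner:
  fixes f g :: "('n::finite) fn"
  assumes f: "f \<in> L2" and g: "g \<in> L2"
  shows "(LINT z|lborel. cross_wigner f g z * of_real (exp (- (norm (z - z0))\<^sup>2)))
    = of_real ((2 * pi) powr (- real CARD('n) / 2) * pi powr (real CARD('n) / 2) * pi powr (real CARD('n) / 2)) *
      (L2_inner f (coherent z0) * cnj (L2_inner g (coherent z0)))"
proof -
  note [measurable] = f[THEN L2_measurable] g[THEN L2_measurable]
  define x0 y0 where "x0 = re_part z0" and "y0 = im_part z0"
  define P where "P = complex_of_real (pi powr (real CARD('n) / 2))"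
  let ?W = "wigner_core f g"
  have split: "(norm (z - z0))\<^sup>2 = (norm (re_part z - x0))\<^sup>2 + (norm (im_part z - y0))\<^sup>2" for z :: "real^('n + 'n)"
    unfolding norm_power2_vec sum_UNIV_Plus x0_def y0_def by (simp add: re_part_def im_part_def)
  have Wi: "integrable lborel (\<lambda>z. ?W (re_part z) (im_part z) * of_real (exp (- (norm (z - z0))\<^sup>2)))"
  proof (rule Bochner_Integration.integrable_bound)
    have "integrable lborel (\<lambda>z::real^('n + 'n). exp (- 1 * (norm (z - z0))\<^sup>2))"
      using lborel_integrable_translate[of "\<lambda>y::real^('n+'n). exp (- 1 * (norm y)\<^sup>2)" z0] gauss_integral_vec[of 1, where 'n="'n + 'n"]
      by (simp add: has_bochner_integral_iff)
    then show "integrable lborel (\<lambda>z::real^('n + 'n). (2 ^ CARD('n) * (L2_norm f * L2_norm g)) * exp (- (norm (z - z0))\<^sup>2))" by simp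
    show "(\<lambda>z. ?W (re_part z) (im_part z) * of_real (exp (- (norm (z - z0))\<^sup>2))) \<in> borel_measurable lborel"
      unfolding wigner_core_def by measurable
    show "AE z in lborel. norm (?W (re_part z) (im_part z) * of_real (exp (- (norm (z - z0))\<^sup>2)))
       \<le> norm ((2 ^ CARD('n) * (L2_norm f * L2_norm g)) * exp (- (norm (z - z0))\<^sup>2))"
      using wigner_core_bound[OF f g] by (auto intro!: AE_I2 mult_right_mono order_trans[OF _ abs_ge_self] simp: norm_mult)
  qed
  \<comment> \<open>\<open>m\<close> collects the weights in the coordinates lag \<open>s\<close>
    and endpoint p = x + s/2. There the integrand \<open>?Phi\<close> is a correlation and
    \<open>correlation_integrable\<close> applies; \<open>?Psi\<close> is the same function with the
    midpoint \<open>x\<close> as variable.\<close>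
  define m where "m = (\<lambda>(s, p). exp (- \<i> * of_real (s \<bullet> y0)) * of_real (exp (- (norm s)\<^sup>2 / 4)) * of_real (exp (- (norm (p - (1/2) *\<^sub>R s - x0))\<^sup>2)))"
  have mm [measurable]: "m \<in> borel_measurable (borel \<Otimes>\<^sub>M borel)" unfolding m_def by measurable
  let ?Phi = "\<lambda>(s, p). m (s, p) * (f p * cnj (g (p - s)))"
  have gi: "integrable lborel (\<lambda>s::real^'n. exp (- (1/4) * (norm s)\<^sup>2))"
    using gauss_integral_vec[of "1/4", where 'n='n] by (simp add: has_bochner_integral_iff)
  have Phi: "integrable (lborel \<Otimes>\<^sub>M lborel) ?Phi"
    by (rule correlation_integrable[OF f g gi mm]) (simp add: m_def norm_mult mult_le_cancel_left1)
  let ?Psi = "\<lambda>(s, x). ?Phi (s, x + (1/2) *\<^sub>R s)"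
  have Psi: "integrable (lborel \<Otimes>\<^sub>M lborel) ?Psi"
  proof (rule lborel_pair.Fubini_integrable)
    show "?Psi \<in> borel_measurable (lborel \<Otimes>\<^sub>M lborel)" by measurable
    have Phm: "(\<lambda>p. ?Phi (s, p)) \<in> borel_measurable borel" for s unfolding m_def prod.case by measurable
    have t: "(LINT x|lborel. norm (?Psi (s, x))) = (LINT p|lborel. norm (?Phi (s, p)))" for s
      using lborel_integral_translate[of "\<lambda>p. norm (?Phi (s, p))" "- (1/2) *\<^sub>R s"] Phm[of s] by simp
    show "integrable lborel (\<lambda>s. LINT x|lborel. norm (?Psi (s, x)))"
      unfolding t using lborel_pair.integrable_fst'[OF integrable_norm[OF Phi]] by simp
    show "AE s in lborel. integrable lborel (\<lambda>x. ?Psi (s, x))"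
      using lborel_pair.AE_integrable_fst'[OF Phi]
    proof eventually_elim
      case (elim s)
      then show ?case using lborel_integrable_translate[of "\<lambda>p. ?Phi (s, p)" "- (1/2) *\<^sub>R s"] by simp
    qed
  qed
  have "(LINT z|lborel. ?W (re_part z) (im_part z) * of_real (exp (- (norm (z - z0))\<^sup>2)))
     = (LINT x|lborel. LINT y|lborel. ?W x y * of_real (exp (- (norm (y - y0))\<^sup>2)) * of_real (exp (- (norm (x - x0))\<^sup>2)))"
    by (subst lborel_integral_join[OF Wi]) (simp only: split re_part_join im_part_join minus_add_distrib exp_add of_real_mult mult_ac)
  also have "\<dots> = (LINT x|lborel. P * (LINT s|lborel. ?Psi (s, x)))"
  proof (rule Bochner_Integration.integral_cong[OF refl])
    fix x :: "real^'n"
    have "(LINT s|lborel. ?Psi (s, x)) = (LINT s|lborel. of_real (exp (- (norm (x - x0))\<^sup>2)) * (exp (- \<i> * of_real (s \<bullet> y0)) * of_real (exp (- (norm s)\<^sup>2 / 4)) * (f (x + (1/2) *\<^sub>R s) * cnj (g (x - (1/2) *\<^sub>R s)))))"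
    proof (rule Bochner_Integration.integral_cong[OF refl])
      fix s :: "real^'n"
      have hs: "x + (1/2) *\<^sub>R s - s = x - (1/2) *\<^sub>R s"
      proof -
        have "x + h - (h + h) = x - h" for h by simp
        from this[of "(1/2) *\<^sub>R s"] show ?thesis unfolding scaleR_half_double .
      qed
      show "?Psi (s, x) = of_real (exp (- (norm (x - x0))\<^sup>2)) * (exp (- \<i> * of_real (s \<bullet> y0)) * of_real (exp (- (norm s)\<^sup>2 / 4)) * (f (x + (1/2) *\<^sub>R s) * cnj (g (x - (1/2) *\<^sub>R s))))"
        unfolding m_def prod.case hs add_diff_cancel_right' by (simp only: mult_ac)
    qed
    then have "P * (LINT s|lborel. ?Psi (s, x)) = of_real (exp (- (norm (x - x0))\<^sup>2)) * (P * (LINT s|lborel. exp (- \<i> * of_real (s \<bullet> y0)) * of_real (exp (- (norm s)\<^sup>2 / 4)) * (f (x + (1/2) *\<^sub>R s) * cnj (g (x - (1/2) *\<^sub>R s)))))"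
      by simp
    then show "(LINT y|lborel. ?W x y * of_real (exp (- (norm (y - y0))\<^sup>2)) * of_real (exp (- (norm (x - x0))\<^sup>2))) = P * (LINT s|lborel. ?Psi (s, x))"
      unfolding P_def wigner_core_gauss_y[OF f g, symmetric] integral_mult_left_zero by (simp only: mult.commute)
  qed
  also have "\<dots> = P * (LINT x|lborel. LINT s|lborel. ?Psi (s, x))" by simp
  also have "(LINT x|lborel. LINT s|lborel. ?Psi (s, x)) = (LINT s|lborel. LINT x|lborel. ?Psi (s, x))"
    using lborel_pair.Fubini_integral[of "\<lambda>s x. ?Psi (s, x)"] Psi by simp
  also have "\<dots> = (LINT s|lborel. LINT p|lborel. ?Phi (s, p))"
  proof (rule Bochner_Integration.integral_cong[OF refl])
    fix s :: "real^'n"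
    have "(\<lambda>p. ?Phi (s, p)) \<in> borel_measurable borel" unfolding m_def prod.case by measurable
    from lborel_integral_translate[OF this, of "- (1/2) *\<^sub>R s"]
    show "(LINT x|lborel. ?Psi (s, x)) = (LINT p|lborel. ?Phi (s, p))" by simp
  qed
  also have "\<dots> = (LINT p|lborel. LINT s|lborel. ?Phi (s, p))"
    using lborel_pair.Fubini_integral[of "\<lambda>s p. ?Phi (s, p)"] Phi by simp
  also have "\<dots> = (LINT p|lborel. f p * cnj (coherent z0 p) * (P * cnj (L2_inner g (coherent z0))))"
  proof (rule Bochner_Integration.integral_cong[OF refl])
    fix p :: "real^'n"
    \<comment> \<open>The lag is replaced by the other endpoint p' = p - s, in terms of which
      \<open>coherent_pair\<close> factors the weight.\<close>
    have "(LINT s|lborel. ?Phi (s, p)) = (LINT p'|lborel. ?Phi (p - p', p))"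
    proof -
      have "(\<lambda>s. ?Phi (s, p)) \<in> borel_measurable borel" unfolding m_def prod.case by measurable
      from lborel_integral_scale[OF this, of "-1" p] show ?thesis by simp
    qed
    also have "\<dots> = (LINT p'|lborel. f p * P * (cnj (coherent z0 p) * cnj (g p' * cnj (coherent z0 p'))))"
    proof (rule Bochner_Integration.integral_cong[OF refl])
      fix p' :: "real^'n"
      have "p - (1/2) *\<^sub>R (p - p') = (1/2) *\<^sub>R (p + p')"
      proof -
        have "(h + h) - (h - h') = h + h'" for h h' :: "real^'n" by simp
        from this[of "(1/2) *\<^sub>R p" "(1/2) *\<^sub>R p'"] show ?thesis
          unfolding scaleR_half_double scaleR_diff_right scaleR_add_right .
      qed
      then have "m (p - p', p) = P * (cnj (coherent z0 p) * coherent z0 p')"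
        unfolding P_def coherent_pair[symmetric] m_def prod.case x0_def y0_def by simp
      then show "?Phi (p - p', p) = f p * P * (cnj (coherent z0 p) * cnj (g p' * cnj (coherent z0 p')))"
        by (simp add: mult_ac)
    qed
    also have "\<dots> = f p * P * (cnj (coherent z0 p) * cnj (L2_inner g (coherent z0)))"
      unfolding L2_inner_def Bochner_Integration.integral_cnj[symmetric] by (simp only: integral_mult_right_zero)
    finally show "(LINT s|lborel. ?Phi (s, p)) = f p * cnj (coherent z0 p) * (P * cnj (L2_inner g (coherent z0)))"
      by (simp only: mult_ac)
  qed
  also have "\<dots> = L2_inner f (coherent z0) * (P * cnj (L2_inner g (coherent z0)))"
    by (simp add: L2_inner_def)
  finally have "(LINT z|lborel. ?W (re_part z) (im_part z) * of_real (exp (- (norm (z - z0))\<^sup>2)))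
     = P * (L2_inner f (coherent z0) * (P * cnj (L2_inner g (coherent z0))))" .
  then show ?thesis
    unfolding cross_wigner_core mult.assoc integral_mult_right_zero by (simp add: P_def mult_ac)
qed

section \<open>The free propagator in the Hermite basis\<close>

lemma hermite_integrable: "integrable lborel (hermite \<alpha>)"
proof -
  have "has_bochner_integral lborel (\<lambda>x::real^'a. \<Prod>i\<in>UNIV. hermC (\<alpha> i) (x $ i)) (\<Prod>i\<in>UNIV. LINT y|lborel. hermC (\<alpha> i) y)"
    by (rule lborel_integral_prod_vec) (rule gauss_decay_integrable[OF gauss_decay_herm])
  then show ?thesis by (simp add: hermite_def[abs_def] has_bochner_integral_iff)
qed

lemma hermite_fourier_inverse:
  fixes \<alpha> :: "'n::finite \<Rightarrow> nat"
  shows "of_real ((2 * pi) powr (- real CARD('n) / 2)) * (LINT \<xi>|lborel. exp (- \<i> * of_real (x \<bullet> \<xi>)) * hermite \<alpha> \<xi>)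
     = (- \<i>) ^ (\<Sum>i\<in>UNIV. \<alpha> i) * hermite \<alpha> x"
proof -
  have "(LINT \<xi>|lborel. exp (- \<i> * of_real (x \<bullet> \<xi>)) * hermite \<alpha> \<xi>) = (LINT \<xi>|lborel. cnj (exp (\<i> * of_real (\<xi> \<bullet> x)) * hermite \<alpha> \<xi>))"
    by (simp add: exp_cnj inner_commute)
  also have "\<dots> = cnj (of_real ((2 * pi) powr (real CARD('n) / 2)) * \<i> ^ (\<Sum>i\<in>UNIV. \<alpha> i) * hermite \<alpha> x)"
    unfolding Bochner_Integration.integral_cnj hermite_fourier ..
  also have "\<dots> = of_real ((2 * pi) powr (real CARD('n) / 2)) * ((- \<i>) ^ (\<Sum>i\<in>UNIV. \<alpha> i) * hermite \<alpha> x)"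
    by (simp add: mult.assoc)
  finally have 1: "(LINT \<xi>|lborel. exp (- \<i> * of_real (x \<bullet> \<xi>)) * hermite \<alpha> \<xi>) = of_real ((2 * pi) powr (real CARD('n) / 2)) * ((- \<i>) ^ (\<Sum>i\<in>UNIV. \<alpha> i) * hermite \<alpha> x)" .
  have "(2 * pi) powr (- real CARD('n) / 2) * (2 * pi) powr (real CARD('n) / 2) = (2 * pi) powr (- real CARD('n) / 2 + real CARD('n) / 2)"
    by (rule powr_add[symmetric])
  also have "\<dots> = 1" by simp
  finally have 2: "complex_of_real ((2 * pi) powr (- real CARD('n) / 2)) * of_real ((2 * pi) powr (real CARD('n) / 2)) = 1"
    by (simp only: of_real_mult[symmetric] of_real_1)
  show ?thesis unfolding 1 mult.assoc[symmetric] 2 by simp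
qed

text \<open>The transform is given only as an L2 limit of truncated integrals. Pairing with a
  Hermite function is continuous by Cauchy-Schwarz, so it suffices to compute the pairing for each
  truncation.\<close>

lemma L2_fourier_hcoeff:
  fixes f h :: "('n::finite) fn"
  assumes F: "L2_fourier f h"
  shows "hcoeff h \<alpha> = (- \<i>) ^ (\<Sum>i\<in>UNIV. \<alpha> i) * hcoeff f \<alpha>"
proof -
  have f: "f \<in> L2" and h: "h \<in> L2" using F by (auto simp: L2_fourier_def)
  note [measurable] = f[THEN L2_measurable] h[THEN L2_measurable]
  define c where "c = complex_of_real ((2 * pi) powr (- real CARD('n) / 2))"
  define fR where "fR N x = indicat_real (cball 0 (real N)) x *\<^sub>R f x" for N :: nat and x
  have fRm [measurable]: "fR N \<in> borel_measurable borel" for N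
    unfolding fR_def[abs_def] using L2_measurable[OF f] by (intro borel_measurable_scaleR borel_measurable_indicator) auto
  have fRi: "integrable lborel (fR N)" for N
  proof (rule Bochner_Integration.integrable_bound)
    have "emeasure lborel (cball (0::real^'n) (real N)) < \<infinity>" by (rule emeasure_lborel_cball_finite)
    then show "integrable lborel (\<lambda>x::real^'n. indicat_real (cball 0 (real N)) x + (cmod (f x))\<^sup>2)"
      using L2_square_integrable[OF f] by (intro Bochner_Integration.integrable_add) auto
    show "AE x in lborel. norm (fR N x) \<le> norm (indicat_real (cball 0 (real N)) x + (cmod (f x))\<^sup>2)"
    proof (rule AE_I2)
      fix x :: "real^'n"
      have "t \<le> 1 + t\<^sup>2" if "t \<ge> 0" for t :: real
        using zero_le_power2[of "t - 1/2"] by (simp add: power2_eq_square algebra_simps)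
      from this[of "cmod (f x)"] show "norm (fR N x) \<le> norm (indicat_real (cball 0 (real N)) x + (cmod (f x))\<^sup>2)"
        by (auto simp: fR_def indicator_def)
    qed
  qed measurable
  define G where "G N \<xi> = c * (LINT x|lborel. exp (- \<i> * of_real (x \<bullet> \<xi>)) * fR N x)" for N \<xi>
  have Gm [measurable]: "G N \<in> borel_measurable borel" for N unfolding G_def[abs_def] by measurable
  have lim: "(\<lambda>N. \<integral>\<^sup>+ \<xi>. ennreal ((cmod (h \<xi> - G N \<xi>))\<^sup>2) \<partial>lborel) \<longlonglongrightarrow> 0"
  proof -
    have e: "(LINT x:cball 0 (real N)|lborel. exp (- \<i> * complex_of_real (x \<bullet> \<xi>)) * f x) = (LINT x|lborel. exp (- \<i> * of_real (x \<bullet> \<xi>)) * fR N x)" for N \<xi>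
      unfolding set_lebesgue_integral_def fR_def by (simp only: mult_scaleR_right)
    have "((\<lambda>R. \<integral>\<^sup>+ \<xi>. ennreal ((cmod (h \<xi> - c * (LINT x:cball 0 R|lborel. exp (- \<i> * complex_of_real (x \<bullet> \<xi>)) * f x)))\<^sup>2) \<partial>lborel) \<longlongrightarrow> 0) at_top"
      using F by (simp add: L2_fourier_def c_def)
    from filterlim_compose[OF this filterlim_real_sequentially] show ?thesis unfolding e G_def .
  qed
  \<comment> \<open>Nothing bounds the error for small \<open>N\<close>, where the integral may be
    infinite. Eventually it is below 1, which places the difference in L2 and allows the passage
    from \<open>ennreal\<close> to \<open>L2_norm\<close>.\<close>
  have ev: "\<forall>\<^sub>F N in sequentially. (\<integral>\<^sup>+ \<xi>. ennreal ((cmod (h \<xi> - G N \<xi>))\<^sup>2) \<partial>lborel) < 1"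
    by (rule order_tendstoD(2)[OF lim]) simp
  have dL2: "(\<lambda>\<xi>. h \<xi> - G N \<xi>) \<in> L2" if "(\<integral>\<^sup>+ \<xi>. ennreal ((cmod (h \<xi> - G N \<xi>))\<^sup>2) \<partial>lborel) < 1" for N
  proof (rule L2I)
    show "(\<lambda>\<xi>. h \<xi> - G N \<xi>) \<in> borel_measurable borel" by measurable
    show "integrable lborel (\<lambda>\<xi>. (cmod (h \<xi> - G N \<xi>))\<^sup>2)"
    proof (rule integrableI_bounded)
      show "(\<lambda>\<xi>. (cmod (h \<xi> - G N \<xi>))\<^sup>2) \<in> borel_measurable lborel" by measurable
      show "(\<integral>\<^sup>+ \<xi>. ennreal (norm ((cmod (h \<xi> - G N \<xi>))\<^sup>2)) \<partial>lborel) < \<infinity>"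
        using that by (simp add: less_trans[OF _ ennreal_one_less_top])
    qed
  qed
  have nrm: "ennreal ((L2_norm (\<lambda>\<xi>. h \<xi> - G N \<xi>))\<^sup>2) = (\<integral>\<^sup>+ \<xi>. ennreal ((cmod (h \<xi> - G N \<xi>))\<^sup>2) \<partial>lborel)"
    if "(\<integral>\<^sup>+ \<xi>. ennreal ((cmod (h \<xi> - G N \<xi>))\<^sup>2) \<partial>lborel) < 1" for N
    unfolding L2_norm_power2 using L2_square_integrable[OF dL2[OF that]] by (subst nn_integral_eq_integral) auto
  have "(\<lambda>N. ennreal ((L2_norm (\<lambda>\<xi>. h \<xi> - G N \<xi>))\<^sup>2)) \<longlonglongrightarrow> ennreal 0"
    using lim ev by (subst tendsto_cong[where g="\<lambda>N. \<integral>\<^sup>+ \<xi>. ennreal ((cmod (h \<xi> - G N \<xi>))\<^sup>2) \<partial>lborel"]) (auto elim!: eventually_mono simp: nrm)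
  then have "(\<lambda>N. (L2_norm (\<lambda>\<xi>. h \<xi> - G N \<xi>))\<^sup>2) \<longlonglongrightarrow> 0" by (subst (asm) tendsto_ennreal_iff) auto
  from tendsto_real_sqrt[OF this] have n0: "(\<lambda>N. L2_norm (\<lambda>\<xi>. h \<xi> - G N \<xi>)) \<longlonglongrightarrow> 0" by simp
  \<comment> \<open>Fubini moves the exponential onto the Hermite function, an eigenfunction of the
    Fourier transform. The truncated \<open>fR N\<close> is integrable, so the double integral
    converges absolutely.\<close>
  have inner: "(LINT \<xi>|lborel. G N \<xi> * hermite \<alpha> \<xi>) = (- \<i>) ^ (\<Sum>i\<in>UNIV. \<alpha> i) * (LINT x|lborel. fR N x * hermite \<alpha> x)" for N
  proof -
    let ?F = "\<lambda>(x, \<xi>). exp (- \<i> * of_real (x \<bullet> \<xi>)) * fR N x * hermite \<alpha> \<xi>"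
    have Fm: "?F \<in> borel_measurable (lborel \<Otimes>\<^sub>M lborel)" by measurable
    have n: "norm (?F (x, \<xi>)) = cmod (fR N x) * cmod (hermite \<alpha> \<xi>)" for x \<xi> by (simp add: norm_mult)
    have Fi: "integrable (lborel \<Otimes>\<^sub>M lborel) ?F"
    proof (rule lborel_pair.Fubini_integrable[OF Fm])
      show "integrable lborel (\<lambda>x. LINT \<xi>|lborel. norm (?F (x, \<xi>)))" unfolding n using fRi[of N] by simp
      show "AE x in lborel. integrable lborel (\<lambda>\<xi>. ?F (x, \<xi>))"
      proof (rule AE_I2)
        fix x :: "real^'n"
        show "integrable lborel (\<lambda>\<xi>. ?F (x, \<xi>))"
        proof (rule Bochner_Integration.integrable_bound)
          show "integrable lborel (\<lambda>\<xi>. cmod (fR N x) * cmod (hermite \<alpha> \<xi>))" using hermite_integrable[of \<alpha>] by simp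
          show "(\<lambda>\<xi>. ?F (x, \<xi>)) \<in> borel_measurable lborel" by (rule measurable_compose[OF measurable_Pair1' Fm]) simp
        qed (use n in auto)
      qed
    qed
    have "(LINT \<xi>|lborel. G N \<xi> * hermite \<alpha> \<xi>) = c * (LINT \<xi>|lborel. LINT x|lborel. ?F (x, \<xi>))"
      unfolding G_def prod.case mult.assoc by (simp flip: integral_mult_left_zero integral_mult_right_zero add: mult.assoc)
    also have "(LINT \<xi>|lborel. LINT x|lborel. ?F (x, \<xi>)) = (LINT x|lborel. LINT \<xi>|lborel. ?F (x, \<xi>))"
      using lborel_pair.Fubini_integral[of "\<lambda>x \<xi>. ?F (x, \<xi>)"] Fi by simp
    also have "c * \<dots> = (LINT x|lborel. c * (LINT \<xi>|lborel. ?F (x, \<xi>)))" by (rule integral_mult_right_zero[symmetric])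
    also have "\<dots> = (LINT x|lborel. (- \<i>) ^ (\<Sum>i\<in>UNIV. \<alpha> i) * (fR N x * hermite \<alpha> x))"
    proof (rule Bochner_Integration.integral_cong[OF refl])
      fix x :: "real^'n"
      have "(LINT \<xi>|lborel. ?F (x, \<xi>)) = fR N x * (LINT \<xi>|lborel. exp (- \<i> * of_real (x \<bullet> \<xi>)) * hermite \<alpha> \<xi>)"
        unfolding integral_mult_right_zero[symmetric] prod.case by (simp only: mult_ac)
      then have "c * (LINT \<xi>|lborel. ?F (x, \<xi>)) = fR N x * (c * (LINT \<xi>|lborel. exp (- \<i> * of_real (x \<bullet> \<xi>)) * hermite \<alpha> \<xi>))"
        by (simp only: mult_ac)
      then show "c * (LINT \<xi>|lborel. ?F (x, \<xi>)) = (- \<i>) ^ (\<Sum>i\<in>UNIV. \<alpha> i) * (fR N x * hermite \<alpha> x)"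
        unfolding c_def hermite_fourier_inverse by (simp only: mult_ac)
    qed
    finally show ?thesis by (simp only: integral_mult_right_zero)
  qed
  have flim: "(\<lambda>N. LINT x|lborel. fR N x * hermite \<alpha> x) \<longlonglongrightarrow> (LINT x|lborel. f x * hermite \<alpha> x)"
  proof (rule integral_dominated_convergence[where w="\<lambda>x. cmod (f x * hermite \<alpha> x)"])
    show "integrable lborel (\<lambda>x. cmod (f x * hermite \<alpha> x))" using L2_mult_integrable[OF f hermite_L2] by (rule integrable_norm)
    show "AE x in lborel. (\<lambda>N. fR N x * hermite \<alpha> x) \<longlonglongrightarrow> f x * hermite \<alpha> x"
    proof (rule AE_I2)
      fix x :: "real^'n"
      have "eventually (\<lambda>N. real N \<ge> norm x) sequentially"
        by (rule filterlim_real_sequentially[unfolded filterlim_at_top, rule_format])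
      then have "eventually (\<lambda>N. fR N x * hermite \<alpha> x = f x * hermite \<alpha> x) sequentially"
        by eventually_elim (simp add: fR_def)
      then show "(\<lambda>N. fR N x * hermite \<alpha> x) \<longlonglongrightarrow> f x * hermite \<alpha> x" by (rule tendsto_eventually)
    qed
    show "AE x in lborel. cmod (fR N x * hermite \<alpha> x) \<le> cmod (f x * hermite \<alpha> x)" for N
      by (auto simp: fR_def indicator_def norm_mult)
  qed measurable
  have 1: "(\<lambda>N. LINT \<xi>|lborel. G N \<xi> * hermite \<alpha> \<xi>) \<longlonglongrightarrow> (- \<i>) ^ (\<Sum>i\<in>UNIV. \<alpha> i) * hcoeff f \<alpha>"
    unfolding inner hcoeff_def L2_inner_def cnj_hermite by (intro tendsto_intros flim)
  have "(\<lambda>N. hcoeff h \<alpha> - (LINT \<xi>|lborel. G N \<xi> * hermite \<alpha> \<xi>)) \<longlonglongrightarrow> 0"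
  proof (rule Lim_null_comparison)
    show "(\<lambda>N. L2_norm (\<lambda>\<xi>. h \<xi> - G N \<xi>) * L2_norm (hermite \<alpha>)) \<longlonglongrightarrow> 0" by (rule tendsto_mult_left_zero[OF n0])
    show "\<forall>\<^sub>F N in sequentially. norm (hcoeff h \<alpha> - (LINT \<xi>|lborel. G N \<xi> * hermite \<alpha> \<xi>)) \<le> L2_norm (\<lambda>\<xi>. h \<xi> - G N \<xi>) * L2_norm (hermite \<alpha>)"
      using ev
    proof eventually_elim
      case (elim N)
      have "G N = (\<lambda>\<xi>. h \<xi> - (h \<xi> - G N \<xi>))" by auto
      then have GL: "G N \<in> L2" using L2_diff[OF h dL2[OF elim]] by simp
      have "hcoeff h \<alpha> - (LINT \<xi>|lborel. G N \<xi> * hermite \<alpha> \<xi>) = L2_inner (\<lambda>\<xi>. h \<xi> - G N \<xi>) (hermite \<alpha>)"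
        using L2_inner_diff_left[OF h GL hermite_L2] by (simp add: hcoeff_def L2_inner_def)
      then show ?case using L2_cauchy_schwarz[OF dL2[OF elim] hermite_L2] by simp
    qed
  qed
  from tendsto_diff[OF tendsto_const[of "hcoeff h \<alpha>"] this]
  have "(\<lambda>N. LINT \<xi>|lborel. G N \<xi> * hermite \<alpha> \<xi>) \<longlonglongrightarrow> hcoeff h \<alpha>" by simp
  from LIMSEQ_unique[OF this 1] show ?thesis .
qed

text \<open>The matrix element of the propagator between two Hermite functions, computed on the
  Fourier side; the powers of -\<i> are the Fourier eigenvalues.\<close>

definition schroedinger_coeff :: "real \<Rightarrow> ('n::finite \<Rightarrow> nat) \<Rightarrow> ('n \<Rightarrow> nat) \<Rightarrow> complex" where
  "schroedinger_coeff t \<alpha> \<beta> = (- \<i>) ^ (\<Sum>i\<in>UNIV. \<alpha> i) * cnj ((- \<i>) ^ (\<Sum>i\<in>UNIV. \<beta> i)) *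
     (LINT x|lborel. exp (- \<i> * of_real (t * (norm x)\<^sup>2)) * hermite \<alpha> x * cnj (hermite \<beta> x))"

lemma schroedinger_coeff_bound:
  fixes \<alpha> \<beta> :: "'n::finite \<Rightarrow> nat"
  shows "cmod (schroedinger_coeff t \<alpha> \<beta>) \<le> (1 + t\<^sup>2) powr (- real CARD('n) / 4)"
  unfolding schroedinger_coeff_def norm_mult complex_mod_cnj norm_power norm_minus_cancel norm_ii power_one mult_1
  by (rule hermite_chirp_bound)

lemma L2_chirp:
  assumes "f \<in> L2"
  shows "(\<lambda>x. exp (- \<i> * of_real (t * (norm x)\<^sup>2)) * f x) \<in> L2"
    and "L2_norm (\<lambda>x. exp (- \<i> * of_real (t * (norm x)\<^sup>2)) * f x) = L2_norm f"
proof -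
  note [measurable] = L2_measurable[OF assms]
  have n: "cmod (exp (- \<i> * of_real (t * (norm x)\<^sup>2)) * f x) = cmod (f x)" for x by (simp add: norm_mult)
  show "(\<lambda>x. exp (- \<i> * of_real (t * (norm x)\<^sup>2)) * f x) \<in> L2"
    by (rule L2I) (measurable, unfold n, rule L2_square_integrable[OF assms])
  show "L2_norm (\<lambda>x. exp (- \<i> * of_real (t * (norm x)\<^sup>2)) * f x) = L2_norm f"
    unfolding L2_norm_def n ..
qed

lemma L2_chirp_inner_le:
  assumes "f \<in> L2" "g \<in> L2"
  shows "cmod (L2_inner (\<lambda>x. exp (- \<i> * of_real (t * (norm x)\<^sup>2)) * f x) g) \<le> L2_norm f * L2_norm g"
  using L2_cauchy_schwarz[OF L2_chirp(1)[OF assms(1), where t=t] assms(2)] unfolding L2_chirp(2)[OF assms(1), where t=t] .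

lemma phase_cancel: "(- \<i>) ^ k * a * cnj ((- \<i>) ^ k * b) = a * cnj b"
proof -
  have "(- \<i>) ^ k * cnj ((- \<i>) ^ k) = of_real ((cmod ((- \<i>) ^ k))\<^sup>2)" by (rule complex_norm_square[symmetric])
  also have "\<dots> = 1" by (simp add: norm_power)
  finally have "(- \<i>) ^ k * cnj ((- \<i>) ^ k) = 1" .
  moreover have "(- \<i>) ^ k * a * cnj ((- \<i>) ^ k * b) = ((- \<i>) ^ k * cnj ((- \<i>) ^ k)) * (a * cnj b)"
    by (simp only: complex_cnj_mult mult_ac)
  ultimately show ?thesis by (simp only: mult_1)
qed

text \<open>The truncated sums are inner products of projections on the Fourier side, where the
  propagator is a multiplication of modulus 1. The second conclusion, uniform in \<open>N\<close>,
  supplies the dominating constant for the average over the group.\<close>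

lemma schroedinger_expansion:
  fixes f g :: "('n::finite) fn"
  assumes U: "free_schroedinger_propagator U" and f: "f \<in> L2" and g: "g \<in> L2"
  shows "(\<lambda>N. \<Sum>\<alpha>\<in>cube N. \<Sum>\<beta>\<in>cube N. hcoeff f \<alpha> * cnj (hcoeff g \<beta>) * schroedinger_coeff t \<alpha> \<beta>) \<longlonglongrightarrow> L2_inner (U t f) g"
    and "cmod (\<Sum>\<alpha>\<in>cube N. \<Sum>\<beta>\<in>cube N. hcoeff f \<alpha> * cnj (hcoeff g \<beta>) * schroedinger_coeff t \<alpha> \<beta>) \<le> L2_norm f * L2_norm g"
proof -
  let ?E = "\<lambda>h x. exp (- \<i> * of_real (t * (norm x)\<^sup>2)) * h x"
  obtain fh where fh: "L2_fourier f fh" and Uf: "L2_fourier (U t f) (?E fh)"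
    using U f unfolding free_schroedinger_propagator_def by blast
  obtain gh where gh: "L2_fourier g gh"
    using U g unfolding free_schroedinger_propagator_def by blast
  have L: "fh \<in> L2" "gh \<in> L2" "U t f \<in> L2" using fh gh Uf by (auto simp: L2_fourier_def)
  note cf = L2_fourier_hcoeff[OF fh] and cg = L2_fourier_hcoeff[OF gh] and cU = L2_fourier_hcoeff[OF Uf]
  have "(\<lambda>N. \<Sum>\<alpha>\<in>cube N. hcoeff (?E fh) \<alpha> * cnj (hcoeff gh \<alpha>)) \<longlonglongrightarrow> L2_inner (?E fh) gh"
    by (rule hcoeff_parseval_inner[OF L2_chirp(1)[OF L(1)] L(2)])
  moreover have "(\<lambda>N. \<Sum>\<alpha>\<in>cube N. hcoeff (?E fh) \<alpha> * cnj (hcoeff gh \<alpha>)) \<longlonglongrightarrow> L2_inner (U t f) g"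
    unfolding cU cg phase_cancel by (rule hcoeff_parseval_inner[OF L(3) g])
  \<comment> \<open>The same partial sums are read in two ways: as Parseval sums of the transforms,
    and, after the Fourier eigenvalues cancel, as Parseval sums of the original functions.\<close>
  ultimately have eq: "L2_inner (U t f) g = L2_inner (?E fh) gh" by (rule LIMSEQ_unique[symmetric])
  have S: "(\<Sum>\<alpha>\<in>cube N. \<Sum>\<beta>\<in>cube N. hcoeff f \<alpha> * cnj (hcoeff g \<beta>) * schroedinger_coeff t \<alpha> \<beta>) = L2_inner (?E (hproj N fh)) (hproj N gh)" for N
  proof -
    have "L2_inner (?E (hproj N fh)) (hproj N gh) = (\<Sum>\<beta>\<in>cube N. cnj (hcoeff gh \<beta>) * L2_inner (?E (hproj N fh)) (hermite \<beta>))"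
    proof -
      have "hproj N gh = (\<lambda>x. \<Sum>\<beta>\<in>cube N. hcoeff gh \<beta> * hermite \<beta> x)" by (auto simp: hproj_def)
      then have "L2_inner (?E (hproj N fh)) (hproj N gh) = L2_inner (?E (hproj N fh)) (\<lambda>x. \<Sum>\<beta>\<in>cube N. hcoeff gh \<beta> * hermite \<beta> x)" by simp
      then show ?thesis
        by (simp only: L2_inner_sum_right[OF finite_cube L2_cmult[OF hermite_L2] L2_chirp(1)[OF hproj_L2]] L2_inner_cmult_right)
    qed
    also have "\<dots> = (\<Sum>\<beta>\<in>cube N. cnj (hcoeff gh \<beta>) * (\<Sum>\<alpha>\<in>cube N. hcoeff fh \<alpha> * L2_inner (?E (hermite \<alpha>)) (hermite \<beta>)))"
    proof (rule sum.cong[OF refl])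
      fix \<beta>
      have "?E (hproj N fh) = (\<lambda>x. \<Sum>\<alpha>\<in>cube N. hcoeff fh \<alpha> * ?E (hermite \<alpha>) x)"
        unfolding hproj_def sum_distrib_left by (simp only: mult_ac)
      then have "L2_inner (?E (hproj N fh)) (hermite \<beta>) = L2_inner (\<lambda>x. \<Sum>\<alpha>\<in>cube N. hcoeff fh \<alpha> * ?E (hermite \<alpha>) x) (hermite \<beta>)" by simp
      also have "\<dots> = (\<Sum>\<alpha>\<in>cube N. L2_inner (\<lambda>x. hcoeff fh \<alpha> * ?E (hermite \<alpha>) x) (hermite \<beta>))"
        by (rule L2_inner_sum_left[OF finite_cube L2_cmult[OF L2_chirp(1)[OF hermite_L2]] hermite_L2])
      also have "\<dots> = (\<Sum>\<alpha>\<in>cube N. hcoeff fh \<alpha> * L2_inner (?E (hermite \<alpha>)) (hermite \<beta>))"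
        by (simp only: L2_inner_cmult_left)
      finally show "cnj (hcoeff gh \<beta>) * L2_inner (?E (hproj N fh)) (hermite \<beta>) = cnj (hcoeff gh \<beta>) * (\<Sum>\<alpha>\<in>cube N. hcoeff fh \<alpha> * L2_inner (?E (hermite \<alpha>)) (hermite \<beta>))"
        by simp
    qed
    also have "\<dots> = (\<Sum>\<beta>\<in>cube N. \<Sum>\<alpha>\<in>cube N. hcoeff f \<alpha> * cnj (hcoeff g \<beta>) * schroedinger_coeff t \<alpha> \<beta>)"
    proof -
      have "cnj (q * b) * (p * a * v) = a * cnj b * (p * cnj q * v)" for a b p q v :: complex
        by (simp only: complex_cnj_mult mult_ac)
      then show ?thesis
        unfolding sum_distrib_left cf cg L2_inner_def schroedinger_coeff_def by (simp only:)
    qed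
    also have "\<dots> = (\<Sum>\<alpha>\<in>cube N. \<Sum>\<beta>\<in>cube N. hcoeff f \<alpha> * cnj (hcoeff g \<beta>) * schroedinger_coeff t \<alpha> \<beta>)"
      by (rule sum.swap)
    finally show ?thesis by simp
  qed
  have pn: "L2_norm (hproj N h) \<le> L2_norm h" if "h \<in> L2" for h :: "'n fn" and N
    using hcoeff_bessel[OF that, of N] unfolding hproj_norm[symmetric] by (rule power2_le_imp_le) simp
  have nf: "L2_norm (hproj N fh) \<le> L2_norm f" and ng: "L2_norm (hproj N gh) \<le> L2_norm g" for N
  proof -
    have "(L2_norm (hproj N fh))\<^sup>2 = (L2_norm (hproj N f))\<^sup>2" "(L2_norm (hproj N gh))\<^sup>2 = (L2_norm (hproj N g))\<^sup>2"
      unfolding hproj_norm cf cg by (simp_all add: norm_mult norm_power)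
    then have "L2_norm (hproj N fh) = L2_norm (hproj N f)" "L2_norm (hproj N gh) = L2_norm (hproj N g)" by simp_all
    then show "L2_norm (hproj N fh) \<le> L2_norm f" "L2_norm (hproj N gh) \<le> L2_norm g" using pn f g by simp_all
  qed
  show "cmod (\<Sum>\<alpha>\<in>cube N. \<Sum>\<beta>\<in>cube N. hcoeff f \<alpha> * cnj (hcoeff g \<beta>) * schroedinger_coeff t \<alpha> \<beta>) \<le> L2_norm f * L2_norm g" for N
  proof -
    have "cmod (L2_inner (?E (hproj N fh)) (hproj N gh)) \<le> L2_norm (hproj N fh) * L2_norm (hproj N gh)"
      by (rule L2_chirp_inner_le[OF hproj_L2 hproj_L2])
    also have "\<dots> \<le> L2_norm f * L2_norm g" by (intro mult_mono nf ng) auto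
    finally show ?thesis unfolding S .
  qed
  \<comment> \<open>Both arguments are truncated, so the error is split into two terms with one
    difference each; the multiplier preserves norms and leaves no trace in the bound.\<close>
  have c: "(\<lambda>N. L2_norm (\<lambda>x. fh x - hproj N fh x) * L2_norm gh + L2_norm f * L2_norm (\<lambda>x. gh x - hproj N gh x)) \<longlonglongrightarrow> 0 * L2_norm gh + L2_norm f * 0"
    by (intro tendsto_intros hproj_tendsto L)
  have "(\<lambda>N. L2_inner (?E fh) gh - L2_inner (?E (hproj N fh)) (hproj N gh)) \<longlonglongrightarrow> 0"
  proof (rule Lim_null_comparison[OF always_eventually c[simplified]], rule allI)
    fix N
    let ?d = "\<lambda>x. fh x - hproj N fh x" and ?e = "\<lambda>x. gh x - hproj N gh x"
    have dL: "?d \<in> L2" "?e \<in> L2" using L by (auto intro: L2_diff)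
    have dec: "L2_inner (?E fh) gh - L2_inner (?E (hproj N fh)) (hproj N gh) = L2_inner (?E ?d) gh + L2_inner (?E (hproj N fh)) ?e"
    proof -
      have "L2_inner (?E ?d) gh = L2_inner (?E fh) gh - L2_inner (?E (hproj N fh)) gh"
        unfolding right_diff_distrib by (rule L2_inner_diff_left[OF L2_chirp(1)[OF L(1)] L2_chirp(1)[OF hproj_L2] L(2)])
      moreover have "L2_inner (?E (hproj N fh)) ?e = L2_inner (?E (hproj N fh)) gh - L2_inner (?E (hproj N fh)) (hproj N gh)"
        by (rule L2_inner_diff_right[OF L(2) hproj_L2 L2_chirp(1)[OF hproj_L2]])
      ultimately show ?thesis by simp
    qed
    have "norm (L2_inner (?E fh) gh - L2_inner (?E (hproj N fh)) (hproj N gh)) \<le> cmod (L2_inner (?E ?d) gh) + cmod (L2_inner (?E (hproj N fh)) ?e)"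
      unfolding dec by (rule norm_triangle_ineq)
    also have "\<dots> \<le> L2_norm ?d * L2_norm gh + L2_norm (hproj N fh) * L2_norm ?e"
      by (rule add_mono[OF L2_chirp_inner_le[OF dL(1) L(2)] L2_chirp_inner_le[OF hproj_L2 dL(2)]])
    also have "\<dots> \<le> L2_norm ?d * L2_norm gh + L2_norm f * L2_norm ?e"
      by (rule add_left_mono[OF mult_right_mono[OF nf L2_norm_nonneg]])
    finally show "norm (L2_inner (?E fh) gh - L2_inner (?E (hproj N fh)) (hproj N gh)) \<le> L2_norm ?d * L2_norm gh + L2_norm f * L2_norm ?e" .
  qed
  from tendsto_diff[OF tendsto_const[of "L2_inner (?E fh) gh"] this]
  show "(\<lambda>N. \<Sum>\<alpha>\<in>cube N. \<Sum>\<beta>\<in>cube N. hcoeff f \<alpha> * cnj (hcoeff g \<beta>) * schroedinger_coeff t \<alpha> \<beta>) \<longlonglongrightarrow> L2_inner (U t f) g"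
    unfolding S eq by simp
qed

section \<open>The maximal compact subgroup\<close>

lemma orthogonal_matrix_cancel:
  assumes "orthogonal_matrix (k :: real^'m^'m)"
  shows "transpose k *v (k *v x) = x" "k *v (transpose k *v x) = x"
  using assms unfolding orthogonal_matrix_def matrix_vector_mul_assoc by (simp_all only: matrix_vector_mul_lid)

lemma orthogonal_matrix_norm:
  assumes "orthogonal_matrix (k :: real^'m^'m)"
  shows "norm (k *v x) = norm x"
proof -
  have "(k *v x) \<bullet> (k *v x) = (transpose k *v (k *v x)) \<bullet> x"
    by (simp add: dot_lmul_matrix[symmetric] inner_commute vector_transpose_matrix)
  then show ?thesis using orthogonal_matrix_cancel(1)[OF assms] by (simp add: norm_eq_sqrt_inner)
qed

lemma matrix_vector_mult_measurable [measurable]: "(\<lambda>x. (k :: real^'m^'n) *v x) \<in> borel_measurable borel"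
  by (intro borel_measurable_continuous_onI linear_continuous_on matrix_vector_mul_bounded_linear)

text \<open>Uniqueness of translation invariant measures, proved by testing against a Gaussian, which is invariant under \<^term>\<open>k\<close>.\<close>

lemma nn_integral_orthogonal_matrix:
  fixes F :: "real^'m::finite \<Rightarrow> ennreal"
  assumes k: "orthogonal_matrix (k :: real^'m^'m)" and F: "F \<in> borel_measurable borel"
  shows "(\<integral>\<^sup>+ x. F (k *v x) \<partial>lborel) = (\<integral>\<^sup>+ x. F x \<partial>lborel)"
proof -
  note [measurable] = F
  define w where "w x = ennreal (exp (- 1 * (norm x)\<^sup>2))" for x :: "real^'m"
  have [measurable]: "w \<in> borel_measurable borel" unfolding w_def[abs_def] by measurable
  have wm: "w (- x) = w x" for x by (simp add: w_def)
  have wk: "w (k *v x) = w x" for x by (simp add: w_def orthogonal_matrix_norm[OF k])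
  have tr: "(\<integral>\<^sup>+ x. G (x - v) \<partial>lborel) = (\<integral>\<^sup>+ x. G x \<partial>lborel)" if [measurable]: "G \<in> borel_measurable borel" for G :: "real^'m \<Rightarrow> ennreal" and v
    by (subst lborel_distr_translate[of v, symmetric], subst nn_integral_distr) auto
  define W where "W = (\<integral>\<^sup>+ x. w x \<partial>lborel)"
  have W: "W = ennreal (pi powr (real CARD('m) / 2))"
    unfolding W_def w_def using gauss_integral_vec[of 1, where 'n='m]
    by (subst nn_integral_eq_integral) (auto simp: has_bochner_integral_iff)
  \<comment> \<open>Translating \<open>x\<close> by \<open>transpose k *v y\<close> shifts the
    argument \<open>k *v x\<close> by \<open>y\<close>. The left side is therefore the same for
    every \<open>y\<close> and can be averaged against \<open>w\<close>.\<close>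
  have 1: "(\<integral>\<^sup>+ x. F (k *v x) \<partial>lborel) = (\<integral>\<^sup>+ x. F (k *v x + y) \<partial>lborel)" for y
  proof -
    have e: "k *v (x - (- (transpose k *v y))) = k *v x + y" for x
      by (simp only: matrix_vector_right_distrib diff_minus_eq_add orthogonal_matrix_cancel(2)[OF k])
    have "(\<lambda>x. F (k *v x)) \<in> borel_measurable borel" by measurable
    from tr[OF this, of "- (transpose k *v y)"] show ?thesis unfolding e by (rule sym)
  qed
  have "(\<integral>\<^sup>+ x. F (k *v x) \<partial>lborel) * W = (\<integral>\<^sup>+ y. (\<integral>\<^sup>+ x. F (k *v x) \<partial>lborel) * w y \<partial>lborel)"
    unfolding W_def by (subst nn_integral_cmult) auto
  also have "\<dots> = (\<integral>\<^sup>+ y. \<integral>\<^sup>+ x. F (k *v x + y) * w y \<partial>lborel \<partial>lborel)"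
    using 1 by (subst nn_integral_multc) auto
  also have "\<dots> = (\<integral>\<^sup>+ x. \<integral>\<^sup>+ y. F (k *v x + y) * w y \<partial>lborel \<partial>lborel)"
    by (rule lborel_pair.Fubini') measurable
  also have "\<dots> = (\<integral>\<^sup>+ x. \<integral>\<^sup>+ y. F y * w (y - k *v x) \<partial>lborel \<partial>lborel)"
  proof (rule nn_integral_cong)
    fix x
    show "(\<integral>\<^sup>+ y. F (k *v x + y) * w y \<partial>lborel) = (\<integral>\<^sup>+ y. F y * w (y - k *v x) \<partial>lborel)"
      using tr[of "\<lambda>y. F (k *v x + y) * w y" "k *v x"] by simp
  qed
  also have "\<dots> = (\<integral>\<^sup>+ y. \<integral>\<^sup>+ x. F y * w (y - k *v x) \<partial>lborel \<partial>lborel)"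
    by (rule lborel_pair.Fubini') measurable
  also have "\<dots> = (\<integral>\<^sup>+ y. F y * W \<partial>lborel)"
  proof (rule nn_integral_cong)
    fix y
    \<comment> \<open>Evenness and invariance of the Gaussian move the matrix from the variable of
      integration to \<open>y\<close>, where a translation removes it.\<close>
    have "w (y - k *v x) = w (x - transpose k *v y)" for x
    proof -
      have "w (y - k *v x) = w (k *v (x - transpose k *v y))"
        unfolding matrix_vector_mult_diff_distrib orthogonal_matrix_cancel(2)[OF k] by (metis minus_diff_eq wm)
      then show ?thesis by (simp only: wk)
    qed
    then have "(\<integral>\<^sup>+ x. F y * w (y - k *v x) \<partial>lborel) = F y * (\<integral>\<^sup>+ x. w (x - transpose k *v y) \<partial>lborel)"
      by (simp add: nn_integral_cmult)
    then show "(\<integral>\<^sup>+ x. F y * w (y - k *v x) \<partial>lborel) = F y * W" by (simp add: tr W_def)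
  qed
  also have "\<dots> = (\<integral>\<^sup>+ y. F y \<partial>lborel) * W" by (rule nn_integral_multc) measurable
  finally have "(\<integral>\<^sup>+ x. F (k *v x) \<partial>lborel) * W = (\<integral>\<^sup>+ y. F y \<partial>lborel) * W" .
  then show ?thesis unfolding W mult_right_ennreal_cancel by (simp add: not_le)
qed

lemma distr_orthogonal_matrix:
  assumes k: "orthogonal_matrix (k :: real^'m::finite^'m)"
  shows "distr lborel borel (\<lambda>x. k *v x) = lborel"
proof (rule measure_eqI)
  fix A assume "A \<in> sets (distr lborel borel (\<lambda>x. k *v x))"
  then have [measurable]: "A \<in> sets borel" by simp
  have "emeasure (distr lborel borel (\<lambda>x. k *v x)) A = (\<integral>\<^sup>+ x. indicator A x \<partial>(distr lborel borel (\<lambda>x. k *v x)))" by simp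
  also have "\<dots> = (\<integral>\<^sup>+ x. indicator A (k *v x) \<partial>lborel)" by (rule nn_integral_distr) measurable
  also have "\<dots> = (\<integral>\<^sup>+ x. indicator A x \<partial>lborel)" by (rule nn_integral_orthogonal_matrix[OF k]) measurable
  finally show "emeasure (distr lborel borel (\<lambda>x. k *v x)) A = emeasure lborel A" by simp
qed simp

lemma lborel_integral_orthogonal_matrix:
  fixes F :: "real^'m::finite \<Rightarrow> complex"
  assumes "orthogonal_matrix (k :: real^'m^'m)" "F \<in> borel_measurable borel"
  shows "(LINT x|lborel. F (k *v x)) = (LINT x|lborel. F x)"
  using integral_distr[of "\<lambda>x. k *v x" lborel borel F] assms(2) by (simp add: distr_orthogonal_matrix[OF assms(1)])

section \<open>The action of the compact subgroup on coherent state coefficients\<close>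

lemma Sp_K_orthogonal: "k \<in> Sp_K \<Longrightarrow> orthogonal_matrix k"
  by (simp add: Sp_K_def)

lemma Sp_K_Sp: "k \<in> Sp_K \<Longrightarrow> k \<in> Sp"
  by (simp add: Sp_K_def)

lemma orthogonal_matrix_inv:
  assumes "orthogonal_matrix (k :: real^'m^'m)"
  shows "matrix_inv k = transpose k"
proof -
  have "\<exists>B. k ** B = mat 1 \<and> B ** k = mat 1"
    using assms unfolding orthogonal_matrix_def by blast
  then have "k ** matrix_inv k = mat 1" unfolding matrix_inv_def by (rule someI2_ex) blast
  then have "transpose k ** (k ** matrix_inv k) = transpose k" by simp
  then show ?thesis using assms by (simp add: matrix_mul_assoc orthogonal_matrix_def)
qed

lemma Sp_K_mult:
  assumes "k \<in> Sp_K" "l \<in> Sp_K"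
  shows "k ** l \<in> Sp_K"
proof -
  have "orthogonal_matrix (k ** l)"
    using assms[THEN Sp_K_orthogonal] unfolding orthogonal_matrix
    by (simp add: matrix_transpose_mul) (metis matrix_mul_assoc matrix_mul_lid)
  moreover have "transpose (k ** l) ** sympl_J ** (k ** l) = transpose l ** (transpose k ** sympl_J ** k) ** l"
    by (simp add: matrix_transpose_mul matrix_mul_assoc)
  ultimately show ?thesis using assms by (simp add: Sp_K_def Sp_def)
qed

text \<open>The Gaussian weight depends only on a distance, so the orthogonal change of variables
  carries smoothing about \<open>z0\<close> to smoothing about
  \<open>transpose k *v z0\<close>.\<close>

lemma coherent_covariance:
  fixes f g :: "('n::finite) fn"
  assumes \<rho>: "metaplectic_rep \<rho>" and k: "k \<in> Sp_K" and f: "f \<in> L2" and g: "g \<in> L2"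
  shows "L2_inner (\<rho> k f) (coherent z0) * cnj (L2_inner (\<rho> k g) (coherent z0))
    = L2_inner f (coherent (transpose k *v z0)) * cnj (L2_inner g (coherent (transpose k *v z0)))"
proof -
  note [measurable] = f[THEN L2_measurable] g[THEN L2_measurable]
  have kS: "k \<in> Sp" and ko: "orthogonal_matrix k" using k by (auto simp: Sp_K_def)
  have kt: "orthogonal_matrix (transpose k)" using ko by simp
  have L: "\<rho> k f \<in> L2" "\<rho> k g \<in> L2" using \<rho> kS f g unfolding metaplectic_rep_def unitary_L2_def by auto
  have W: "cross_wigner (\<rho> k f) (\<rho> k g) z = cross_wigner f g (transpose k *v z)" for z
    using \<rho> kS f g orthogonal_matrix_inv[OF ko] unfolding metaplectic_rep_def by auto
  define F where "F z = cross_wigner f g z * of_real (exp (- (norm (z - transpose k *v z0))\<^sup>2))" for z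
  have Fm: "F \<in> borel_measurable borel" unfolding F_def[abs_def] cross_wigner_def by measurable
  define C where "C = complex_of_real ((2 * pi) powr (- real CARD('n) / 2) * pi powr (real CARD('n) / 2) * pi powr (real CARD('n) / 2))"
  have C: "C \<noteq> 0" by (simp add: C_def)
  have "C * (L2_inner (\<rho> k f) (coherent z0) * cnj (L2_inner (\<rho> k g) (coherent z0)))
    = (LINT z|lborel. cross_wigner f g (transpose k *v z) * of_real (exp (- (norm (z - z0))\<^sup>2)))"
    unfolding C_def husimi_wigner[OF L, symmetric] W ..
  also have "\<dots> = (LINT z|lborel. F (transpose k *v z))"
    unfolding F_def matrix_vector_mult_diff_distrib[symmetric] orthogonal_matrix_norm[OF kt] ..
  also have "\<dots> = (LINT z|lborel. F z)" by (rule lborel_integral_orthogonal_matrix[OF kt Fm])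
  also have "\<dots> = C * (L2_inner f (coherent (transpose k *v z0)) * cnj (L2_inner g (coherent (transpose k *v z0))))"
    unfolding C_def husimi_wigner[OF f g, symmetric] F_def ..
  finally show ?thesis using C by simp
qed

text \<open>The Gaussian ground state. Its coherent state coefficients are radial and vanish
  nowhere, which makes it the reference vector for fixing phases.\<close>

definition vac :: "('n::finite) fn" where
  "vac = hermite (\<lambda>_. 0)"

lemma vac_L2 [simp]: "vac \<in> L2"
  by (simp add: vac_def)

lemma vac_coherent: "L2_inner vac (coherent z) = of_real (exp (- (norm z)\<^sup>2 / 4))"
proof -
  have "L2_inner (coherent z) vac = exp (- of_real ((norm z)\<^sup>2) / 4)"
    using coherent_hermite[of z "\<lambda>_. 0"] by (simp add: L2_inner_def vac_def has_bochner_integral_iff)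
  also have "\<dots> = of_real (exp (- (norm z)\<^sup>2 / 4))" by (simp add: exp_of_real[symmetric])
  finally have "cnj (L2_inner (coherent z) vac) = of_real (exp (- (norm z)\<^sup>2 / 4))" by simp
  then show ?thesis by (simp only: L2_inner_cnj)
qed

text \<open>This is the scalar c with \<rho> k vac = c vac almost everywhere, as the proof of
  \<open>metaplectic_coherent\<close> shows.\<close>

definition phase :: "(('n::finite) sqmat \<Rightarrow> 'n fn \<Rightarrow> 'n fn) \<Rightarrow> 'n sqmat \<Rightarrow> complex" where
  "phase \<rho> k = L2_inner (\<rho> k vac) vac"

lemma metaplectic_L2: "metaplectic_rep \<rho> \<Longrightarrow> k \<in> Sp_K \<Longrightarrow> f \<in> L2 \<Longrightarrow> \<rho> k f \<in> L2"
  using Sp_K_Sp unfolding metaplectic_rep_def unitary_L2_def by blast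

lemma metaplectic_inner: "metaplectic_rep \<rho> \<Longrightarrow> k \<in> Sp_K \<Longrightarrow> f \<in> L2 \<Longrightarrow> g \<in> L2 \<Longrightarrow> L2_inner (\<rho> k f) (\<rho> k g) = L2_inner f g"
  using Sp_K_Sp unfolding metaplectic_rep_def unitary_L2_def by blast

lemma metaplectic_norm:
  assumes "metaplectic_rep \<rho>" "k \<in> Sp_K" "f \<in> L2"
  shows "L2_norm (\<rho> k f) = L2_norm f"
proof -
  have "(L2_norm (\<rho> k f))\<^sup>2 = (L2_norm f)\<^sup>2"
    using metaplectic_inner[OF assms assms(3)] unfolding L2_inner_self of_real_eq_iff .
  then show ?thesis by simp
qed

lemma vac_inner: "L2_inner vac vac = 1"
  by (simp add: vac_def hermite_inner)

lemma vac_norm: "L2_norm vac = 1"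
proof -
  note vac_inner
  then have "(L2_norm vac)\<^sup>2 = 1" unfolding L2_inner_self by (simp only: of_real_eq_1_iff)
  then show ?thesis by (metis L2_norm_nonneg power2_eq_1_iff neg_0_le_iff_le not_one_le_zero)
qed

lemma coherent_zero: "coherent 0 = vac"
  by (auto simp: vac_def coherent_0)

text \<open>The origin of phase space is fixed by \<open>k\<close>, and the coherent state there is
  the ground state itself.\<close>

lemma phase_norm:
  assumes "metaplectic_rep \<rho>" "k \<in> Sp_K"
  shows "phase \<rho> k * cnj (phase \<rho> k) = 1"
  using coherent_covariance[OF assms vac_L2 vac_L2, of 0]
  by (simp add: phase_def coherent_zero vac_inner)

text \<open>Covariance controls only products of two coefficients. With the ground state as second
  function, whose coefficients are known and nonzero, the product can be divided and the first
  factor is isolated up to the phase.\<close>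

lemma metaplectic_coherent:
  assumes \<rho>: "metaplectic_rep \<rho>" and k: "k \<in> Sp_K" and f: "f \<in> L2"
  shows "L2_inner (\<rho> k f) (coherent z) = phase \<rho> k * L2_inner f (coherent (transpose k *v z))"
proof -
  let ?c = "phase \<rho> k"
  note v = metaplectic_L2[OF \<rho> k vac_L2]
  \<comment> \<open>Equality in Cauchy-Schwarz: two unit vectors whose inner product has modulus 1
    are proportional, here expressed by the vanishing of their distance after the phase is
    inserted.\<close>
  have "(L2_norm (\<lambda>x. \<rho> k vac x - ?c * vac x))\<^sup>2 = 1 - 2 * Re (cnj ?c * ?c) + (cmod ?c)\<^sup>2"
    using metaplectic_norm[OF \<rho> k vac_L2] v
    by (subst L2_norm_diff_power2) (auto intro: L2_cmult simp: vac_norm L2_norm_cmult L2_inner_cmult_right phase_def power_mult_distrib)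
  moreover have "(cmod ?c)\<^sup>2 = 1" using phase_norm[OF \<rho> k] by (metis complex_norm_square of_real_eq_1_iff)
  moreover have "cnj ?c * ?c = 1" using phase_norm[OF \<rho> k] by (simp add: mult.commute)
  ultimately have "L2_norm (\<lambda>x. \<rho> k vac x - ?c * vac x) = 0" by simp
  then have "AE x in lborel. \<rho> k vac x - ?c * vac x = 0"
    by (intro L2_norm_eq_0 L2_diff L2_cmult v vac_L2)
  then have "L2_inner (\<rho> k vac) (coherent z) = L2_inner (\<lambda>x. ?c * vac x) (coherent z)"
    by (intro L2_inner_cong_AE v L2_cmult vac_L2 coherent_L2) simp
  then have vz: "L2_inner (\<rho> k vac) (coherent z) = ?c * of_real (exp (- (norm z)\<^sup>2 / 4))"
    by (simp add: L2_inner_cmult_left vac_coherent)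
  have kt: "orthogonal_matrix (transpose k)" using Sp_K_orthogonal[OF k] by simp
  have "L2_inner (\<rho> k f) (coherent z) * cnj ?c * of_real (exp (- (norm z)\<^sup>2 / 4))
     = L2_inner f (coherent (transpose k *v z)) * of_real (exp (- (norm z)\<^sup>2 / 4))"
    using coherent_covariance[OF \<rho> k f vac_L2, of z] unfolding vz vac_coherent orthogonal_matrix_norm[OF kt]
    by (simp add: mult.assoc)
  then have "L2_inner (\<rho> k f) (coherent z) * cnj ?c = L2_inner f (coherent (transpose k *v z))" by simp
  then have "?c * L2_inner f (coherent (transpose k *v z)) = L2_inner (\<rho> k f) (coherent z) * (?c * cnj ?c)"
    by (metis mult.assoc mult.commute)
  then show ?thesis unfolding phase_norm[OF \<rho> k] by simp
qed

text \<open>Operators known only through their coherent state coefficients are compared by this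
  principle.\<close>

lemma coherent_eq_AE:
  assumes "f \<in> L2" "g \<in> L2" "\<And>z. L2_inner f (coherent z) = L2_inner g (coherent z)"
  shows "AE x in lborel. f x = g x"
proof -
  have "L2_norm (\<lambda>x. f x - g x) = 0"
    by (rule coherent_total) (use assms in \<open>auto intro: L2_diff simp: L2_inner_diff_left\<close>)
  then have "AE x in lborel. f x - g x = 0" by (intro L2_norm_eq_0 L2_diff assms)
  then show ?thesis by simp
qed

text \<open>In the coordinates x + iy it multiplies the coordinate with index \<open>i\<close> by
  \<open>cis \<theta>\<close>: one circle factor of the diagonal torus of U(n).\<close>

definition rot :: "'n::finite \<Rightarrow> real \<Rightarrow> 'n sqmat" where
  "rot i \<theta> = (\<chi> a b. case (a, b) of
      (Inl p, Inl q) \<Rightarrow> if p = q then (if p = i then cos \<theta> else 1) else 0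
    | (Inr p, Inr q) \<Rightarrow> if p = q then (if p = i then cos \<theta> else 1) else 0
    | (Inl p, Inr q) \<Rightarrow> if p = q \<and> p = i then - sin \<theta> else 0
    | (Inr p, Inl q) \<Rightarrow> if p = q \<and> p = i then sin \<theta> else 0)"

lemma rot_vec:
  "(rot i \<theta> *v z) $ Inl p = (if p = i then cos \<theta> * z $ Inl p - sin \<theta> * z $ Inr p else z $ Inl p)"
  "(rot i \<theta> *v z) $ Inr p = (if p = i then sin \<theta> * z $ Inl p + cos \<theta> * z $ Inr p else z $ Inr p)"
proof -
  have s: "(\<Sum>q\<in>UNIV. (if p = q then c q else 0) * f q) = c p * f p" for c f :: "'a \<Rightarrow> real"
  proof -
    have "(\<Sum>q\<in>UNIV. (if p = q then c q else 0) * f q) = (\<Sum>q\<in>UNIV. if p = q then c q * f q else 0)"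
      by (intro sum.cong) auto
    then show ?thesis by simp
  qed
  have s': "(\<Sum>q\<in>UNIV. (if p = q \<and> p = i then c else 0) * f q) = (if p = i then c * f p else 0)" for c and f :: "'a \<Rightarrow> real"
    using s[of "\<lambda>_. c" f] by auto
  show "(rot i \<theta> *v z) $ Inl p = (if p = i then cos \<theta> * z $ Inl p - sin \<theta> * z $ Inr p else z $ Inl p)"
    "(rot i \<theta> *v z) $ Inr p = (if p = i then sin \<theta> * z $ Inl p + cos \<theta> * z $ Inr p else z $ Inr p)"
    unfolding matrix_vector_mult_def by (simp_all add: sum_UNIV_Plus rot_def s s')
qed

lemma sympl_J_vec:
  "(sympl_J *v z) $ Inl p = z $ Inr p" "(sympl_J *v z) $ Inr p = - z $ Inl p"
proof -
  have s: "(\<Sum>q\<in>UNIV. (if p = q then c else 0) * f q) = c * f p" for c and f :: "'a \<Rightarrow> real"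
  proof -
    have "(\<Sum>q\<in>UNIV. (if p = q then c else 0) * f q) = (\<Sum>q\<in>UNIV. if p = q then c * f q else 0)"
      by (intro sum.cong) auto
    then show ?thesis by simp
  qed
  show "(sympl_J *v z) $ Inl p = z $ Inr p" "(sympl_J *v z) $ Inr p = - z $ Inl p"
    unfolding matrix_vector_mult_def by (simp_all add: sum_UNIV_Plus sympl_J_def s)
qed

lemma transpose_rot: "transpose (rot i \<theta>) = rot i (- \<theta>)"
  by (auto simp: transpose_def rot_def vec_eq_iff split: sum.splits)

lemma vec_eq_plus_iff: "z = z' \<longleftrightarrow> (\<forall>p. z $ Inl p = z' $ Inl p) \<and> (\<forall>p. z $ Inr p = z' $ Inr p)" for z z' :: "real^('n::finite + 'm::finite)"
  unfolding vec_eq_iff by (metis sum.exhaust)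

lemma rot_cancel: "rot i (- \<theta>) *v (rot i \<theta> *v z) = z"
proof -
  have e: "cos \<theta> * (cos \<theta> * x - sin \<theta> * y) + sin \<theta> * (sin \<theta> * x + cos \<theta> * y) = x"
    "cos \<theta> * (sin \<theta> * x + cos \<theta> * y) - sin \<theta> * (cos \<theta> * x - sin \<theta> * y) = y" for x y
  proof -
    have "cos \<theta> * (cos \<theta> * x - sin \<theta> * y) + sin \<theta> * (sin \<theta> * x + cos \<theta> * y) = (cos \<theta> * cos \<theta> + sin \<theta> * sin \<theta>) * x"
      "cos \<theta> * (sin \<theta> * x + cos \<theta> * y) - sin \<theta> * (cos \<theta> * x - sin \<theta> * y) = (cos \<theta> * cos \<theta> + sin \<theta> * sin \<theta>) * y"
      by (simp_all only: algebra_simps)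
    then show "cos \<theta> * (cos \<theta> * x - sin \<theta> * y) + sin \<theta> * (sin \<theta> * x + cos \<theta> * y) = x"
      "cos \<theta> * (sin \<theta> * x + cos \<theta> * y) - sin \<theta> * (cos \<theta> * x - sin \<theta> * y) = y" by simp_all
  qed
  show ?thesis unfolding vec_eq_plus_iff rot_vec using e by auto
qed

text \<open>An orthogonal matrix is symplectic exactly when it commutes with \<open>sympl_J\<close>,
  that is, when it is complex linear; both properties are read off from the action on
  vectors.\<close>

lemma rot_Sp_K: "rot i \<theta> \<in> Sp_K"
proof -
  have "transpose (rot i \<theta>) ** rot i \<theta> = mat 1"
    unfolding matrix_eq transpose_rot matrix_vector_mul_assoc[symmetric] rot_cancel by simp
  then have "orthogonal_matrix (rot i \<theta>)" by (simp add: orthogonal_matrix)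
  moreover have "sympl_J ** rot i \<theta> = rot i \<theta> ** sympl_J"
    unfolding matrix_eq matrix_vector_mul_assoc[symmetric] vec_eq_plus_iff rot_vec sympl_J_vec by auto
  then have "transpose (rot i \<theta>) ** sympl_J ** rot i \<theta> = (transpose (rot i \<theta>) ** rot i \<theta>) ** sympl_J"
    by (metis matrix_mul_assoc)
  ultimately show ?thesis using \<open>transpose (rot i \<theta>) ** rot i \<theta> = mat 1\<close> by (simp add: Sp_K_def Sp_def)
qed

text \<open>Up to a radial factor the coefficient is a monomial in the conjugate coordinates, so
  turning one coordinate yields a character whose degree is the exponent there. The conjugation
  explains why the opposite rotation occurs on the left.\<close>

lemma hermite_coherent_rot:
  "L2_inner (hermite \<alpha>) (coherent (rot i (- \<theta>) *v z)) = cis (\<theta> * real (\<alpha> i)) * L2_inner (hermite \<alpha>) (coherent z)"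
proof -
  let ?w = "\<lambda>z p. (of_real (z $ Inl p) + \<i> * of_real (z $ Inr p)) / of_real (sqrt 2)"
  have ih: "L2_inner (coherent z) (hermite \<alpha>) = exp (- of_real ((norm z)\<^sup>2) / 4) * (\<Prod>p\<in>UNIV. ?w z p ^ \<alpha> p / of_real (sqrt (fact (\<alpha> p))))" for z
    using coherent_hermite[of z \<alpha>] by (simp only: L2_inner_def has_bochner_integral_iff)
  have n: "norm (rot i (- \<theta>) *v z) = norm z"
    by (rule orthogonal_matrix_norm[OF Sp_K_orthogonal[OF rot_Sp_K]])
  have w: "?w (rot i (- \<theta>) *v z) p = (if p = i then cis (- \<theta>) else 1) * ?w z p" for p
  proof -
    have "of_real (cos (- \<theta>) * x - sin (- \<theta>) * y) + \<i> * of_real (sin (- \<theta>) * x + cos (- \<theta>) * y) = cis (- \<theta>) * (of_real x + \<i> * of_real y)" for x y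
      by (simp add: complex_eq_iff)
    then show ?thesis unfolding rot_vec by (cases "p = i") (simp_all only: if_True if_False times_divide_eq_right mult_1 refl)
  qed
  have c: "((if p = i then cis (- \<theta>) else 1) * a) ^ \<alpha> p / b = (if p = i then cis (- \<theta>) ^ \<alpha> p else 1) * (a ^ \<alpha> p / b)" for p a b
    by (simp add: power_mult_distrib)
  have d: "(\<Prod>p\<in>UNIV. if p = i then cis (- \<theta>) ^ \<alpha> p else 1) = cis (- \<theta>) ^ \<alpha> i" by simp
  have "L2_inner (coherent (rot i (- \<theta>) *v z)) (hermite \<alpha>) = cis (- \<theta>) ^ \<alpha> i * L2_inner (coherent z) (hermite \<alpha>)"
    unfolding ih n w c prod.distrib d by (simp only: mult_ac)
  then have "cnj (L2_inner (coherent (rot i (- \<theta>) *v z)) (hermite \<alpha>)) = cnj (cis (- \<theta>) ^ \<alpha> i) * cnj (L2_inner (coherent z) (hermite \<alpha>))" by simp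
  moreover have "cnj (cis (- \<theta>) ^ \<alpha> i) = cis (\<theta> * real (\<alpha> i))"
    using Complex.DeMoivre[of \<theta> "\<alpha> i"] by (simp add: cis_cnj mult.commute)
  ultimately show ?thesis unfolding L2_inner_cnj by (simp only:)
qed

text \<open>The factor \<^term>\<open>phase \<rho> k\<close> cancels the scalar by which \<^term>\<open>\<rho> k\<close> is undetermined.\<close>

definition rcoeff :: "(('n::finite) sqmat \<Rightarrow> 'n fn \<Rightarrow> 'n fn) \<Rightarrow> 'n fn \<Rightarrow> 'n sqmat \<Rightarrow> ('n \<Rightarrow> nat) \<Rightarrow> complex" where
  "rcoeff \<rho> f k \<alpha> = cnj (phase \<rho> k) * hcoeff (\<rho> k f) \<alpha>"

text \<open>Multiplicativity of \<open>\<rho>\<close> is replaced by a comparison of coherent state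
  coefficients: once the phases are divided out, applying \<open>k\<close> and then the rotation
  agrees almost everywhere with applying their product.\<close>

lemma rcoeff_rot:
  assumes \<rho>: "metaplectic_rep \<rho>" and k: "k \<in> Sp_K" and f: "f \<in> L2"
  shows "rcoeff \<rho> f (rot i \<theta> ** k) \<alpha> = cis (\<theta> * real (\<alpha> i)) * rcoeff \<rho> f k \<alpha>"
proof -
  let ?t = "rot i \<theta>" and ?c = "cis (\<theta> * real (\<alpha> i))"
  note t = rot_Sp_K[of i \<theta>] and tk = Sp_K_mult[OF rot_Sp_K[of i \<theta>] k]
  define F where "F x = cnj (phase \<rho> (?t ** k)) * \<rho> (?t ** k) f x" for x
  define G where "G x = cnj (phase \<rho> k) * \<rho> k f x" for x
  have FL: "F \<in> L2" unfolding F_def[abs_def] by (intro L2_cmult metaplectic_L2[OF \<rho> tk f])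
  have GL: "G \<in> L2" unfolding G_def[abs_def] by (intro L2_cmult metaplectic_L2[OF \<rho> k f])
  have pc: "cnj (phase \<rho> k) * (phase \<rho> k * a) = a" if "k \<in> Sp_K" for k a
    using phase_norm[OF \<rho> that] by (metis mult.assoc mult.commute mult_1)
  have F: "L2_inner F (coherent z) = L2_inner f (coherent (transpose (?t ** k) *v z))" for z
    unfolding F_def[abs_def] L2_inner_cmult_left metaplectic_coherent[OF \<rho> tk f] pc[OF tk] ..
  have G: "L2_inner G (coherent z) = L2_inner f (coherent (transpose k *v z))" for z
    unfolding G_def[abs_def] L2_inner_cmult_left metaplectic_coherent[OF \<rho> k f] pc[OF k] ..
  have "L2_inner (\<rho> ?t G) (coherent z) = L2_inner (\<lambda>x. phase \<rho> ?t * F x) (coherent z)" for z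
    unfolding metaplectic_coherent[OF \<rho> t GL] L2_inner_cmult_left F G
    by (simp only: matrix_transpose_mul matrix_vector_mul_assoc)
  then have 1: "AE x in lborel. \<rho> ?t G x = phase \<rho> ?t * F x"
    by (rule coherent_eq_AE[OF metaplectic_L2[OF \<rho> t GL] L2_cmult[OF FL]])
  have "L2_inner (\<rho> ?t (hermite \<alpha>)) (coherent z) = L2_inner (\<lambda>x. phase \<rho> ?t * ?c * hermite \<alpha> x) (coherent z)" for z
    unfolding metaplectic_coherent[OF \<rho> t hermite_L2] L2_inner_cmult_left transpose_rot hermite_coherent_rot by (simp only: mult.assoc)
  then have 2: "AE x in lborel. \<rho> ?t (hermite \<alpha>) x = phase \<rho> ?t * ?c * hermite \<alpha> x"
    by (rule coherent_eq_AE[OF metaplectic_L2[OF \<rho> t hermite_L2] L2_cmult[OF hermite_L2]])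
  \<comment> \<open>Unitarity inserts the rotation on both sides. The first argument then becomes a
    multiple of \<open>F\<close>, the second a multiple of the Hermite function, and the phase of
    the rotation cancels.\<close>
  have "L2_inner G (hermite \<alpha>) = L2_inner (\<rho> ?t G) (\<rho> ?t (hermite \<alpha>))"
    by (rule metaplectic_inner[OF \<rho> t GL hermite_L2, symmetric])
  also have "\<dots> = L2_inner (\<lambda>x. phase \<rho> ?t * F x) (\<rho> ?t (hermite \<alpha>))"
    by (rule L2_inner_cong_AE[OF metaplectic_L2[OF \<rho> t GL] L2_cmult[OF FL] metaplectic_L2[OF \<rho> t hermite_L2] 1])
  also have "\<dots> = cnj (L2_inner (\<rho> ?t (hermite \<alpha>)) (\<lambda>x. phase \<rho> ?t * F x))" by (simp only: L2_inner_cnj)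
  also have "L2_inner (\<rho> ?t (hermite \<alpha>)) (\<lambda>x. phase \<rho> ?t * F x) = L2_inner (\<lambda>x. phase \<rho> ?t * ?c * hermite \<alpha> x) (\<lambda>x. phase \<rho> ?t * F x)"
    by (rule L2_inner_cong_AE[OF metaplectic_L2[OF \<rho> t hermite_L2] L2_cmult[OF hermite_L2] L2_cmult[OF FL] 2])
  also have "cnj \<dots> = L2_inner (\<lambda>x. phase \<rho> ?t * F x) (\<lambda>x. phase \<rho> ?t * ?c * hermite \<alpha> x)" by (simp only: L2_inner_cnj)
  also have "\<dots> = phase \<rho> ?t * (cnj (phase \<rho> ?t * ?c) * L2_inner F (hermite \<alpha>))"
    unfolding L2_inner_cmult_left L2_inner_cmult_right ..
  also have "\<dots> = (phase \<rho> ?t * cnj (phase \<rho> ?t)) * (cnj ?c * L2_inner F (hermite \<alpha>))"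
    by (simp only: complex_cnj_mult mult_ac)
  also have "\<dots> = cnj ?c * L2_inner F (hermite \<alpha>)" unfolding phase_norm[OF \<rho> t] by simp
  finally have "L2_inner G (hermite \<alpha>) = cnj ?c * L2_inner F (hermite \<alpha>)" .
  then have "?c * L2_inner G (hermite \<alpha>) = (?c * cnj ?c) * L2_inner F (hermite \<alpha>)" by (simp only: mult.assoc)
  also have "?c * cnj ?c = 1" by (simp add: cis_cnj cis_mult)
  finally have "L2_inner F (hermite \<alpha>) = ?c * L2_inner G (hermite \<alpha>)" by simp
  then show ?thesis unfolding F_def[abs_def] G_def[abs_def] L2_inner_cmult_left rcoeff_def hcoeff_def .
qed

section \<open>Averaging over the maximal compact subgroup\<close>

lemma haar_K_space: "haar_K \<mu> \<Longrightarrow> space \<mu> = Sp_K"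
  unfolding haar_K_def using sets_eq_imp_space_eq[of \<mu> "restrict_space borel Sp_K"] by (auto simp: space_restrict_space)

lemma haar_K_prob: "haar_K \<mu> \<Longrightarrow> prob_space \<mu>"
  using haar_K_space[of \<mu>] by (intro prob_spaceI) (simp add: haar_K_def)

text \<open>\<open>haar_K\<close> speaks of images under left translation, integration of preimages.
  The preimage under \<open>\<tau>\<close> is the image under its inverse, which is passed as
  \<open>\<tau>'\<close>.\<close>

lemma haar_K_inv:
  fixes F :: "('n::finite) sqmat \<Rightarrow> complex"
  assumes \<mu>: "haar_K \<mu>" and \<tau>: "\<tau> \<in> Sp_K" "\<tau>' \<in> Sp_K" "\<tau>' ** \<tau> = mat 1" "\<tau> ** \<tau>' = mat 1"
    and F: "F \<in> borel_measurable \<mu>"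
  shows "(LINT k|\<mu>. F (\<tau> ** k)) = (LINT k|\<mu>. F k)"
proof -
  have sp: "space \<mu> = Sp_K" by (rule haar_K_space[OF \<mu>])
  have se: "sets \<mu> = sets (restrict_space borel Sp_K)" using \<mu> by (simp add: haar_K_def)
  have c: "continuous_on UNIV (\<lambda>k::'n sqmat. \<tau> ** k)"
    unfolding matrix_matrix_mult_def by (intro continuous_intros continuous_on_vec_lambda continuous_on_component continuous_on_id)
  have "(\<lambda>k. \<tau> ** k) \<in> measurable (restrict_space borel Sp_K) (restrict_space borel Sp_K)"
    by (rule measurable_restrict_space3[OF borel_measurable_continuous_onI[OF c]]) (auto intro: Sp_K_mult[OF \<tau>(1)])
  then have m: "(\<lambda>k. \<tau> ** k) \<in> measurable \<mu> \<mu>" by (simp add: measurable_cong_sets[OF se se])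
  have "distr \<mu> \<mu> (\<lambda>k. \<tau> ** k) = \<mu>"
  proof (rule measure_eqI)
    fix A assume "A \<in> sets (distr \<mu> \<mu> (\<lambda>k. \<tau> ** k))"
    then have A: "A \<in> sets \<mu>" by simp
    have AS: "A \<subseteq> Sp_K" using sets.sets_into_space[OF A] sp by simp
    have "(\<lambda>k. \<tau> ** k) -` A \<inter> space \<mu> = (**) \<tau>' ` A"
    proof
      show "(\<lambda>k. \<tau> ** k) -` A \<inter> space \<mu> \<subseteq> (**) \<tau>' ` A"
      proof
        fix k assume "k \<in> (\<lambda>k. \<tau> ** k) -` A \<inter> space \<mu>"
        moreover have "k = \<tau>' ** (\<tau> ** k)" by (simp add: matrix_mul_assoc \<tau>(3))
        ultimately show "k \<in> (**) \<tau>' ` A" by blast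
      qed
      show "(**) \<tau>' ` A \<subseteq> (\<lambda>k. \<tau> ** k) -` A \<inter> space \<mu>"
        using AS Sp_K_mult[OF \<tau>(2)] by (auto simp: sp matrix_mul_assoc \<tau>(4))
    qed
    then have "emeasure (distr \<mu> \<mu> (\<lambda>k. \<tau> ** k)) A = emeasure \<mu> ((**) \<tau>' ` A)"
      by (simp add: emeasure_distr[OF m A])
    also have "\<dots> = emeasure \<mu> A" using \<mu> \<tau>(2) A by (simp add: haar_K_def)
    finally show "emeasure (distr \<mu> \<mu> (\<lambda>k. \<tau> ** k)) A = emeasure \<mu> A" .
  qed simp
  then show ?thesis using integral_distr[OF m F] by simp
qed

text \<open>Measurability in \<open>k\<close> cannot be read off from \<open>\<rho>\<close>, which
  is an arbitrary choice for each \<open>k\<close>. After normalisation, however, the coherent state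
  coefficients depend on \<open>k\<close> only through \<open>transpose k *v z\<close>, and
  \<open>gform\<close> recovers the Hermite coefficient as a limit of integrals over them.\<close>

lemma rcoeff_measurable:
  fixes \<mu> :: "('n::finite) sqmat measure"
  assumes \<mu>: "haar_K \<mu>" and \<rho>: "metaplectic_rep \<rho>" and f: "f \<in> L2"
  shows "(\<lambda>k. rcoeff \<rho> f k \<alpha>) \<in> borel_measurable \<mu>"
proof -
  note [measurable] = f[THEN L2_measurable]
  have se: "sets \<mu> = sets (restrict_space borel Sp_K)" using \<mu> by (simp add: haar_K_def)
  have sp: "space \<mu> = Sp_K" by (rule haar_K_space[OF \<mu>])
  define C where "C = complex_of_real ((4 * pi) powr (real CARD('n) / 2) * pi powr (real CARD('n) / 2))"
  have C: "C \<noteq> 0" by (simp add: C_def)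
  define G where "G k x = cnj (phase \<rho> k) * \<rho> k f x" for k x
  have GL: "G k \<in> L2" if "k \<in> Sp_K" for k unfolding G_def[abs_def] by (intro L2_cmult metaplectic_L2[OF \<rho> that f])
  define a where "a z = L2_inner f (coherent z)" for z
  have [measurable]: "a \<in> borel_measurable borel" unfolding a_def[abs_def] L2_inner_def by measurable
  have [measurable]: "(\<lambda>z. L2_inner (hermite \<alpha>) (coherent z)) \<in> borel_measurable borel"
    unfolding L2_inner_def by measurable
  have Ga: "L2_inner (G k) (coherent z) = a (transpose k *v z)" if "k \<in> Sp_K" for k z
    unfolding G_def[abs_def] L2_inner_cmult_left metaplectic_coherent[OF \<rho> that f] a_def
    using phase_norm[OF \<rho> that] by (metis mult.assoc mult.commute mult_1)
  \<comment> \<open>On the group this is the regularised pairing divided by its limiting constant,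
    written without \<open>\<rho>\<close>, so that the integrand is jointly measurable in
    \<open>k\<close> and \<open>z\<close>.\<close>
  define g where "g j k = inverse C * (LINT z|lborel. a (transpose k *v z) * cnj (L2_inner (hermite \<alpha>) (coherent z)) * of_real (exp (- (1 / real (Suc j)) * (norm (im_part z))\<^sup>2)))" for j k
  show ?thesis
  proof (rule borel_measurable_LIMSEQ_metric)
    fix k assume "k \<in> space \<mu>"
    then have k: "k \<in> Sp_K" by (simp add: sp)
    have "(\<lambda>j. inverse C * gform (1 / real (Suc j)) (G k) (hermite \<alpha>)) \<longlonglongrightarrow> inverse C * (C * L2_inner (G k) (hermite \<alpha>))"
      unfolding C_def by (intro tendsto_intros gform_tendsto GL k hermite_L2)
    moreover have "inverse C * gform (1 / real (Suc j)) (G k) (hermite \<alpha>) = g j k" for j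
      unfolding g_def gform_def Ga[OF k] ..
    moreover have "inverse C * (C * L2_inner (G k) (hermite \<alpha>)) = rcoeff \<rho> f k \<alpha>"
      unfolding rcoeff_def hcoeff_def G_def[abs_def] L2_inner_cmult_left using C by simp
    ultimately show "(\<lambda>j. g j k) \<longlonglongrightarrow> rcoeff \<rho> f k \<alpha>" by simp
  next
    fix j
    have c: "continuous_on UNIV (\<lambda>p :: 'n sqmat \<times> (real^('n + 'n)). transpose (fst p) *v snd p)"
      unfolding matrix_vector_mult_def transpose_def
      by (intro continuous_intros continuous_on_vec_lambda)
    have i: "(\<lambda>k. k) \<in> measurable \<mu> borel"
      using measurable_restrict_space1[OF measurable_ident, of borel] unfolding measurable_cong_sets[OF se refl] id_def .
    have fm: "(\<lambda>x. fst x) \<in> measurable (\<mu> \<Otimes>\<^sub>M lborel) borel" and sm: "(\<lambda>x. snd x) \<in> borel_measurable (\<mu> \<Otimes>\<^sub>M (lborel :: (real^('n + 'n)) measure))"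
      using measurable_compose[OF measurable_fst i] measurable_snd[of \<mu> "lborel :: (real^('n + 'n)) measure"] by auto
    have "(\<lambda>x. (fst x, snd x)) \<in> measurable (\<mu> \<Otimes>\<^sub>M lborel) (borel :: ('n sqmat \<times> (real^('n + 'n))) measure)"
      unfolding borel_prod[symmetric] by (rule measurable_Pair[OF fm sm])
    from measurable_compose[OF this borel_measurable_continuous_onI[OF c]]
    have [measurable]: "(\<lambda>x. transpose (fst x) *v snd x) \<in> borel_measurable (\<mu> \<Otimes>\<^sub>M (lborel :: (real^('n + 'n)) measure))" by simp
    have "(\<lambda>x. a (transpose (fst x) *v snd x) * cnj (L2_inner (hermite \<alpha>) (coherent (snd x))) * of_real (exp (- (1 / real (Suc j)) * (norm (im_part (snd x)))\<^sup>2))) \<in> borel_measurable (\<mu> \<Otimes>\<^sub>M lborel)"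
      by measurable
    then have "(\<lambda>(k, z). a (transpose k *v z) * cnj (L2_inner (hermite \<alpha>) (coherent z)) * of_real (exp (- (1 / real (Suc j)) * (norm (im_part z))\<^sup>2))) \<in> borel_measurable (\<mu> \<Otimes>\<^sub>M lborel)"
      by (simp only: case_prod_beta')
    from lborel.borel_measurable_lebesgue_integral[OF this]
    show "g j \<in> borel_measurable \<mu>" unfolding g_def[abs_def] by simp
  qed
qed

lemma rcoeff_sum_le:
  assumes "metaplectic_rep \<rho>" "k \<in> Sp_K" "f \<in> L2"
  shows "(\<Sum>\<alpha>\<in>cube N. (cmod (rcoeff \<rho> f k \<alpha>))\<^sup>2) \<le> (L2_norm f)\<^sup>2"
proof -
  have "cmod (phase \<rho> k) = 1"
    using phase_norm[OF assms(1,2)] by (metis complex_mod_mult_cnj norm_one power2_eq_1_iff norm_ge_zero neg_0_le_iff_le not_one_le_zero)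
  then have "(\<Sum>\<alpha>\<in>cube N. (cmod (rcoeff \<rho> f k \<alpha>))\<^sup>2) = (\<Sum>\<alpha>\<in>cube N. (cmod (hcoeff (\<rho> k f) \<alpha>))\<^sup>2)"
    by (simp add: rcoeff_def norm_mult)
  also have "\<dots> \<le> (L2_norm f)\<^sup>2"
    using hcoeff_bessel[OF metaplectic_L2[OF assms]] metaplectic_norm[OF assms] by simp
  finally show ?thesis .
qed

lemma rcoeff_norm_le:
  assumes "metaplectic_rep \<rho>" "k \<in> Sp_K" "f \<in> L2"
  shows "cmod (rcoeff \<rho> f k \<alpha>) \<le> L2_norm f"
proof -
  obtain N where "\<alpha> \<in> cube N"
  proof
    show "\<alpha> \<in> cube (Max (range \<alpha>))" unfolding cube_def by (auto intro: Max_ge)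
  qed
  then have "(cmod (rcoeff \<rho> f k \<alpha>))\<^sup>2 \<le> (\<Sum>\<alpha>\<in>cube N. (cmod (rcoeff \<rho> f k \<alpha>))\<^sup>2)"
    by (intro member_le_sum) auto
  also have "\<dots> \<le> (L2_norm f)\<^sup>2" by (rule rcoeff_sum_le[OF assms])
  finally show ?thesis by (rule power2_le_imp_le) simp
qed

lemma rcoeff_integrable:
  assumes \<mu>: "haar_K \<mu>" and \<rho>: "metaplectic_rep \<rho>" and f: "f \<in> L2"
  shows "integrable \<mu> (\<lambda>k. rcoeff \<rho> f k \<alpha> * cnj (rcoeff \<rho> f k \<beta>))"
proof -
  interpret prob_space \<mu> by (rule haar_K_prob[OF \<mu>])
  note [measurable] = rcoeff_measurable[OF \<mu> \<rho> f]
  show ?thesis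
  proof (rule integrable_const_bound)
    show "AE k in \<mu>. norm (rcoeff \<rho> f k \<alpha> * cnj (rcoeff \<rho> f k \<beta>)) \<le> L2_norm f * L2_norm f"
      using rcoeff_norm_le[OF \<rho> _ f] by (intro AE_I2) (auto simp: haar_K_space[OF \<mu>] norm_mult intro!: mult_mono)
  qed measurable
qed

text \<open>Schur orthogonality for the maximal torus: left translation by a rotation in a single
  coordinate plane multiplies the integrand by \<open>-1\<close>.\<close>

lemma rcoeff_orthogonal:
  fixes \<mu> :: "('n::finite) sqmat measure"
  assumes \<mu>: "haar_K \<mu>" and \<rho>: "metaplectic_rep \<rho>" and f: "f \<in> L2" and ne: "\<alpha> \<noteq> \<beta>"
  shows "(LINT k|\<mu>. rcoeff \<rho> f k \<alpha> * cnj (rcoeff \<rho> f k \<beta>)) = 0"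
proof -
  obtain i where i: "\<alpha> i \<noteq> \<beta> i" using ne by auto
  define \<theta> where "\<theta> = pi / (real (\<alpha> i) - real (\<beta> i))"
  have "\<theta> * real (\<alpha> i) + - (\<theta> * real (\<beta> i)) = \<theta> * (real (\<alpha> i) - real (\<beta> i))" by (simp add: algebra_simps)
  also have "\<dots> = pi" using i by (simp add: \<theta>_def)
  finally have c: "cis (\<theta> * real (\<alpha> i)) * cnj (cis (\<theta> * real (\<beta> i))) = -1"
    unfolding cis_cnj cis_mult by simp
  note [measurable] = rcoeff_measurable[OF \<mu> \<rho> f]
  let ?F = "\<lambda>k. rcoeff \<rho> f k \<alpha> * cnj (rcoeff \<rho> f k \<beta>)"
  have rr: "rot i (- \<theta>) ** rot i \<theta> = mat 1" "rot i \<theta> ** rot i (- \<theta>) = mat 1"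
    using Sp_K_orthogonal[OF rot_Sp_K[of i \<theta>]] unfolding orthogonal_matrix_def transpose_rot by auto
  have "(LINT k|\<mu>. ?F k) = (LINT k|\<mu>. ?F (rot i \<theta> ** k))"
    by (rule haar_K_inv[OF \<mu> rot_Sp_K rot_Sp_K rr, symmetric]) measurable
  also have "\<dots> = (LINT k|\<mu>. - ?F k)"
  proof (rule Bochner_Integration.integral_cong[OF refl])
    fix k assume "k \<in> space \<mu>"
    then have k: "k \<in> Sp_K" by (simp add: haar_K_space[OF \<mu>])
    have "?F (rot i \<theta> ** k) = (cis (\<theta> * real (\<alpha> i)) * cnj (cis (\<theta> * real (\<beta> i)))) * ?F k"
      unfolding rcoeff_rot[OF \<rho> k f] complex_cnj_mult by (simp only: mult_ac)
    then show "?F (rot i \<theta> ** k) = - ?F k" unfolding c by simp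
  qed
  also have "\<dots> = - (LINT k|\<mu>. ?F k)" by simp
  finally show ?thesis by simp
qed

text \<open>Pythagoras after averaging, since the off-diagonal terms integrate to 0. The vector
  \<open>v\<close> is left arbitrary so that it may depend on a second group element held
  fixed.\<close>

lemma rcoeff_square_integral:
  fixes \<mu> :: "('n::finite) sqmat measure"
  assumes \<mu>: "haar_K \<mu>" and \<rho>: "metaplectic_rep \<rho>" and f: "f \<in> L2" and A: "finite A"
  shows "integrable \<mu> (\<lambda>k. (cmod (\<Sum>\<alpha>\<in>A. rcoeff \<rho> f k \<alpha> * v \<alpha>))\<^sup>2)"
    and "(LINT k|\<mu>. (cmod (\<Sum>\<alpha>\<in>A. rcoeff \<rho> f k \<alpha> * v \<alpha>))\<^sup>2) = (\<Sum>\<alpha>\<in>A. (LINT k|\<mu>. (cmod (rcoeff \<rho> f k \<alpha>))\<^sup>2) * (cmod (v \<alpha>))\<^sup>2)"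
proof -
  let ?c = "\<lambda>k \<alpha>. rcoeff \<rho> f k \<alpha>"
  have e: "complex_of_real ((cmod (\<Sum>\<alpha>\<in>A. ?c k \<alpha> * v \<alpha>))\<^sup>2) = (\<Sum>\<alpha>\<in>A. \<Sum>\<beta>\<in>A. (v \<alpha> * cnj (v \<beta>)) * (?c k \<alpha> * cnj (?c k \<beta>)))" for k
    unfolding complex_norm_square cnj_sum sum_product complex_cnj_mult by (intro sum.cong refl) (simp only: mult_ac)
  have i: "integrable \<mu> (\<lambda>k. (v \<alpha> * cnj (v \<beta>)) * (?c k \<alpha> * cnj (?c k \<beta>)))" for \<alpha> \<beta>
    by (rule integrable_mult_right[OF rcoeff_integrable[OF \<mu> \<rho> f]])
  have "integrable \<mu> (\<lambda>k. complex_of_real ((cmod (\<Sum>\<alpha>\<in>A. ?c k \<alpha> * v \<alpha>))\<^sup>2))"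
    unfolding e by (intro Bochner_Integration.integrable_sum i)
  then show "integrable \<mu> (\<lambda>k. (cmod (\<Sum>\<alpha>\<in>A. ?c k \<alpha> * v \<alpha>))\<^sup>2)" by (simp only: complex_of_real_integrable_eq)
  have d: "(LINT k|\<mu>. ?c k \<alpha> * cnj (?c k \<beta>)) = (if \<alpha> = \<beta> then of_real (LINT k|\<mu>. (cmod (?c k \<alpha>))\<^sup>2) else 0)" for \<alpha> \<beta>
  proof (cases "\<alpha> = \<beta>")
    case True
    then show ?thesis unfolding True complex_norm_square[symmetric] by (simp only: if_True integral_complex_of_real)
  qed (simp add: rcoeff_orthogonal[OF \<mu> \<rho> f])
  have "complex_of_real (LINT k|\<mu>. (cmod (\<Sum>\<alpha>\<in>A. ?c k \<alpha> * v \<alpha>))\<^sup>2) = (LINT k|\<mu>. (\<Sum>\<alpha>\<in>A. \<Sum>\<beta>\<in>A. (v \<alpha> * cnj (v \<beta>)) * (?c k \<alpha> * cnj (?c k \<beta>))))"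
    unfolding e[symmetric] integral_complex_of_real ..
  also have "\<dots> = (\<Sum>\<alpha>\<in>A. \<Sum>\<beta>\<in>A. (LINT k|\<mu>. (v \<alpha> * cnj (v \<beta>)) * (?c k \<alpha> * cnj (?c k \<beta>))))"
    using i by (simp only: Bochner_Integration.integral_sum Bochner_Integration.integrable_sum)
  also have "\<dots> = (\<Sum>\<alpha>\<in>A. \<Sum>\<beta>\<in>A. if \<alpha> = \<beta> then (v \<alpha> * cnj (v \<alpha>)) * of_real (LINT k|\<mu>. (cmod (?c k \<alpha>))\<^sup>2) else 0)"
    unfolding integral_mult_right_zero d by (intro sum.cong refl) simp
  also have "\<dots> = (\<Sum>\<alpha>\<in>A. (v \<alpha> * cnj (v \<alpha>)) * of_real (LINT k|\<mu>. (cmod (?c k \<alpha>))\<^sup>2))"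
    using A by simp
  also have "\<dots> = of_real (\<Sum>\<alpha>\<in>A. (LINT k|\<mu>. (cmod (?c k \<alpha>))\<^sup>2) * (cmod (v \<alpha>))\<^sup>2)"
    unfolding complex_norm_square[symmetric] of_real_sum of_real_mult by (simp only: mult.commute)
  finally show "(LINT k|\<mu>. (cmod (\<Sum>\<alpha>\<in>A. ?c k \<alpha> * v \<alpha>))\<^sup>2) = (\<Sum>\<alpha>\<in>A. (LINT k|\<mu>. (cmod (?c k \<alpha>))\<^sup>2) * (cmod (v \<alpha>))\<^sup>2)"
    by (simp only: of_real_eq_iff)
qed

lemma rcoeff_total_mass:
  fixes \<mu> :: "('n::finite) sqmat measure"
  assumes \<mu>: "haar_K \<mu>" and \<rho>: "metaplectic_rep \<rho>" and f: "f \<in> L2"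
  shows "(\<Sum>\<alpha>\<in>cube N. LINT k|\<mu>. (cmod (rcoeff \<rho> f k \<alpha>))\<^sup>2) \<le> (L2_norm f)\<^sup>2"
proof -
  interpret prob_space \<mu> by (rule haar_K_prob[OF \<mu>])
  have i: "integrable \<mu> (\<lambda>k. (cmod (rcoeff \<rho> f k \<alpha>))\<^sup>2)" for \<alpha>
    using rcoeff_square_integral(1)[OF \<mu> \<rho> f, of "{\<alpha>}" "\<lambda>_. 1"] by simp
  have "(\<Sum>\<alpha>\<in>cube N. LINT k|\<mu>. (cmod (rcoeff \<rho> f k \<alpha>))\<^sup>2) = (LINT k|\<mu>. (\<Sum>\<alpha>\<in>cube N. (cmod (rcoeff \<rho> f k \<alpha>))\<^sup>2))"
    using i by (simp add: Bochner_Integration.integral_sum)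
  also have "\<dots> \<le> (LINT k|\<mu>. (L2_norm f)\<^sup>2)"
    by (rule integral_mono) (use i rcoeff_sum_le[OF \<rho> _ f] haar_K_space[OF \<mu>] in auto)
  also have "\<dots> = (L2_norm f)\<^sup>2" by (simp add: prob_space)
  finally show ?thesis .
qed

text \<open>Built from the normalised coefficients, hence measurable in both group elements; by
  \<open>partial_coeff_norm\<close> its modulus is that of the truncated expansion with the original
  operators.\<close>

definition partial_coeff :: "real \<Rightarrow> (('n::finite) sqmat \<Rightarrow> 'n fn \<Rightarrow> 'n fn) \<Rightarrow> 'n fn \<Rightarrow> 'n fn \<Rightarrow> nat \<Rightarrow> 'n sqmat \<Rightarrow> 'n sqmat \<Rightarrow> complex" where
  "partial_coeff t \<rho> f g N k l = (\<Sum>\<alpha>\<in>cube N. \<Sum>\<beta>\<in>cube N. rcoeff \<rho> f k \<alpha> * cnj (rcoeff \<rho> g l \<beta>) * schroedinger_coeff t \<alpha> \<beta>)"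

lemma partial_coeff_norm:
  assumes \<rho>: "metaplectic_rep \<rho>" and k: "k \<in> Sp_K" and l: "l \<in> Sp_K"
  shows "cmod (partial_coeff t \<rho> f g N k l) = cmod (\<Sum>\<alpha>\<in>cube N. \<Sum>\<beta>\<in>cube N. hcoeff (\<rho> k f) \<alpha> * cnj (hcoeff (\<rho> l g) \<beta>) * schroedinger_coeff t \<alpha> \<beta>)"
proof -
  have p: "cmod (phase \<rho> k) = 1" if "k \<in> Sp_K" for k
    using phase_norm[OF \<rho> that] by (metis complex_mod_mult_cnj norm_one power2_eq_1_iff norm_ge_zero neg_0_le_iff_le not_one_le_zero)
  have "partial_coeff t \<rho> f g N k l = (cnj (phase \<rho> k) * phase \<rho> l) * (\<Sum>\<alpha>\<in>cube N. \<Sum>\<beta>\<in>cube N. hcoeff (\<rho> k f) \<alpha> * cnj (hcoeff (\<rho> l g) \<beta>) * schroedinger_coeff t \<alpha> \<beta>)"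
    unfolding partial_coeff_def rcoeff_def sum_distrib_left by (intro sum.cong refl) (simp add: mult_ac)
  then show ?thesis by (simp add: norm_mult p[OF k] p[OF l])
qed

text \<open>Orthogonality is applied twice: first to the average over \<open>l\<close>, with
  \<open>k\<close> frozen inside the coefficient vector, then to the average over
  \<open>k\<close>.\<close>

lemma partial_coeff_mean_square:
  fixes \<mu> :: "('n::finite) sqmat measure"
  assumes \<mu>: "haar_K \<mu>" and \<rho>: "metaplectic_rep \<rho>" and f: "f \<in> L2" and g: "g \<in> L2"
  shows "(LINT k|\<mu>. LINT l|\<mu>. (cmod (partial_coeff t \<rho> f g N k l))\<^sup>2)
    \<le> ((1 + t\<^sup>2) powr (- real CARD('n) / 4))\<^sup>2 * (L2_norm f)\<^sup>2 * (L2_norm g)\<^sup>2"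
proof -
  let ?D = "schroedinger_coeff t"
  define M where "M = ((1 + t\<^sup>2) powr (- real CARD('n) / 4))\<^sup>2"
  define p where "p \<alpha> = (LINT k|\<mu>. (cmod (rcoeff \<rho> f k \<alpha>))\<^sup>2)" for \<alpha>
  define q where "q \<beta> = (LINT l|\<mu>. (cmod (rcoeff \<rho> g l \<beta>))\<^sup>2)" for \<beta>
  have p0: "p \<alpha> \<ge> 0" and q0: "q \<alpha> \<ge> 0" for \<alpha> by (simp_all add: p_def q_def integral_nonneg_AE)
  have inner: "(LINT l|\<mu>. (cmod (partial_coeff t \<rho> f g N k l))\<^sup>2) = (\<Sum>\<beta>\<in>cube N. q \<beta> * (cmod (\<Sum>\<alpha>\<in>cube N. rcoeff \<rho> f k \<alpha> * ?D \<alpha> \<beta>))\<^sup>2)" for k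
  proof -
    \<comment> \<open>Conjugating the sum frees \<open>rcoeff \<rho> g l\<close> of its conjugate,
      the shape required by \<open>rcoeff_square_integral\<close>.\<close>
    have "cmod (partial_coeff t \<rho> f g N k l) = cmod (\<Sum>\<beta>\<in>cube N. rcoeff \<rho> g l \<beta> * cnj (\<Sum>\<alpha>\<in>cube N. rcoeff \<rho> f k \<alpha> * ?D \<alpha> \<beta>))" for l
    proof -
      have "partial_coeff t \<rho> f g N k l = (\<Sum>\<beta>\<in>cube N. \<Sum>\<alpha>\<in>cube N. rcoeff \<rho> f k \<alpha> * cnj (rcoeff \<rho> g l \<beta>) * ?D \<alpha> \<beta>)"
        unfolding partial_coeff_def by (rule sum.swap)
      also have "\<dots> = cnj (\<Sum>\<beta>\<in>cube N. rcoeff \<rho> g l \<beta> * cnj (\<Sum>\<alpha>\<in>cube N. rcoeff \<rho> f k \<alpha> * ?D \<alpha> \<beta>))"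
        unfolding cnj_sum complex_cnj_mult complex_cnj_cnj sum_distrib_left by (intro sum.cong refl) (simp only: mult_ac)
      finally show ?thesis by (simp only: complex_mod_cnj)
    qed
    then show ?thesis
      using rcoeff_square_integral(2)[OF \<mu> \<rho> g finite_cube, where v="\<lambda>\<beta>. cnj (\<Sum>\<alpha>\<in>cube N. rcoeff \<rho> f k \<alpha> * ?D \<alpha> \<beta>)"]
      by (simp only: complex_mod_cnj q_def)
  qed
  have "(LINT k|\<mu>. LINT l|\<mu>. (cmod (partial_coeff t \<rho> f g N k l))\<^sup>2) = (\<Sum>\<beta>\<in>cube N. q \<beta> * (LINT k|\<mu>. (cmod (\<Sum>\<alpha>\<in>cube N. rcoeff \<rho> f k \<alpha> * ?D \<alpha> \<beta>))\<^sup>2))"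
    unfolding inner using rcoeff_square_integral(1)[OF \<mu> \<rho> f finite_cube]
    by (subst Bochner_Integration.integral_sum) auto
  also have "\<dots> = (\<Sum>\<beta>\<in>cube N. q \<beta> * (\<Sum>\<alpha>\<in>cube N. p \<alpha> * (cmod (?D \<alpha> \<beta>))\<^sup>2))"
    unfolding rcoeff_square_integral(2)[OF \<mu> \<rho> f finite_cube] p_def ..
  also have "\<dots> \<le> (\<Sum>\<beta>\<in>cube N. q \<beta> * (\<Sum>\<alpha>\<in>cube N. p \<alpha> * M))"
    unfolding M_def by (intro sum_mono mult_left_mono power_mono schroedinger_coeff_bound p0 q0) auto
  also have "\<dots> = M * (\<Sum>\<alpha>\<in>cube N. p \<alpha>) * (\<Sum>\<beta>\<in>cube N. q \<beta>)"
    unfolding sum_distrib_right[symmetric] by (simp only: mult_ac)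
  also have "\<dots> \<le> M * (L2_norm f)\<^sup>2 * (L2_norm g)\<^sup>2"
    using rcoeff_total_mass[OF \<mu> \<rho> f, of N] rcoeff_total_mass[OF \<mu> \<rho> g, of N]
    unfolding p_def[symmetric] q_def[symmetric]
    by (intro mult_mono) (auto simp: M_def intro!: sum_nonneg p0 q0 mult_nonneg_nonneg)
  finally show ?thesis unfolding M_def .
qed

text \<open>The origin of the constant: (1 + |t|)^2 <= 2 (1 + t^2), raised to the negative power
  -n/4.\<close>

lemma one_plus_square_powr_le:
  fixes t :: real
  shows "(1 + t\<^sup>2) powr (- real n / 4) \<le> 2 powr (real n / 4) * (1 + \<bar>t\<bar>) powr (- real n / 2)"
proof -
  have "(1 + \<bar>t\<bar>)\<^sup>2 \<le> 2 * (1 + t\<^sup>2)"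
    using zero_le_power2[of "1 - \<bar>t\<bar>"] by (simp add: power2_eq_square algebra_simps)
  then have "(1 + \<bar>t\<bar>)\<^sup>2 / 2 \<le> 1 + t\<^sup>2" by simp
  then have "(1 + t\<^sup>2) powr (- real n / 4) \<le> ((1 + \<bar>t\<bar>)\<^sup>2 / 2) powr (- real n / 4)"
    by (intro powr_mono2') (auto simp: add_pos_nonneg)
  moreover have "((1 + \<bar>t\<bar>)\<^sup>2) powr (- real n / 4) = (1 + \<bar>t\<bar>) powr (- real n / 2)"
  proof -
    have "(1 + \<bar>t\<bar>)\<^sup>2 = (1 + \<bar>t\<bar>) powr 2" by (simp add: powr_numeral)
    then show ?thesis by (simp only: powr_powr) simp
  qed
  moreover have "1 / (2::real) powr (- real n / 4) = 2 powr (real n / 4)"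
    by (simp only: powr_minus_divide minus_divide_left[symmetric]) simp
  ultimately show ?thesis
    unfolding powr_divide by (metis mult.commute divide_inverse inverse_eq_divide)
qed

text \<open>Integrability on the product is asserted together with the inequality: the Bochner
  integral of a nonintegrable function is 0 by convention, so the inequality alone could hold
  vacuously. The constant is chosen before the measure, the representation and the
  propagator.\<close>

theorem theorem5p4:
  "\<exists>C>0. \<forall>(\<mu> :: ('n::finite) sqmat measure) (\<rho> :: 'n sqmat \<Rightarrow> 'n fn \<Rightarrow> 'n fn)
        (U :: real \<Rightarrow> 'n fn \<Rightarrow> 'n fn).
     haar_K \<mu> \<longrightarrow> metaplectic_rep \<rho> \<longrightarrow> free_schroedinger_propagator U \<longrightarrow>
     (\<forall>t. \<forall>\<phi>1\<in>L2. \<forall>\<phi>2\<in>L2.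
        integrable (\<mu> \<Otimes>\<^sub>M \<mu>)
          (\<lambda>(k1, k2). (cmod (L2_inner (U t (\<rho> k1 \<phi>1)) (\<rho> k2 \<phi>2)))\<^sup>2) \<and>
        sqrt (LINT k1|\<mu>. LINT k2|\<mu>. (cmod (L2_inner (U t (\<rho> k1 \<phi>1)) (\<rho> k2 \<phi>2)))\<^sup>2)
          \<le> C * (1 + \<bar>t\<bar>) powr (- real CARD('n) / 2) * L2_norm \<phi>1 * L2_norm \<phi>2)"
proof (intro exI[of _ "2 powr (real CARD('n) / 4)"] conjI allI impI ballI)
  show "0 < 2 powr (real CARD('n) / 4)" by simp
next
  fix \<mu> :: "'n sqmat measure" and \<rho> :: "'n sqmat \<Rightarrow> 'n fn \<Rightarrow> 'n fn" and U :: "real \<Rightarrow> 'n fn \<Rightarrow> 'n fn"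
    and t :: real and f g :: "'n fn"
  assume \<mu>: "haar_K \<mu>" and \<rho>: "metaplectic_rep \<rho>" and U: "free_schroedinger_propagator U"
    and f: "f \<in> L2" and g: "g \<in> L2"
  interpret prob_space \<mu> by (rule haar_K_prob[OF \<mu>])
  interpret P: pair_prob_space \<mu> \<mu> ..
  note sp = haar_K_space[OF \<mu>]
  define B where "B N k l = (cmod (partial_coeff t \<rho> f g N k l))\<^sup>2" for N k l
  define Q where "Q k l = (cmod (L2_inner (U t (\<rho> k f)) (\<rho> l g)))\<^sup>2" for k l
  define b where "b = (L2_norm f * L2_norm g)\<^sup>2"
  \<comment> \<open>The truncated expansions converge to the matrix coefficient for each pair of
    group elements and are bounded by one constant, since \<open>\<rho>\<close> preserves norms.
    This carries both measurability and the estimate to the limit.\<close>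
  have lim: "(\<lambda>N. B N k l) \<longlonglongrightarrow> Q k l" and Bb: "B N k l \<le> b" if "k \<in> Sp_K" "l \<in> Sp_K" for N k l
  proof -
    note kf = metaplectic_L2[OF \<rho> that(1) f] and lg = metaplectic_L2[OF \<rho> that(2) g]
    show "(\<lambda>N. B N k l) \<longlonglongrightarrow> Q k l"
      unfolding B_def Q_def partial_coeff_norm[OF \<rho> that] by (intro tendsto_intros schroedinger_expansion(1)[OF U kf lg])
    show "B N k l \<le> b"
      unfolding B_def b_def partial_coeff_norm[OF \<rho> that]
      using schroedinger_expansion(2)[OF U kf lg, where t=t and N=N] metaplectic_norm[OF \<rho> that(1) f] metaplectic_norm[OF \<rho> that(2) g]
      by (intro power_mono) auto
  qed
  have Qb: "Q k l \<le> b" if "k \<in> Sp_K" "l \<in> Sp_K" for k l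
    by (rule LIMSEQ_le_const2[OF lim[OF that]]) (use Bb[OF that] in auto)
  have B0: "B N k l \<ge> 0" and Q0: "Q k l \<ge> 0" for N k l by (simp_all add: B_def Q_def)
  have Bm: "(\<lambda>(k, l). B N k l) \<in> borel_measurable (\<mu> \<Otimes>\<^sub>M \<mu>)" for N
  proof -
    note [measurable] = rcoeff_measurable[OF \<mu> \<rho> f] rcoeff_measurable[OF \<mu> \<rho> g]
    show ?thesis unfolding B_def partial_coeff_def by measurable
  qed
  \<comment> \<open>The operators \<open>\<rho>\<close> and \<open>U\<close> come without any
    regularity in the group elements, so measurability is inherited from the truncations as a
    pointwise limit.\<close>
  have Qm: "(\<lambda>(k, l). Q k l) \<in> borel_measurable (\<mu> \<Otimes>\<^sub>M \<mu>)"
    by (rule borel_measurable_LIMSEQ_metric[OF Bm]) (use lim sp in \<open>auto simp: space_pair_measure\<close>)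
  have Qi: "integrable (\<mu> \<Otimes>\<^sub>M \<mu>) (\<lambda>(k, l). Q k l)"
    by (rule P.integrable_const_bound[OF _ Qm, where B=b]) (use Qb Q0 sp in \<open>auto intro!: AE_I2 simp: space_pair_measure\<close>)
  then show "integrable (\<mu> \<Otimes>\<^sub>M \<mu>) (\<lambda>(k1, k2). (cmod (L2_inner (U t (\<rho> k1 f)) (\<rho> k2 g)))\<^sup>2)"
    unfolding Q_def .
  have Bi: "integrable (\<mu> \<Otimes>\<^sub>M \<mu>) (\<lambda>(k, l). B N k l)" for N
    by (rule P.integrable_const_bound[OF _ Bm, where B=b]) (use Bb B0 sp in \<open>auto intro!: AE_I2 simp: space_pair_measure\<close>)
  have "(\<lambda>N. LINT p|(\<mu> \<Otimes>\<^sub>M \<mu>). (\<lambda>(k, l). B N k l) p) \<longlonglongrightarrow> (LINT p|(\<mu> \<Otimes>\<^sub>M \<mu>). (\<lambda>(k, l). Q k l) p)"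
    by (rule integral_dominated_convergence[where w="\<lambda>_. b"])
      (use Qm Bm lim Bb B0 sp in \<open>auto intro!: AE_I2 simp: space_pair_measure\<close>)
  moreover have "(LINT p|(\<mu> \<Otimes>\<^sub>M \<mu>). (\<lambda>(k, l). B N k l) p) \<le> ((1 + t\<^sup>2) powr (- real CARD('n) / 4))\<^sup>2 * (L2_norm f)\<^sup>2 * (L2_norm g)\<^sup>2" for N
    using partial_coeff_mean_square[OF \<mu> \<rho> f g, of t N] P.integral_fst'[OF Bi, of N] by (simp add: B_def)
  ultimately have "(LINT p|(\<mu> \<Otimes>\<^sub>M \<mu>). (\<lambda>(k, l). Q k l) p) \<le> ((1 + t\<^sup>2) powr (- real CARD('n) / 4))\<^sup>2 * (L2_norm f)\<^sup>2 * (L2_norm g)\<^sup>2"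
    by (meson LIMSEQ_le_const2)
  then have "(LINT k|\<mu>. LINT l|\<mu>. Q k l) \<le> ((1 + t\<^sup>2) powr (- real CARD('n) / 4) * L2_norm f * L2_norm g)\<^sup>2"
    using P.integral_fst'[OF Qi] by (simp add: power_mult_distrib)
  from real_sqrt_le_mono[OF this]
  have "sqrt (LINT k|\<mu>. LINT l|\<mu>. Q k l) \<le> (1 + t\<^sup>2) powr (- real CARD('n) / 4) * L2_norm f * L2_norm g" by simp
  also have "\<dots> \<le> 2 powr (real CARD('n) / 4) * (1 + \<bar>t\<bar>) powr (- real CARD('n) / 2) * L2_norm f * L2_norm g"
    by (intro mult_right_mono one_plus_square_powr_le) auto
  finally show "sqrt (LINT k1|\<mu>. LINT k2|\<mu>. (cmod (L2_inner (U t (\<rho> k1 f)) (\<rho> k2 g)))\<^sup>2)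
     \<le> 2 powr (real CARD('n) / 4) * (1 + \<bar>t\<bar>) powr (- real CARD('n) / 2) * L2_norm f * L2_norm g"
    unfolding Q_def .
qed

end
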